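(* Let $\beta\in(0,1)$, $A<0$, let $h:\mathbb{R}\to\mathbb{R}$ be measurable, and let $\mathcal{E}$, with $\|\cdot\|_{\mathcal{X}}$, be the class of initial conditions $\xi=\xi^{(1)}+\xi^{(2)}+\xi^{(3)}$, $\xi^{(i)}\in\mathcal{E}^i$, defined in the context. For $\xi\in\mathcal{E}$ consider $$X(t)=\xi_t+\frac{1}{\Gamma(\beta)}\int_0^t (t-s)^{\beta-1}A X(s)\,ds+\frac{1}{\Gamma(\beta)}\int_0^t (t-s)^{\beta-1}h(X(s))\,ds,\qquad t\ge0.\qquad ( * )$$ (a) If there are $\delta_0>0$ and $C>0$ such that $A+C<0$ and $|h(x)|\le C|x|$ for $|x|<\delta_0$, then any continuous solution of $( * )$ is asymptotically $\mathcal{E}$-stable. (b) If there is a constant $C>0$ such that $A+C<0$ and $|h(x)|\le C|x|$ for all $x\in\mathbb{R}$, then any continuous solution of $( * )$ is globally $\mathcal{E}$-stable in the large.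
   Context: $\Gamma$ is the Gamma function and $E_{a,b}(z)=\sum_{k\ge0} z^k/\Gamma(ka+b)$ is the Mittag-Leffler function. The classes of initial conditions are: - $\mathcal{E}^1$: the continuous functions $\xi$ on $[0,\infty)$ for which there is $\xi_\infty\in\mathbb{R}$ such that, given $\varepsilon>0$, there exists $t_0>0$ with $|\xi_s-\xi_\infty|\le\varepsilon$ for any $s\ge t_0$; here $\|\xi\|_{\mathcal{X}^1}=\sup_{t\ge0}|\xi_t|$. - $\mathcal{E}^2$: the functions $\xi$ with a continuous derivative on $\mathbb{R}_+$ such that $\lim_{t\to\infty}|\xi_t|/t^\beta=0$ and $|\xi_t'|\le \tilde C/t^{1-\upsilon}$ for some $\upsilon\in(0,\beta)$ and some $\tilde C\in\mathbb{R}$; here $\|\xi\|_{\mathcal{X}^2}=\sup_{t\ge0}|\xi_tE_{\beta,1}(At^\beta)|+\sup_{t\ge0}|t^{1-\upsilon}\xi'_t|$. - $\mathcal{E}^3$: the continuous functions of the form $\xi_t=\frac{1}{\Gamma(\eta)}\int_0^t(t-s)^{\eta-1}g(s)\,ds$ with $g\in L^1([0,\infty))\cap L^{p}([0,\infty))$, $\eta\in(0,\beta+1)$ and $p>\max(1/\eta,1)$; here $\|\xi\|_{\mathcal{X}^3}=\|g\|_{L^1([0,\infty))}+\|g\|_{L^{p}([0,\infty))}$. $\mathcal{E}=\{\xi\in C([0,\infty)):\ \xi=\sum_{i=1}^3\xi^{(i)},\ \xi^{(i)}\in\mathcal{E}^i\}$, with $\|\xi\|_{\mathcal{X}}=\sum_{i=1}^3\|\xi^{(i)}\|_{\mathcal{X}^i}$.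 A solution $X$ of $( * )$ is said to be: globally $\mathcal{E}$-stable in the large if $X(t)\to0$ as $t\to\infty$ for every $\xi\in\mathcal{E}$; $\mathcal{E}$-stable if for $\varepsilon>0$ there is $\delta>0$ such that $\sup_{t\ge0}|X(t)|<\varepsilon$ for every $\xi\in\mathcal{E}$ satisfying $\|\xi\|_{\mathcal{X}}<\delta$; asymptotically $\mathcal{E}$-stable if it is $\mathcal{E}$-stable and there is $\delta>0$ such that $\lim_{t\to\infty}X(t)=0$ for any $\xi\in\mathcal{E}$ with $\|\xi\|_{\mathcal{X}}<\delta$. *)

theory Defs
  imports "HOL-Analysis.Analysis"
begin

text \<open>
  Functions on \<open>[0,\<infinity>)\<close> are represented by functions \<open>real \<Rightarrow> real\<close> of which only the values
  at nonnegative arguments matter. Suprema and norms are taken in \<open>ereal\<close>, so that unbounded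
  functions have supremum \<open>\<infinity>\<close>.
\<close>

definition mittag_leffler :: "real \<Rightarrow> real \<Rightarrow> real \<Rightarrow> real" where
  "mittag_leffler a b z = (\<Sum>k. z ^ k / Gamma (real k * a + b))"

text \<open>Riemann--Liouville integral of order \<open>a\<close>.\<close>

definition frac_integral :: "real \<Rightarrow> (real \<Rightarrow> real) \<Rightarrow> real \<Rightarrow> real" where
  "frac_integral a f t = 1 / Gamma a * (LBINT s:{0..t}. (t - s) powr (a - 1) * f s)"

definition sup_norm :: "(real \<Rightarrow> real) \<Rightarrow> ereal" where
  "sup_norm f = (SUP t\<in>{0..}. ereal \<bar>f t\<bar>)"


definition IC1 :: "(real \<Rightarrow> real) set" where
  "IC1 = {\<xi>. continuous_on {0..} \<xi> \<and>
     (\<exists>\<xi>inf. \<forall>\<epsilon>>0. \<exists>t0>0. \<forall>s\<ge>t0. \<bar>\<xi> s - \<xi>inf\<bar> \<le> \<epsilon>)}"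

definition norm_X1 :: "(real \<Rightarrow> real) \<Rightarrow> ereal" where
  "norm_X1 \<xi> = sup_norm \<xi>"


text \<open>
  The derivative is only required on \<open>(0,\<infinity>)\<close>, since the bound \<open>C / t powr (1 - \<upsilon>)\<close>
  allows it to blow up at the origin. Continuity at \<open>0\<close> is not imposed here: it
  follows in the class \<open>IC\<close> below, whose elements are continuous on \<open>[0,\<infinity>)\<close>, as are those of
  \<open>IC1\<close> and \<open>IC3\<close>.
\<close>

definition IC2 :: "real \<Rightarrow> (real \<Rightarrow> real) set" where
  "IC2 \<beta> = {\<xi>. \<xi> differentiable_on {0<..} \<and> continuous_on {0<..} (deriv \<xi>) \<and>
     ((\<lambda>t. \<bar>\<xi> t\<bar> / t powr \<beta>) \<longlongrightarrow> 0) at_top \<and>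
     (\<exists>\<upsilon>\<in>{0<..<\<beta>}. \<exists>C. \<forall>t>0. \<bar>deriv \<xi> t\<bar> \<le> C / t powr (1 - \<upsilon>))}"

text \<open>
  The exponent \<open>\<upsilon>\<close> may depend on the function and need not be unique; as in \<open>norm_X3\<close> and
  \<open>norm_X\<close> below, a norm that refers to a representation of \<open>\<xi>\<close> is the infimum over the
  admissible representations. Thus \<open>norm < \<delta>\<close> says that some representation has norm below
  \<open>\<delta>\<close>.
\<close>

definition norm_X2 :: "real \<Rightarrow> real \<Rightarrow> (real \<Rightarrow> real) \<Rightarrow> ereal" where
  "norm_X2 A \<beta> \<xi> = (INF \<upsilon>\<in>{0<..<\<beta>}.
     sup_norm (\<lambda>t. \<xi> t * mittag_leffler \<beta> 1 (A * t powr \<beta>)) +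
     (SUP t\<in>{0<..}. ereal \<bar>t powr (1 - \<upsilon>) * deriv \<xi> t\<bar>))"


definition L1_Lp :: "real \<Rightarrow> (real \<Rightarrow> real) set" where
  "L1_Lp p = {g. set_integrable lborel {0..} g \<and>
     set_integrable lborel {0..} (\<lambda>s. \<bar>g s\<bar> powr p)}"

definition Lp_norm :: "real \<Rightarrow> (real \<Rightarrow> real) \<Rightarrow> real" where
  "Lp_norm p g = (LBINT s:{0..}. \<bar>g s\<bar> powr p) powr (1 / p)"

definition IC3_densities :: "real \<Rightarrow> real \<Rightarrow> (real \<Rightarrow> real) \<Rightarrow> (real \<Rightarrow> real) set" where
  "IC3_densities \<eta> p \<xi> = {g \<in> L1_Lp p. \<forall>t\<ge>0. \<xi> t = frac_integral \<eta> g t}"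

definition IC3 :: "real \<Rightarrow> real \<Rightarrow> (real \<Rightarrow> real) set" where
  "IC3 \<eta> p = {\<xi>. continuous_on {0..} \<xi> \<and> IC3_densities \<eta> p \<xi> \<noteq> {}}"

definition norm_X3 :: "real \<Rightarrow> real \<Rightarrow> (real \<Rightarrow> real) \<Rightarrow> ereal" where
  "norm_X3 \<eta> p \<xi> = (INF g\<in>IC3_densities \<eta> p \<xi>. ereal (Lp_norm 1 g + Lp_norm p g))"


definition IC_decompositions ::
  "real \<Rightarrow> real \<Rightarrow> real \<Rightarrow> (real \<Rightarrow> real) \<Rightarrow> ((real \<Rightarrow> real) \<times> (real \<Rightarrow> real) \<times> (real \<Rightarrow> real)) set"
where
  "IC_decompositions \<beta> \<eta> p \<xi> =
     {(\<xi>1, \<xi>2, \<xi>3). \<xi>1 \<in> IC1 \<and> \<xi>2 \<in> IC2 \<beta> \<and> \<xi>3 \<in> IC3 \<eta> p \<and>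
        (\<forall>t\<ge>0. \<xi> t = \<xi>1 t + \<xi>2 t + \<xi>3 t)}"

definition IC :: "real \<Rightarrow> real \<Rightarrow> real \<Rightarrow> (real \<Rightarrow> real) set" where
  "IC \<beta> \<eta> p = {\<xi>. continuous_on {0..} \<xi> \<and> IC_decompositions \<beta> \<eta> p \<xi> \<noteq> {}}"

definition norm_X :: "real \<Rightarrow> real \<Rightarrow> real \<Rightarrow> real \<Rightarrow> (real \<Rightarrow> real) \<Rightarrow> ereal" where
  "norm_X A \<beta> \<eta> p \<xi> =
     (INF (\<xi>1, \<xi>2, \<xi>3)\<in>IC_decompositions \<beta> \<eta> p \<xi>.
        norm_X1 \<xi>1 + norm_X2 A \<beta> \<xi>2 + norm_X3 \<eta> p \<xi>3)"


text \<open>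
  Integrability is part of the notion of solution: \<open>h\<close> is merely measurable, and the Bochner
  integral of a non-integrable function is \<open>0\<close> by convention.
\<close>

definition continuous_solution ::
  "real \<Rightarrow> real \<Rightarrow> (real \<Rightarrow> real) \<Rightarrow> (real \<Rightarrow> real) \<Rightarrow> (real \<Rightarrow> real) \<Rightarrow> bool"
where
  "continuous_solution \<beta> A h \<xi> X \<longleftrightarrow> continuous_on {0..} X \<and>
     (\<forall>t\<ge>0. set_integrable lborel {0..t} (\<lambda>s. (t - s) powr (\<beta> - 1) * (A * X s)) \<and>
            set_integrable lborel {0..t} (\<lambda>s. (t - s) powr (\<beta> - 1) * h (X s)) \<and>
            X t = \<xi> t + frac_integral \<beta> (\<lambda>s. A * X s) t + frac_integral \<beta> (\<lambda>s. h (X s)) t)"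

text \<open>
  Stability concerns the dependence of solutions on \<open>\<xi>\<close>. Each notion below is required of all
  continuous solutions belonging to an initial condition, with \<open>\<delta>\<close> independent of the
  solution; neither existence nor uniqueness is presupposed.
\<close>

definition globally_IC_stable_in_the_large ::
  "real \<Rightarrow> real \<Rightarrow> (real \<Rightarrow> real) \<Rightarrow> real \<Rightarrow> real \<Rightarrow> bool"
where
  "globally_IC_stable_in_the_large \<beta> A h \<eta> p \<longleftrightarrow>
     (\<forall>\<xi>\<in>IC \<beta> \<eta> p. \<forall>X. continuous_solution \<beta> A h \<xi> X \<longrightarrow> (X \<longlongrightarrow> 0) at_top)"

definition IC_stable :: "real \<Rightarrow> real \<Rightarrow> (real \<Rightarrow> real) \<Rightarrow> real \<Rightarrow> real \<Rightarrow> bool" where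
  "IC_stable \<beta> A h \<eta> p \<longleftrightarrow>
     (\<forall>\<epsilon>>0. \<exists>\<delta>>0. \<forall>\<xi>\<in>IC \<beta> \<eta> p. norm_X A \<beta> \<eta> p \<xi> < ereal \<delta> \<longrightarrow>
        (\<forall>X. continuous_solution \<beta> A h \<xi> X \<longrightarrow> sup_norm X < ereal \<epsilon>))"

definition asymptotically_IC_stable ::
  "real \<Rightarrow> real \<Rightarrow> (real \<Rightarrow> real) \<Rightarrow> real \<Rightarrow> real \<Rightarrow> bool"
where
  "asymptotically_IC_stable \<beta> A h \<eta> p \<longleftrightarrow>
     IC_stable \<beta> A h \<eta> p \<and>
     (\<exists>\<delta>>0. \<forall>\<xi>\<in>IC \<beta> \<eta> p. norm_X A \<beta> \<eta> p \<xi> < ereal \<delta> \<longrightarrow>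
        (\<forall>X. continuous_solution \<beta> A h \<xi> X \<longrightarrow> (X \<longlongrightarrow> 0) at_top))"

end

theory Submission
  imports Defs
begin

text \<open>
  With \<open>a = - A\<close>, let \<open>rho t = t powr (b - 1) * E(b,b)(- a * t powr b)\<close> be the resolvent of the
  fractional kernel. Variation of constants turns the equation into \<open>X = lin \<xi> + rho * h(X)\<close> (convolution),
  where \<open>lin f = f - a * (rho * f)\<close>. Since \<open>rho\<close> is nonnegative with integral \<open>1 / a\<close> and \<open>C < a\<close>, the
  nonlinear term is a contraction with fading memory, and everything reduces to showing that \<open>lin \<xi>\<close> is
  small and tends to \<open>0\<close> for each of the three classes.

  That \<open>rho\<close> is nonnegative follows from log-convexity of the kernel. Monotonicity of \<open>rho\<close> then comes
  from the resolvent identity \<open>rho\<^sub>a - rho\<^sub>c = (c - a) (rho\<^sub>a * rho\<^sub>c)\<close> and self-similarity, and yields the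
  decay \<open>rho t = O(t powr (- b - 1))\<close> without any complex analysis. On slowly varying functions this
  decay gains a factor \<open>t powr (- b)\<close>, which settles \<open>IC2\<close>, and also \<open>IC3\<close>, where \<open>lin\<close> acts on the
  fractional kernel of order \<open>\<eta>\<close> before it is convolved with the density.
\<close>

section \<open>Convolution of fractional kernels\<close>

text \<open>Why \<open>lin\<close> should decay: \<open>a * rho\<close> is a probability density, so
  \<open>lin f t\<close> compares \<open>f t\<close> with an average of its past. This settles
  convergent data (\<open>IC1\<close>). Members of \<open>IC2\<close> and \<open>IC3\<close> may be
  unbounded, and there the rate matters: the bound t^(-b-1) on \<open>rho\<close> gives a first
  moment of order t^(1-b) up to time t, so a Lipschitz constant D on the recent half of the past
  costs D * t^(1-b). For \<open>IC2\<close>, D is of order t^(v-1), and the product decays because v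
  < b. For the kernel of order \<eta>, D is of order t^(\<eta>-2), and it decays because \<eta> < b
  + 1. The condition p > 1/\<eta> makes u^(\<eta>-1) locally integrable to the exponent conjugate to
  p. A second obstacle is that a solution is not known to be bounded beforehand and \<open>h\<close>
  is merely measurable. Functions are therefore truncated at the current time T, and the estimates
  use \<open>h\<close> only along the path before T. This is what lets the local and the global
  statement share their lemmas.\<close>

lemma integrable_dominated:
  fixes f g :: "'a \<Rightarrow> real"
  assumes "integrable M g" "f \<in> borel_measurable M" "\<And>x. \<bar>f x\<bar> \<le> g x"
  shows "integrable M f"
  by (rule Bochner_Integration.integrable_bound[OF assms(1,2)])
    (use assms(3) in \<open>auto intro!: always_eventually order_trans[OF _ abs_ge_self]\<close>)

text \<open>Integrating over the whole line makes commutativity a bare substitution, valid without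
  integrability. Since a divergent Bochner integral is 0, integrability facts accompany the
  identities that split or reorder integrals.\<close>

definition conv :: "(real \<Rightarrow> real) \<Rightarrow> (real \<Rightarrow> real) \<Rightarrow> real \<Rightarrow> real" where
  "conv f g t = (LBINT s. f (t - s) * g s)"

lemma conv_commute: "conv f g t = conv g f t"
  unfolding conv_def
  by (subst lborel_integral_real_affine[where c="-1" and t=t]) (auto simp: mult.commute)

lemma conv_integrable_commute:
  fixes f g :: "real \<Rightarrow> real"
  shows "integrable lborel (\<lambda>s. f (t - s) * g s) \<longleftrightarrow> integrable lborel (\<lambda>s. g (t - s) * f s)"
  by (subst lborel_integrable_real_affine_iff[where c="-1" and t=t, symmetric]) (auto simp: mult.commute)

lemma conv_measurable[measurable]:
  assumes [measurable]: "f \<in> borel_measurable borel" "g \<in> borel_measurable borel"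
  shows "conv f g \<in> borel_measurable borel"
  unfolding conv_def by measurable

text \<open>Only the products have to agree, so a function may be truncated wherever the kernel
  vanishes.\<close>

lemma conv_cong:
  assumes "\<And>s. f (t - s) * g s = f' (t - s) * g' s"
  shows "conv f g t = conv f' g' t"
  unfolding conv_def using assms by simp

lemma conv_nonneg:
  assumes "\<And>s. 0 \<le> f s" "\<And>s. 0 \<le> g s"
  shows "0 \<le> conv f g t"
  unfolding conv_def by (intro Bochner_Integration.integral_nonneg) (use assms in auto)

lemma abs_conv_le: "\<bar>conv f g t\<bar> \<le> conv (\<lambda>s. \<bar>f s\<bar>) (\<lambda>s. \<bar>g s\<bar>) t"
  unfolding conv_def
  using integral_norm_bound[of lborel "\<lambda>s. f (t - s) * g s"] by (simp add: abs_mult)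

text \<open>Fubini for the double integrand \<open>?F\<close>; the last hypothesis is its absolute
  integrability, already written as an iterated convolution because that is the quantity the
  applications can dominate.\<close>

lemma conv_assoc:
  fixes f g h :: "real \<Rightarrow> real"
  assumes [measurable]: "f \<in> borel_measurable borel" "g \<in> borel_measurable borel" "h \<in> borel_measurable borel"
  assumes gh: "\<And>s. integrable lborel (\<lambda>u. g (s - u) * h u)"
  assumes fgh: "integrable lborel (\<lambda>s. \<bar>f (t - s)\<bar> * conv (\<lambda>u. \<bar>g u\<bar>) (\<lambda>u. \<bar>h u\<bar>) s)"
  shows "conv f (conv g h) t = conv (conv f g) h t"
proof -
  let ?F = "\<lambda>s u. f (t - s) * (g (s - u) * h u)"
  have "integrable (lborel \<Otimes>\<^sub>M lborel) (case_prod ?F)"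
  proof (rule lborel_pair.Fubini_integrable)
    have "(\<lambda>s. LBINT u. norm (case_prod ?F (s, u))) = (\<lambda>s. \<bar>f (t - s)\<bar> * conv (\<lambda>u. \<bar>g u\<bar>) (\<lambda>u. \<bar>h u\<bar>) s)"
      by (simp add: conv_def abs_mult)
    then show "integrable lborel (\<lambda>s. LBINT u. norm (case_prod ?F (s, u)))"
      using fgh by simp
    show "AE s in lborel. integrable lborel (\<lambda>u. case_prod ?F (s, u))"
      using gh by auto
  qed simp
  then have "(LBINT u. LBINT s. ?F s u) = (LBINT s. LBINT u. ?F s u)"
    by (rule lborel_pair.Fubini_integral)
  moreover have "(LBINT s. LBINT u. ?F s u) = conv f (conv g h) t"
    by (simp add: conv_def)
  moreover have "(LBINT s. ?F s u) = conv f g (t - u) * h u" for u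
  proof -
    have "(LBINT s. ?F s u) = (LBINT s. f (t - s) * g (s - u)) * h u"
      by (simp add: mult.assoc[symmetric])
    also have "(LBINT s. f (t - s) * g (s - u)) = conv f g (t - u)"
      unfolding conv_def
      by (subst lborel_integral_real_affine[where c=1 and t=u]) (auto simp: algebra_simps)
    finally show ?thesis .
  qed
  ultimately show ?thesis
    by (simp add: conv_def)
qed

text \<open>
  Kernels vanish on the negative half-line, so that convolutions over the whole line are integrals over
  \<open>{0..t}\<close>. The value at \<open>0\<close> is set to \<open>0\<close> as well, whatever the order.
\<close>

definition kern :: "real \<Rightarrow> real \<Rightarrow> real" where
  "kern c t = (if 0 < t then t powr (c - 1) / Gamma c else 0)"

lemma kern_measurable[measurable]: "kern c \<in> borel_measurable borel"
  unfolding kern_def by measurable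

lemma kern_nonneg: "0 < c \<Longrightarrow> 0 \<le> kern c t"
  by (simp add: kern_def Gamma_real_pos less_imp_le)

lemma kern_pos: "0 < c \<Longrightarrow> 0 < t \<Longrightarrow> 0 < kern c t"
  by (simp add: kern_def Gamma_real_pos)

lemma kern_one: "0 < t \<Longrightarrow> kern 1 t = 1"
  by (simp add: kern_def)

lemma has_bochner_integral_Beta:
  fixes x y :: real
  assumes "0 < x" "0 < y"
  shows "has_bochner_integral lborel (\<lambda>s. indicator {0..1} s * (s powr (x - 1) * (1 - s) powr (y - 1))) (Beta x y)"
proof (rule has_bochner_integral_nn_integral)
  have "0 < Beta x y"
    using assms by (simp add: Beta_def Gamma_real_pos)
  then show "0 \<le> Beta x y" by simp
  show "(\<integral>\<^sup>+ s. ennreal (indicator {0..1} s * (s powr (x - 1) * (1 - s) powr (y - 1))) \<partial>lborel) = ennreal (Beta x y)"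
    using nn_integral_has_integral_lebesgue[OF _ has_integral_Beta_real[OF assms]]
    by (simp add: mult.commute)
qed auto

text \<open>Semigroup law of fractional integration: rescaling \<open>{0..t}\<close> to
  \<open>{0..1}\<close> leaves a Beta integral, and the Gamma factors in \<open>kern\<close> are
  exactly those that normalize it.\<close>

lemma has_bochner_integral_kern:
  assumes "0 < x" "0 < y"
  shows "has_bochner_integral lborel (\<lambda>s. kern x (t - s) * kern y s) (kern (x + y) t)"
proof (cases "0 < t")
  case False
  then have "(\<lambda>s. kern x (t - s) * kern y s) = (\<lambda>s. 0)"
    by (auto simp: kern_def)
  then show ?thesis using False by (simp add: kern_def has_bochner_integral_zero)
next
  case True
  let ?B = "\<lambda>s. indicator {0..1} s * (s powr (y - 1) * (1 - s) powr (x - 1))"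
  let ?c = "t powr (x + y - 2) / (Gamma x * Gamma y)"
  have "has_bochner_integral lborel (\<lambda>s. ?c * ?B (0 + (1/t) * s)) (?c * (Beta y x /\<^sub>R \<bar>1/t\<bar>))"
    using has_bochner_integral_Beta[OF assms(2,1)] True
    by (intro has_bochner_integral_mult_right) (subst (asm) lborel_has_bochner_integral_real_affine_iff[where c="1/t" and t=0], auto)
  moreover have "?c * (Beta y x /\<^sub>R \<bar>1/t\<bar>) = kern (x + y) t"
  proof -
    have "t powr (x + y - 2) * t = t powr (x + y - 1)"
      using True by (simp add: powr_mult_base mult.commute algebra_simps)
    then show ?thesis
      using True Gamma_real_pos[OF assms(1)] Gamma_real_pos[OF assms(2)]
      by (simp add: kern_def Beta_def add.commute field_simps)
  qed
  moreover have "?c * ?B (0 + (1/t) * s) = kern x (t - s) * kern y s" for s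
  proof (cases "0 < s \<and> s < t")
    case inside: True
    have "(s / t) powr (y - 1) * (1 - s / t) powr (x - 1) = s powr (y-1) * (t - s) powr (x-1) / t powr (x + y - 2)"
    proof -
      have "1 - s / t = (t - s) / t" using True by (simp add: field_simps)
      moreover have "t powr (x + y - 2) = t powr (y - 1) * t powr (x - 1)"
        using True by (simp add: powr_add[symmetric] add.commute)
      ultimately show ?thesis using inside by (simp add: powr_divide)
    qed
    then show ?thesis
      using inside True by (simp add: kern_def indicator_def field_simps)
  next
    case False
    then show ?thesis using True
      by (auto simp: kern_def indicator_def field_simps)
  qed
  ultimately show ?thesis by simp
qed

lemma kern_integrable: "0 < x \<Longrightarrow> 0 < y \<Longrightarrow> integrable lborel (\<lambda>s. kern x (t - s) * kern y s)"
  and conv_kern: "0 < x \<Longrightarrow> 0 < y \<Longrightarrow> conv (kern x) (kern y) t = kern (x + y) t"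
  using has_bochner_integral_kern[of x y t] by (auto simp: has_bochner_integral_iff conv_def)

section \<open>Mittag-Leffler functions\<close>

text \<open>The factor \<open>R powr (x - 1)\<close> with arbitrary \<open>R\<close> makes the Mittag-Leffler series converge everywhere.\<close>

lemma Gamma_real_ge_powr:
  fixes x R :: real
  assumes "1 \<le> x" "1 \<le> R"
  shows "R powr (x - 1) / exp (R + 1) \<le> Gamma x"
proof -
  have sub: "(\<lambda>t. t powr (x - 1) / exp t) integrable_on {R..R+1}"
    by (rule integrable_continuous_real) (use assms in \<open>auto intro!: continuous_intros\<close>)
  \<comment> \<open>On this window of length 1 the Gamma integrand has numerator at least
    \<open>R powr (x - 1)\<close> and denominator at most \<open>exp (R + 1)\<close>.\<close>
  have "integral {R..R+1} (\<lambda>t. R powr (x - 1) / exp (R + 1)) \<le> integral {R..R+1} (\<lambda>t. t powr (x - 1) / exp t)"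
    by (intro integral_le sub frac_le powr_mono2) (use assms in auto)
  also have "\<dots> \<le> integral {0..} (\<lambda>t. t powr (x - 1) / exp t)"
    by (intro integral_subset_le sub has_integral_integrable[OF Gamma_integral_real])
      (use assms in auto)
  also have "\<dots> = Gamma x"
    by (intro integral_unique Gamma_integral_real) (use assms in auto)
  finally show ?thesis by simp
qed

lemma mittag_leffler_summable:
  assumes "0 < b" "0 < c"
  shows "summable (\<lambda>k. \<bar>z\<bar> ^ k / Gamma (real k * b + c))"
proof -
  \<comment> \<open>\<open>R\<close> is large enough for \<bar>z\<bar> to be at most half of
    \<open>R powr b\<close>, so the series is eventually dominated by a geometric one of ratio
    1/2.\<close>
  define R where "R = max 1 ((2 * \<bar>z\<bar>) powr (1 / b))"
  have R: "1 \<le> R" by (simp add: R_def)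
  have zR: "\<bar>z\<bar> \<le> R powr b / 2"
  proof -
    have "2 * \<bar>z\<bar> = ((2 * \<bar>z\<bar>) powr (1 / b)) powr b"
      using assms by (simp add: powr_powr)
    also have "\<dots> \<le> R powr b"
      by (intro powr_mono2) (use assms in \<open>auto simp: R_def\<close>)
    finally show ?thesis by simp
  qed
  have "eventually (\<lambda>k. norm (\<bar>z\<bar> ^ k / Gamma (real k * b + c)) \<le> (exp (R + 1) * R powr (1 - c)) * (1/2) ^ k) sequentially"
  proof -
    have "filterlim (\<lambda>k. real k * b + c) at_top sequentially"
      using filterlim_tendsto_add_at_top[OF tendsto_const[of c]
          filterlim_tendsto_pos_mult_at_top[OF tendsto_const[of b] \<open>0 < b\<close> filterlim_real_sequentially]]
      by (simp add: algebra_simps)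
    then have "eventually (\<lambda>k. 1 \<le> real k * b + c) sequentially"
      by (simp add: filterlim_at_top)
    then show ?thesis
    proof eventually_elim
      case (elim k)
      have G: "R powr (real k * b + c - 1) / exp (R + 1) \<le> Gamma (real k * b + c)"
        by (rule Gamma_real_ge_powr) (use elim R in auto)
      have "\<bar>z\<bar> ^ k / Gamma (real k * b + c) \<le> (R powr b / 2) ^ k / (R powr (real k * b + c - 1) / exp (R + 1))"
        by (intro frac_le power_mono zR G) (use R in auto)
      also have "(R powr b) ^ k = R powr (real k * b)"
        using R by (simp add: powr_powr[symmetric] powr_realpow[symmetric] mult.commute)
      then have "(R powr b / 2) ^ k / (R powr (real k * b + c - 1) / exp (R + 1)) = (exp (R + 1) * R powr (1 - c)) * (1/2) ^ k"
        using R by (simp add: power_divide powr_add powr_diff field_simps)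
      finally show ?case
        using elim by (simp add: Gamma_real_pos)
    qed
  qed
  then show ?thesis
    by (rule summable_comparison_test_ev) (simp add: summable_geometric)
qed

lemma mittag_leffler_sums:
  assumes "0 < b" "0 < c"
  shows "(\<lambda>k. z ^ k / Gamma (real k * b + c)) sums mittag_leffler b c z"
proof -
  have "summable (\<lambda>k. norm (z ^ k / Gamma (real k * b + c)))"
  proof -
    have "norm (z ^ k / Gamma (real k * b + c)) = \<bar>z\<bar> ^ k / Gamma (real k * b + c)" for k
    proof -
      have "0 < Gamma (real k * b + c)"
        by (rule Gamma_real_pos) (use assms in \<open>simp add: add_nonneg_pos\<close>)
      then show ?thesis by (simp add: power_abs)
    qed
    then show ?thesis using mittag_leffler_summable[OF assms, of z] by simp
  qed
  then have "summable (\<lambda>k. z ^ k / Gamma (real k * b + c))"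
    by (rule summable_norm_cancel)
  then show ?thesis
    unfolding mittag_leffler_def by (rule summable_sums)
qed

lemma continuous_mittag_leffler:
  assumes "0 < b" "0 < c"
  shows "isCont (mittag_leffler b c) z"
proof -
  have "isCont (\<lambda>x. \<Sum>k. (1 / Gamma (real k * b + c)) * x ^ k) z"
    by (rule isCont_powser_converges_everywhere)
      (use mittag_leffler_sums[OF assms] in \<open>auto simp: sums_iff\<close>)
  then show ?thesis
    by (simp add: mittag_leffler_def[abs_def])
qed

lemma mittag_leffler_0: "0 < c \<Longrightarrow> 0 < b \<Longrightarrow> mittag_leffler b c 0 = 1 / Gamma c"
  using mittag_leffler_sums[of b c 0] sums_unique2 powser_sums_zero[of "\<lambda>k. 1 / Gamma (real k * b + c)"]
  by fastforce

text \<open>The function with Laplace transform s^(b-c) / (s^b + a). The order \<open>c = b\<close>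
  is the resolvent and \<open>c = 1\<close> the relaxation function; fractional integration merely
  shifts \<open>c\<close>.\<close>

definition ml :: "real \<Rightarrow> real \<Rightarrow> real \<Rightarrow> real \<Rightarrow> real" where
  "ml b a c t = (if 0 < t then t powr (c - 1) * mittag_leffler b c (- a * t powr b) else 0)"

text \<open>Seen as a series of fractional kernels, \<open>ml\<close> inherits its convolution
  identities term by term from the semigroup law.\<close>

lemma ml_sums:
  assumes "0 < b" "0 < c"
  shows "(\<lambda>n. (- a) ^ n * kern (c + real n * b) t) sums ml b a c t"
proof (cases "0 < t")
  case True
  have "(\<lambda>n. t powr (c - 1) * ((- a * t powr b) ^ n / Gamma (real n * b + c))) sums
     (t powr (c - 1) * mittag_leffler b c (- a * t powr b))"
    by (intro sums_mult mittag_leffler_sums assms)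
  moreover have "t powr (c - 1) * ((- a * t powr b) ^ n / Gamma (real n * b + c)) = (- a) ^ n * kern (c + real n * b) t" for n
  proof -
    have "t powr (c - 1) * (t powr b) ^ n = t powr (c + real n * b - 1)"
      using True by (simp add: powr_realpow[symmetric] powr_powr powr_add[symmetric] algebra_simps)
    then show ?thesis
      using True by (simp only: kern_def power_mult_distrib) (simp add: add.commute mult.left_commute)
  qed
  ultimately show ?thesis using True by (simp add: ml_def)
qed (simp add: kern_def ml_def)

text \<open>Taking absolute values replaces \<open>a\<close> by \<open>-\<bar>a\<bar>\<close>, which
  gives a series of the same family.\<close>

lemma ml_abs_summable:
  assumes "0 < b" "0 < c"
  shows "summable (\<lambda>n. norm ((- a) ^ n * kern (c + real n * b) t))"
proof -
  have "norm ((- a) ^ n * kern (c + real n * b) t) = (- (-\<bar>a\<bar>)) ^ n * kern (c + real n * b) t" for n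
    using kern_nonneg[of "c + real n * b" t] assms
    by (simp add: abs_mult power_abs add_pos_nonneg)
  then show ?thesis
    using ml_sums[OF assms, where a = "-\<bar>a\<bar>" and t = t] by (simp only: sums_iff)
qed

lemma ml_measurable[measurable]:
  assumes "0 < b" "0 < c"
  shows "ml b a c \<in> borel_measurable borel"
proof -
  have "ml b a c = (\<lambda>t. \<Sum>n. (- a) ^ n * kern (c + real n * b) t)"
    using ml_sums[OF assms] by (auto simp: sums_iff)
  then show ?thesis by simp
qed

text \<open>Termwise integration is justified because the kernels are nonnegative: the L1 norms of
  the terms form another absolute kernel series, of order \<open>x + c\<close>.\<close>

lemma conv_kern_ml:
  assumes "0 < b" "0 < c" "0 < x"
  shows "integrable lborel (\<lambda>s. kern x (t - s) * ml b a c s)" (is ?A)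
    and "conv (kern x) (ml b a c) t = ml b a (x + c) t" (is ?B)
proof -
  let ?f = "\<lambda>n s. kern x (t - s) * ((- a) ^ n * kern (c + real n * b) s)"
  have pos: "0 < c + real n * b" for n using assms by (simp add: add_pos_nonneg)
  have int: "integrable lborel (?f n)" for n
    using integrable_mult_right[OF kern_integrable[OF \<open>0 < x\<close> pos], of "(- a) ^ n"]
    by (simp add: mult.left_commute)
  have val: "(LBINT s. ?f n s) = (- a) ^ n * kern (x + c + real n * b) t" for n
    using conv_kern[OF \<open>0 < x\<close> pos, where t = t]
    by (simp add: mult.left_commute conv_def add.assoc)
  have nval: "(LBINT s. norm (?f n s)) = norm ((- a) ^ n * kern (x + c + real n * b) t)" for n
  proof -
    have "(LBINT s. norm (?f n s)) = (LBINT s. \<bar>(- a) ^ n\<bar> * (kern x (t - s) * kern (c + real n * b) s))"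
      using kern_nonneg[OF pos] kern_nonneg[OF \<open>0 < x\<close>]
      by (intro Bochner_Integration.integral_cong) (auto simp: abs_mult)
    also have "\<dots> = \<bar>(- a) ^ n\<bar> * kern (x + c + real n * b) t"
      using conv_kern[OF \<open>0 < x\<close> pos, where t = t] by (simp add: conv_def add.assoc)
    finally show ?thesis
      using kern_nonneg[of "x + c + real n * b" t] pos[of n] assms by (simp add: abs_mult add.assoc)
  qed
  have ae: "AE s in lborel. summable (\<lambda>n. norm (?f n s))"
    using summable_mult[OF ml_abs_summable[OF assms(1,2)]]
    by (simp add: abs_mult)
  have su: "summable (\<lambda>n. LBINT s. norm (?f n s))"
    unfolding nval by (rule ml_abs_summable) (use assms in auto)
  have eq: "(\<Sum>n. ?f n s) = kern x (t - s) * ml b a c s" for s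
    using sums_mult[OF ml_sums[OF assms(1,2)]] by (simp add: sums_iff)
  show ?A
    using integrable_suminf[OF int ae su] by (simp only: eq)
  have "(\<lambda>n. LBINT s. ?f n s) sums (LBINT s. kern x (t - s) * ml b a c s)"
    using sums_integral[OF int ae su] by (simp only: eq)
  moreover have "(\<lambda>n. LBINT s. ?f n s) sums ml b a (x + c) t"
    unfolding val by (rule ml_sums) (use assms in auto)
  ultimately show ?B
    unfolding conv_def by (rule sums_unique2)
qed

text \<open>The term n = 0 is split off. With \<open>conv_kern_ml\<close> this becomes the Volterra
  equation; it also gives the bounds near 0.\<close>

lemma ml_eq_kern_minus:
  assumes "0 < b" "0 < c"
  shows "ml b a c t = kern c t - a * ml b a (c + b) t"
proof -
  have "(\<lambda>n. (- a) ^ (Suc n) * kern (c + real (Suc n) * b) t) sums (- a * ml b a (c + b) t)"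
    using sums_mult[OF ml_sums[of b "c + b", where a = a and t = t], of "- a"] assms by (simp add: algebra_simps)
  then have "(\<lambda>n. (- a) ^ n * kern (c + real n * b) t) sums (- a * ml b a (c + b) t + kern c t)"
    by (subst (asm) sums_Suc_iff) simp
  from sums_unique2[OF ml_sums[OF assms] this] show ?thesis
    by simp
qed

lemma ml_nonpos: "t \<le> 0 \<Longrightarrow> ml b a c t = 0"
  by (simp add: ml_def)

lemma ml_volterra:
  assumes "0 < b" "0 < c"
  shows "ml b a c t = kern c t - a * conv (kern b) (ml b a c) t"
  using ml_eq_kern_minus[OF assms, of a t] conv_kern_ml(2)[OF assms assms(1), where a=a and t=t] by (simp add: add.commute)

lemma continuous_on_mittag_leffler_powr:
  assumes "0 < b" "0 < c"
  shows "continuous_on {0..} (\<lambda>t. mittag_leffler b c (- a * t powr b))"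
proof -
  have "continuous_on {0..} (\<lambda>t::real. - a * t powr b)"
    using assms by (intro continuous_intros continuous_on_powr') auto
  moreover have "continuous_on UNIV (mittag_leffler b c)"
    using continuous_mittag_leffler[OF assms] by (intro continuous_at_imp_continuous_on) auto
  ultimately show ?thesis
    using continuous_on_compose2 by blast
qed

lemma continuous_on_ml:
  assumes "0 < b" "0 < c"
  shows "continuous_on {0<..} (ml b a c)"
proof -
  have "continuous_on {0<..} (\<lambda>t. t powr (c - 1) * mittag_leffler b c (- a * t powr b))"
    by (intro continuous_intros continuous_on_subset[OF continuous_on_mittag_leffler_powr[OF assms]]) auto
  then show ?thesis by (rule continuous_on_eq) (simp add: ml_def)
qed

lemma has_bochner_integral_kern_shift:
  assumes "0 < x" "0 < y"
  shows "has_bochner_integral lborel (\<lambda>s. kern x (t - s) * kern y (s - r)) (kern (x + y) (t - r))"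
  using has_bochner_integral_kern[OF assms, of "t - r"]
  by (subst (asm) lborel_has_bochner_integral_real_affine_iff[where c=1 and t="-r"]) (auto simp: algebra_simps)

section \<open>Positivity, monotonicity and decay of the resolvent\<close>

text \<open>The ratio of \<open>kern b (t0 - s)\<close> to \<open>kern b (t - s)\<close> is at most
  its value at s = 0: one has t0 * (t - s) \<le> (t0 - s) * t, and the power b - 1 \<le> 0 reverses
  the inequality.\<close>

lemma kern_log_convex:
  assumes "0 < b" "b \<le> 1" "0 < s" "s < t" "t \<le> t0"
  shows "kern b (t0 - s) * kern b t \<le> kern b t0 * kern b (t - s)"
proof -
  have "t0 * (t - s) \<le> (t0 - s) * t"
    using assms by (simp add: algebra_simps)
  then have "((t0 - s) * t) powr (b - 1) \<le> (t0 * (t - s)) powr (b - 1)"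
    by (intro powr_mono2') (use assms in auto)
  then have "((t0 - s) powr (b - 1) * t powr (b - 1)) / (Gamma b * Gamma b)
      \<le> (t0 powr (b - 1) * (t - s) powr (b - 1)) / (Gamma b * Gamma b)"
    using assms by (intro divide_right_mono) (auto simp: powr_mult)
  then show ?thesis
    using assms by (simp add: kern_def)
qed

text \<open>
  At a first zero \<open>t0\<close>, log-convexity of the kernel bounds the memory of \<open>{0..t}\<close> felt at \<open>t0\<close> by the
  one felt at \<open>t\<close>. If \<open>t\<close> maximizes the solution on a short interval before \<open>t0\<close>, the rest of the
  memory cannot absorb the difference.
\<close>

lemma ml_pos:
  assumes b: "0 < b" "b \<le> 1" and a: "0 < a" and "0 < t1"
  shows "0 < ml b a b t1"
proof (rule ccontr)
  let ?r = "ml b a b" and ?k = "kern b"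
  \<comment> \<open>\<open>?r\<close> is singular at 0; without its power factor it is continuous on
    \<open>{0..}\<close> and positive at 0, so the first point with \<open>G\<close> \<le> 0 exists
    and is positive.\<close>
  define G where "G = (\<lambda>t. mittag_leffler b b (- a * t powr b))"
  have r: "?r t = t powr (b - 1) * G t" if "0 < t" for t
    using that by (simp add: ml_def G_def)
  assume "\<not> 0 < ?r t1"
  then have "G t1 \<le> 0"
    using \<open>0 < t1\<close> r[of t1] by (simp add: not_less mult_le_0_iff)
  have contG: "continuous_on {0..} G"
    unfolding G_def by (rule continuous_on_mittag_leffler_powr[OF b(1) b(1)])
  define S where "S = {0..t1} \<inter> G -` {..0}"
  have "closed S"
    unfolding S_def by (rule continuous_closed_preimage[OF continuous_on_subset[OF contG]]) auto
  moreover have "S \<subseteq> {0..t1}" by (auto simp: S_def)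
  ultimately have "compact S"
    using compact_Icc compact_Int_closed[of "{0..t1}" S] by (simp add: Int_absorb1)
  moreover have "S \<noteq> {}"
  proof -
    have "t1 \<in> S" using \<open>G t1 \<le> 0\<close> \<open>0 < t1\<close> by (simp add: S_def)
    then show ?thesis by blast
  qed
  ultimately obtain t0 where t0: "t0 \<in> S" and least: "\<And>s. s \<in> S \<Longrightarrow> t0 \<le> s"
    using compact_attains_inf[of S] by blast
  have "0 < G 0"
    using b mittag_leffler_0[of b b] by (simp add: G_def Gamma_real_pos)
  with t0 have "0 < t0"
    by (cases "t0 = 0") (auto simp: S_def)
  have before: "0 < ?r s" if "0 < s" "s < t0" for s
  proof -
    have "0 < G s" using least[of s] t0 that by (force simp: S_def)
    then show ?thesis using r that by simp
  qed
  have at_t0: "?r t0 \<le> 0"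
    using t0 r[OF \<open>0 < t0\<close>] by (simp add: mult_nonneg_nonpos S_def)
  \<comment> \<open>The first bound keeps t above t0/2, which makes K \<ge> 1/2. The second keeps a
    times the kernel mass of the last interval below 1/4. The contradiction needs only 1/2 >
    1/4.\<close>
  define d where "d = min (t0 / 2) ((Gamma (b + 1) / (4 * a)) powr (1 / b))"
  have G1: "0 < Gamma (b + 1)" using b by (simp add: Gamma_real_pos)
  have d: "0 < d" "d \<le> t0 / 2" using \<open>0 < t0\<close> G1 a by (auto simp: d_def)
  have "d powr b \<le> ((Gamma (b + 1) / (4 * a)) powr (1 / b)) powr b"
    using b d by (intro powr_mono2) (auto simp: d_def)
  also have "\<dots> = Gamma (b + 1) / (4 * a)"
    using b a G1 by (simp add: powr_powr)
  finally have dp: "a * (d powr b / Gamma (b + 1)) \<le> 1 / 4"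
    using a G1 by (simp add: field_simps)
  have "continuous_on {t0 - d..t0} ?r"
    by (rule continuous_on_subset[OF continuous_on_ml[OF b(1) b(1)]]) (use d \<open>0 < t0\<close> in auto)
  then obtain t where t: "t \<in> {t0 - d..t0}" and tmax: "\<forall>s\<in>{t0 - d..t0}. ?r s \<le> ?r t"
    using continuous_attains_sup[of "{t0 - d..t0}" ?r] d by auto
  have "0 < ?r (t0 - d)" by (rule before) (use d \<open>0 < t0\<close> in auto)
  also have "\<dots> \<le> ?r t" using tmax d by auto
  finally have rt: "0 < ?r t" .
  have "t < t0" using rt at_t0 t by (cases "t = t0") auto
  have "0 < t" "t0 / 2 \<le> t" using t d \<open>0 < t0\<close> by auto
  \<comment> \<open>The ratio of the two kernels at s = 0, which bounds their ratio on all of (0, t)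
    by log-convexity.\<close>
  define K where "K = ?k t0 / ?k t"
  have kt: "0 < ?k t" "0 < ?k t0" using b \<open>0 < t\<close> \<open>0 < t0\<close> by (auto intro: kern_pos)
  have K: "1 / 2 \<le> K"
  proof -
    have "(1/2) * t powr (b - 1) \<le> (1/2) * (t0 / 2) powr (b - 1)"
      by (intro mult_left_mono powr_mono2') (use b \<open>t0 / 2 \<le> t\<close> \<open>0 < t0\<close> in auto)
    also have "\<dots> = (1/2) powr 1 * (1/2) powr (b - 1) * t0 powr (b - 1)"
      using powr_mult[of t0 "1/2" "b - 1"] \<open>0 < t0\<close> by simp
    also have "\<dots> = (1/2) powr b * t0 powr (b - 1)"
      by (subst powr_add[symmetric]) simp
    also have "\<dots> \<le> 1 * t0 powr (b - 1)"
      using b by (intro mult_right_mono powr_le1) auto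
    finally show ?thesis
      using \<open>0 < t\<close> \<open>0 < t0\<close> Gamma_real_pos[OF b(1)] by (simp add: K_def kern_def field_simps)
  qed
  have int: "integrable lborel (\<lambda>s. ?k (t - s) * ?r s)" for t
    by (rule conv_kern_ml) (use b in auto)
  have tail: "has_bochner_integral lborel (\<lambda>s. ?k (t0 - s) * kern 1 (s - t)) (kern (b + 1) (t0 - t))"
    by (rule has_bochner_integral_kern_shift) (use b in auto)
  have "conv ?k ?r t0 \<le> (LBINT s. K * (?k (t - s) * ?r s) + ?r t * (?k (t0 - s) * kern 1 (s - t)))"
    unfolding conv_def
  proof (rule integral_mono_AE)
    \<comment> \<open>The point s = t is excluded because both kernels on the right take the value 0
      there by convention.\<close>
    show "AE s in lborel. ?k (t0 - s) * ?r s \<le> K * (?k (t - s) * ?r s) + ?r t * (?k (t0 - s) * kern 1 (s - t))"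
      using AE_lborel_singleton[of t]
    proof eventually_elim
      case (elim s)
      consider "s \<le> 0" | "0 < s" "s < t" | "t < s" "s < t0" | "t0 \<le> s" using elim by force
      then show ?case
      proof cases
        case 1
        then show ?thesis using rt b kern_nonneg[of b] kern_nonneg[of 1] by (simp add: ml_nonpos)
      next
        case 2
        have "?k (t0 - s) \<le> K * ?k (t - s)"
          using kern_log_convex[OF b 2, of t0] \<open>t < t0\<close> kt by (simp add: K_def field_simps)
        then have "?k (t0 - s) * ?r s \<le> K * ?k (t - s) * ?r s"
          using before[of s] 2 \<open>t < t0\<close> by (intro mult_right_mono) auto
        then show ?thesis using 2 by (simp add: kern_def)
      next
        case 3
        have "?r s \<le> ?r t" using tmax t 3 by auto
        then have "?k (t0 - s) * ?r s \<le> ?k (t0 - s) * ?r t"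
          using kern_nonneg[OF b(1)] by (intro mult_left_mono) auto
        then show ?thesis using 3 by (simp add: kern_def mult.commute)
      next
        case 4
        then show ?thesis using \<open>t < t0\<close> by (simp add: kern_def)
      qed
    qed
  qed (use int tail in \<open>auto simp: has_bochner_integral_iff\<close>)
  also have "\<dots> = K * conv ?k ?r t + ?r t * kern (b + 1) (t0 - t)"
    using int tail by (simp add: has_bochner_integral_iff conv_def)
  finally have "a * conv ?k ?r t0 \<le> a * (K * conv ?k ?r t + ?r t * kern (b + 1) (t0 - t))"
    using a by simp
  \<comment> \<open>The Volterra equation at t replaces the memory by \<open>?k t - ?r t\<close>.
    Since K * \<open>?k t\<close> = \<open>?k t0\<close>, the forcing cancels against the one in the
    equation at t0.\<close>
  also have "\<dots> = K * (?k t - ?r t) + ?r t * (a * kern (b + 1) (t0 - t))"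
    by (subst ml_volterra[OF b(1) b(1), of a t]) (simp add: algebra_simps)
  also have "K * (?k t - ?r t) = ?k t0 - K * ?r t"
    using kt by (simp add: K_def field_simps)
  finally have "K * ?r t - ?r t * (a * kern (b + 1) (t0 - t)) \<le> ?r t0"
    using ml_volterra[OF b(1) b(1), of a t0] by simp
  then have "?r t * (K - a * kern (b + 1) (t0 - t)) \<le> 0"
    using at_t0 by (simp add: algebra_simps)
  moreover have "a * kern (b + 1) (t0 - t) \<le> 1 / 4"
  proof -
    have "(t0 - t) powr b \<le> d powr b"
      using t \<open>t < t0\<close> b by (intro powr_mono2) auto
    then have "a * kern (b + 1) (t0 - t) \<le> a * (d powr b / Gamma (b + 1))"
      using a G1 \<open>t < t0\<close> by (simp add: kern_def divide_right_mono)
    then show ?thesis using dp by (rule order_trans)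
  qed
  ultimately show False
    using rt K by (simp add: mult_le_0_iff)
qed

section \<open>The resolvent, the relaxation function and their bounds\<close>

locale relaxation =
  fixes b a :: real
  assumes b: "0 < b" "b < 1" and a: "0 < a"
begin

definition rho :: "real \<Rightarrow> real" where "rho = ml b a b"

text \<open>The Mittag-Leffler response of the linear equation to the constant input 1; for t > 0 it
  equals 1 minus a times the mass of \<open>rho\<close> on (0, t).\<close>

definition relax :: "real \<Rightarrow> real" where "relax = ml b a 1"

lemma rho_measurable[measurable]: "rho \<in> borel_measurable borel"
  unfolding rho_def by (rule ml_measurable) (use b in auto)

lemma rho_nonneg: "0 \<le> rho t"
  using ml_pos[of b a t] b a by (cases "0 < t") (auto simp: rho_def ml_nonpos less_imp_le)

lemma rho_nonpos: "t \<le> 0 \<Longrightarrow> rho t = 0"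
  by (simp add: rho_def ml_nonpos)

lemma kern_rho_integrable: "0 < x \<Longrightarrow> integrable lborel (\<lambda>s. kern x (t - s) * rho s)"
  unfolding rho_def using b by (intro conv_kern_ml) auto

lemma conv_kern_rho: "0 < x \<Longrightarrow> conv (kern x) rho t = ml b a (x + b) t"
  unfolding rho_def using b by (intro conv_kern_ml) auto

lemma ml_nonneg: "b < c \<Longrightarrow> 0 \<le> ml b a c t"
  using conv_kern_rho[of "c - b" t] conv_nonneg[of "kern (c - b)" rho t] kern_nonneg[of "c - b"] rho_nonneg by simp

lemma ml_le_kern: "b \<le> c \<Longrightarrow> ml b a c t \<le> kern c t"
  using ml_eq_kern_minus[of b c a t] ml_nonneg[of "c + b" t] a b by simp

lemma rho_le_kern: "rho t \<le> kern b t"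
  unfolding rho_def by (rule ml_le_kern) simp

end

text \<open>The convolution of \<open>q.rho\<close>, \<open>kern b\<close> and \<open>p.rho\<close>
  is evaluated in both associations. Eliminating the kernel by the two Volterra equations yields the
  resolvent identity, whose right-hand side is nonnegative.\<close>

lemma ml_antimono_param:
  assumes "0 < b" "b < 1" "0 < a" "a \<le> a'"
  shows "ml b a' b t \<le> ml b a b t"
proof -
  interpret p: relaxation b a by unfold_locales (use assms in auto)
  interpret q: relaxation b a' by unfold_locales (use assms in auto)
  have "conv q.rho (conv (kern b) p.rho) t = conv (conv q.rho (kern b)) p.rho t"
  proof (rule conv_assoc)
    show "integrable lborel (\<lambda>s. \<bar>q.rho (t - s)\<bar> * conv (\<lambda>u. \<bar>kern b u\<bar>) (\<lambda>u. \<bar>p.rho u\<bar>) s)"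
    proof (rule Bochner_Integration.integrable_bound[OF kern_integrable[of b "b + b" t]])
      show "AE s in lborel. norm (\<bar>q.rho (t - s)\<bar> * conv (\<lambda>u. \<bar>kern b u\<bar>) (\<lambda>u. \<bar>p.rho u\<bar>) s)
          \<le> norm (kern b (t - s) * kern (b + b) s)"
        using assms p.ml_le_kern[of "b + b"] p.ml_nonneg[of "b + b"]
        by (auto simp: p.rho_nonneg q.rho_nonneg kern_nonneg p.conv_kern_rho abs_mult
            intro!: mult_mono q.rho_le_kern)
    qed (use assms in auto)
  qed (use assms in \<open>auto intro: p.kern_rho_integrable\<close>)
  moreover have "conv q.rho (conv (kern b) p.rho) t = (conv q.rho (kern b) t - conv q.rho p.rho t) / a"
  proof -
    have "conv (kern b) p.rho s = (kern b s - p.rho s) / a" for s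
      using ml_volterra[of b b a s] assms by (simp add: p.rho_def field_simps)
    moreover have "integrable lborel (\<lambda>s. q.rho (t - s) * kern b s)"
      using q.kern_rho_integrable[of b t] assms conv_integrable_commute[of q.rho t "kern b"] by simp
    moreover have "integrable lborel (\<lambda>s. q.rho (t - s) * p.rho s)"
      by (rule Bochner_Integration.integrable_bound[OF kern_integrable[of b b t]])
        (use assms in \<open>auto simp: p.rho_nonneg q.rho_nonneg kern_nonneg intro!: mult_mono q.rho_le_kern p.rho_le_kern\<close>)
    ultimately show ?thesis
      by (simp add: conv_def right_diff_distrib diff_divide_distrib)
  qed
  moreover have "conv (conv q.rho (kern b)) p.rho t = (conv (kern b) p.rho t - conv q.rho p.rho t) / a'"
  proof -
    have "conv q.rho (kern b) s = (kern b s - q.rho s) / a'" for s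
      using ml_volterra[of b b a' s] assms conv_commute[of q.rho "kern b" s] by (simp add: q.rho_def field_simps)
    moreover have "integrable lborel (\<lambda>s. kern b (t - s) * p.rho s)"
      using p.kern_rho_integrable[of b t] assms by simp
    moreover have "integrable lborel (\<lambda>s. q.rho (t - s) * p.rho s)"
      by (rule Bochner_Integration.integrable_bound[OF kern_integrable[of b b t]])
        (use assms in \<open>auto simp: p.rho_nonneg q.rho_nonneg kern_nonneg intro!: mult_mono q.rho_le_kern p.rho_le_kern\<close>)
    ultimately show ?thesis
      by (simp add: conv_def left_diff_distrib diff_divide_distrib)
  qed
  moreover have "a * conv (kern b) p.rho t = kern b t - p.rho t"
    using ml_volterra[of b b a t] assms by (simp add: p.rho_def)
  moreover have "a' * conv q.rho (kern b) t = kern b t - q.rho t"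
    using ml_volterra[of b b a' t] assms conv_commute[of q.rho "kern b" t] by (simp add: q.rho_def)
  ultimately have "p.rho t - q.rho t = (a' - a) * conv q.rho p.rho t"
    using assms by (simp add: field_simps)
  moreover have "0 \<le> conv q.rho p.rho t"
    by (intro conv_nonneg p.rho_nonneg q.rho_nonneg)
  ultimately have "0 \<le> p.rho t - q.rho t" using assms by simp
  then show ?thesis by (simp add: p.rho_def q.rho_def)
qed

context relaxation begin

text \<open>Changing the time scale amounts to changing \<open>a\<close>.\<close>

lemma rho_antimono:
  assumes "0 < s" "s \<le> t"
  shows "rho t \<le> rho s"
proof -
  \<comment> \<open>Chosen so that time s at rate a' gives the same Mittag-Leffler argument as time
    t at rate a. That common value must be known to be nonnegative before the power factors can be
    compared.\<close>
  define a' where "a' = a * (t powr b / s powr b)"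
  have "s powr b \<le> t powr b" using assms b by (intro powr_mono2) auto
  then have a': "a \<le> a'" using a assms by (simp add: a'_def field_simps)
  have "a' * s powr b = a * t powr b" using assms by (simp add: a'_def)
  then have eq: "mittag_leffler b b (- a * t powr b) = mittag_leffler b b (- a' * s powr b)"
    by simp
  have "0 \<le> ml b a' b s"
    using ml_pos[of b a' s] a a' assms b by simp
  then have nn: "0 \<le> mittag_leffler b b (- a * t powr b)"
    unfolding eq using assms by (simp add: ml_def zero_le_mult_iff)
  have "t powr (b - 1) \<le> s powr (b - 1)" using assms b by (intro powr_mono2') auto
  then have "rho t \<le> ml b a' b s"
    using mult_right_mono[OF _ nn] assms unfolding rho_def ml_def eq[symmetric] by simp
  also have "\<dots> \<le> rho s"
    unfolding rho_def by (rule ml_antimono_param) (use b a a' in auto)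
  finally show ?thesis .
qed

lemma relax_eq: "0 < t \<Longrightarrow> relax t = mittag_leffler b 1 (- a * t powr b)"
  by (simp add: relax_def ml_def)

lemma relax_nonneg: "0 \<le> relax t"
  unfolding relax_def by (rule ml_nonneg) (use b in auto)

lemma relax_eq_integral:
  "0 < t \<Longrightarrow> relax t = 1 - a * conv (kern 1) rho t"
  using ml_eq_kern_minus[of b 1 a t] conv_kern_rho[of 1 t] b by (simp add: relax_def kern_one)

lemma relax_antimono:
  assumes "0 < s" "s \<le> t"
  shows "relax t \<le> relax s"
proof -
  have "conv (kern 1) rho s \<le> conv (kern 1) rho t"
    unfolding conv_def
    by (intro integral_mono kern_rho_integrable mult_right_mono rho_nonneg) (use assms in \<open>auto simp: kern_def\<close>)
  then show ?thesis using assms a by (simp add: relax_eq_integral)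
qed

text \<open>In the relaxation equation \<open>relax + a * conv (kern b) relax = 1\<close>,
  monotonicity allows the past values to be replaced by the smaller \<open>relax t\<close>.\<close>

lemma relax_upper:
  assumes "0 < t"
  shows "a * t powr b * relax t \<le> Gamma (b + 1)"
proof -
  have "conv (kern b) (\<lambda>s. relax t * kern 1 s) t \<le> conv (kern b) relax t"
    unfolding conv_def
  proof (rule integral_mono)
    fix s
    show "kern b (t - s) * (relax t * kern 1 s) \<le> kern b (t - s) * relax s"
    proof (cases "s < t")
      case True
      then have "relax t * kern 1 s \<le> relax s"
        using relax_antimono[of s t] relax_nonneg[of s] by (simp add: kern_def)
      then show ?thesis by (intro mult_left_mono kern_nonneg b)
    qed (simp add: kern_def)
  next
    show "integrable lborel (\<lambda>s. kern b (t - s) * (relax t * kern 1 s))"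
      using integrable_mult_right[OF kern_integrable[of b 1 t], of "relax t"] b by (simp add: mult_ac)
    show "integrable lborel (\<lambda>s. kern b (t - s) * relax s)"
      unfolding relax_def by (rule conv_kern_ml) (use b in auto)
  qed
  also have "conv (kern b) (\<lambda>s. relax t * kern 1 s) t = relax t * kern (b + 1) t"
    using conv_kern[of b 1 t] b by (simp add: conv_def mult.left_commute)
  finally have "a * (relax t * kern (b + 1) t) \<le> a * conv (kern b) relax t"
    using a by simp
  also have "\<dots> = 1 - relax t"
    using ml_volterra[of b 1 a t] b assms by (simp add: relax_def kern_one)
  also have "\<dots> \<le> 1" using relax_nonneg by simp
  finally show ?thesis
    using assms b by (simp add: kern_def field_simps Gamma_real_pos)
qed

text \<open>\<open>relax\<close> is the convolution of the decreasing \<open>kern (1 - b)\<close>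
  with \<open>rho\<close>, hence at least \<open>kern (1 - b) t\<close> times the mass of
  \<open>rho\<close> on (0, t), which is (1 - \<open>relax t\<close>) / a. The bound converts the
  weight in \<open>norm_X2\<close> into a growth bound.\<close>

lemma relax_lower:
  assumes "0 < t"
  shows "1 \<le> (1 + a * Gamma (1 - b) * t powr b) * relax t"
proof -
  have "kern (1 - b) t * conv (kern 1) rho t \<le> conv (kern (1 - b)) rho t"
    unfolding conv_def integral_mult_right_zero[symmetric]
  proof (rule integral_mono)
    fix s
    have "kern (1 - b) t \<le> kern (1 - b) (t - s)" if "0 < s" "s < t"
      using that b by (auto simp: kern_def Gamma_real_pos intro!: divide_right_mono powr_mono2')
    then show "kern (1 - b) t * (kern 1 (t - s) * rho s) \<le> kern (1 - b) (t - s) * rho s"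
      using rho_nonneg[of s]
      by (cases "0 < s"; cases "s < t") (auto simp: rho_nonpos kern_one intro!: mult_right_mono, auto simp: kern_def)
  qed (use b in \<open>auto intro!: integrable_mult_right kern_rho_integrable\<close>)
  then have "kern (1 - b) t * (a * conv (kern 1) rho t) \<le> a * relax t"
    using conv_kern_rho[of "1 - b" t] a b by (simp add: relax_def mult.left_commute)
  moreover have "kern (1 - b) t = 1 / (t powr b * Gamma (1 - b))"
    using assms by (simp add: kern_def powr_minus field_simps)
  moreover have "0 < Gamma (1 - b)" using b by (simp add: Gamma_real_pos)
  ultimately show ?thesis
    using assms by (simp add: relax_eq_integral field_simps)
qed

text \<open>By monotonicity t/2 * \<open>rho t\<close> is at most the mass of \<open>rho\<close> on
  \<open>{t/2..<t}\<close>, which is a difference of \<open>relax\<close> values and thus controlled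
  by \<open>relax_upper\<close>. One factor 2 of the constant 4 comes from the half interval, the
  other bounds 2^b.\<close>

lemma rho_decay:
  assumes "0 < t"
  shows "rho t \<le> 4 * Gamma (b + 1) / a\<^sup>2 * t powr (- b - 1)"
proof -
  \<comment> \<open>Because \<open>kern 1 0 = 0\<close>, the difference of the two kernels is
    exactly the indicator of the half-open interval.\<close>
  have "(LBINT s. indicator {t/2..<t} s * rho t) \<le> (LBINT s. kern 1 (t - s) * rho s - kern 1 (t / 2 - s) * rho s)"
  proof (rule integral_mono)
    show "integrable lborel (\<lambda>s. kern 1 (t - s) * rho s - kern 1 (t / 2 - s) * rho s)"
      by (intro Bochner_Integration.integrable_diff kern_rho_integrable) auto
    fix s
    show "indicator {t/2..<t} s * rho t \<le> kern 1 (t - s) * rho s - kern 1 (t / 2 - s) * rho s"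
      using assms rho_antimono[of s t] rho_nonneg[of s]
      by (simp add: kern_def indicator_def)
    show "integrable lborel (\<lambda>s. indicator {t/2..<t} s * rho t)"
      by (intro integrable_mult_left integrable_real_indicator) (use assms in auto)
  qed
  also have "\<dots> = conv (kern 1) rho t - conv (kern 1) rho (t / 2)"
    unfolding conv_def by (intro Bochner_Integration.integral_diff kern_rho_integrable) auto
  also have "(LBINT s. indicator {t/2..<t} s * rho t) = t / 2 * rho t"
    using assms by simp
  finally have "a * (t / 2 * rho t) \<le> a * (conv (kern 1) rho t - conv (kern 1) rho (t / 2))"
    using a by simp
  also have "\<dots> = relax (t / 2) - relax t"
    using assms by (simp add: relax_eq_integral algebra_simps)
  also have "\<dots> \<le> relax (t / 2)" using relax_nonneg by simp
  finally have "(a * t powr b) * (a * (t / 2 * rho t)) \<le> (a * t powr b) * relax (t / 2)"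
    using a by (intro mult_left_mono) auto
  also have "\<dots> = 2 powr b * (a * (t / 2) powr b * relax (t / 2))"
    using assms by (simp add: powr_divide)
  also have "\<dots> \<le> 2 powr 1 * Gamma (b + 1)"
    using b assms by (intro mult_mono powr_mono relax_upper) (auto simp: relax_nonneg a less_imp_le)
  finally have "a\<^sup>2 * (t powr b * t) * rho t \<le> 4 * Gamma (b + 1)"
    by (simp add: power2_eq_square field_simps)
  then have "rho t \<le> 4 * Gamma (b + 1) / a\<^sup>2 * (1 / (t powr b * t))"
    using assms a by (simp add: field_simps)
  moreover have "t powr (- b - 1) = 1 / (t powr b * t)"
    using assms by (simp add: powr_diff powr_minus field_simps)
  ultimately show ?thesis by simp
qed

lemma relax_tendsto: "(relax \<longlongrightarrow> 0) at_top"
proof (rule tendsto_sandwich[OF _ _ tendsto_const])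
  show "\<forall>\<^sub>F t in at_top. relax t \<le> Gamma (b + 1) / a * t powr (- b)"
    using eventually_gt_at_top[of 0]
  proof eventually_elim
    case (elim t)
    then show ?case using relax_upper[of t] a by (simp add: powr_minus field_simps)
  qed
  show "((\<lambda>t. Gamma (b + 1) / a * t powr (- b)) \<longlongrightarrow> 0) at_top"
    using b by (intro tendsto_mult_right_zero tendsto_neg_powr filterlim_ident) auto
qed (simp add: relax_nonneg)

text \<open>The mass of \<open>rho\<close> up to n is (1 - \<open>relax n\<close>) / a, and
  \<open>relax\<close> tends to 0.\<close>

lemma has_bochner_integral_rho: "has_bochner_integral lborel rho (1 / a)"
proof (rule has_bochner_integral_monotone_convergence)
  show "integrable lborel (\<lambda>s. kern 1 (real n - s) * rho s)" for n
    by (rule kern_rho_integrable) simp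
  show "AE s in lborel. mono (\<lambda>n. kern 1 (real n - s) * rho s)"
    by (intro always_eventually allI monoI) (auto simp: kern_def rho_nonneg)
  show "AE s in lborel. (\<lambda>n. kern 1 (real n - s) * rho s) \<longlonglongrightarrow> rho s"
  proof (intro always_eventually allI)
    fix s
    have "eventually (\<lambda>n. s < real n) sequentially"
      using filterlim_real_sequentially by (simp add: filterlim_at_top_dense)
    then show "(\<lambda>n. kern 1 (real n - s) * rho s) \<longlonglongrightarrow> rho s"
      by (intro tendsto_eventually, eventually_elim) (simp add: kern_def)
  qed
  have "(\<lambda>n. (1 - relax (real n)) / a) \<longlonglongrightarrow> (1 - 0) / a"
    by (intro tendsto_intros filterlim_compose[OF relax_tendsto filterlim_real_sequentially]) (use a in auto)
  moreover have "\<forall>\<^sub>F n in sequentially. (1 - relax (real n)) / a = (LBINT s. kern 1 (real n - s) * rho s)"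
    using eventually_gt_at_top[of 0]
  proof eventually_elim
    case (elim n)
    then show ?case using relax_eq_integral[of "real n"] a by (simp add: conv_def field_simps)
  qed
  ultimately show "(\<lambda>n. LBINT s. kern 1 (real n - s) * rho s) \<longlonglongrightarrow> 1 / a"
    by (simp add: tendsto_cong)
qed auto


section \<open>Response of the linear equation\<close>

definition lin :: "(real \<Rightarrow> real) \<Rightarrow> real \<Rightarrow> real" where
  "lin f t = f t - a * conv rho f t"

lemma rho_shift: "has_bochner_integral lborel (\<lambda>s. rho (t - s)) (1 / a)"
  using has_bochner_integral_rho
  by (subst (asm) lborel_has_bochner_integral_real_affine_iff[where c="-1" and t=t]) auto

text \<open>Averaging against the probability density \<open>a * rho\<close> costs no constant. A
  bound strictly before t is enough since \<open>rho\<close> vanishes at 0; the first-exit argument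
  relies on this.\<close>

lemma conv_rho_bounded:
  assumes [measurable]: "f \<in> borel_measurable borel" and bound: "\<And>s. s < t \<Longrightarrow> \<bar>f s\<bar> \<le> B"
  shows "integrable lborel (\<lambda>s. rho (t - s) * f s)" (is ?A)
    and "a * conv rho (\<lambda>s. \<bar>f s\<bar>) t \<le> B" (is ?B)
    and "\<bar>a * conv rho f t\<bar> \<le> B" (is ?C)
proof -
  have dom: "\<bar>rho (t - s) * f s\<bar> \<le> B * rho (t - s)" for s
  proof (cases "s < t")
    case True
    then show ?thesis using mult_left_mono[OF bound[OF True] rho_nonneg[of "t - s"]] rho_nonneg[of "t - s"]
      by (simp add: abs_mult mult.commute)
  qed (simp add: rho_nonpos)
  have intB: "integrable lborel (\<lambda>s. B * rho (t - s))"
    using rho_shift[of t] by (auto simp: has_bochner_integral_iff)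
  show ?A
    by (rule integrable_dominated[OF intB _ dom]) simp
  have "conv rho (\<lambda>s. \<bar>f s\<bar>) t \<le> (LBINT s. B * rho (t - s))"
    unfolding conv_def
  proof (rule integral_mono)
    show "integrable lborel (\<lambda>s. rho (t - s) * \<bar>f s\<bar>)"
      using integrable_abs[OF \<open>?A\<close>] by (simp add: abs_mult rho_nonneg)
    show "rho (t - s) * \<bar>f s\<bar> \<le> B * rho (t - s)" for s
      using dom[of s] by (simp add: abs_mult rho_nonneg)
  qed (fact intB)
  also have "\<dots> = B / a"
    using rho_shift[of t] by (simp add: has_bochner_integral_iff)
  finally show ?B using a by (simp add: field_simps)
  moreover have "\<bar>a * conv rho f t\<bar> \<le> a * conv rho (\<lambda>s. \<bar>f s\<bar>) t"
    using abs_conv_le[of rho f t] a by (simp add: abs_mult rho_nonneg)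
  ultimately show ?C by linarith
qed

lemma lin_bounded:
  assumes "f \<in> borel_measurable borel" "\<And>s. s \<le> t \<Longrightarrow> \<bar>f s\<bar> \<le> B"
  shows "\<bar>lin f t\<bar> \<le> 2 * B"
proof -
  have "\<bar>a * conv rho f t\<bar> \<le> B" by (rule conv_rho_bounded(3)) (use assms in auto)
  then show ?thesis using assms(2)[of t] by (simp add: lin_def)
qed

lemma conv_rho_tendsto:
  assumes [measurable]: "f \<in> borel_measurable borel" and bound: "\<And>s. \<bar>f s\<bar> \<le> B" and lim: "(f \<longlongrightarrow> L) at_top"
  shows "((\<lambda>t. a * conv rho f t) \<longlongrightarrow> L) at_top"
proof -
  have "((\<lambda>t. LBINT u. f (t - u) * rho u) \<longlongrightarrow> (LBINT u. L * rho u)) at_top"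
  proof (rule integral_dominated_convergence_at_top)
    show "AE u in lborel. ((\<lambda>t. f (t - u) * rho u) \<longlongrightarrow> L * rho u) at_top"
    proof (intro always_eventually allI tendsto_intros)
      fix u
      show "((\<lambda>t. f (t - u)) \<longlongrightarrow> L) at_top"
        using filterlim_compose[OF lim filterlim_tendsto_add_at_top[OF tendsto_const[of "-u"] filterlim_ident]]
        by simp
    qed
    show "\<forall>\<^sub>F t in at_top. AE u in lborel. norm (f (t - u) * rho u) \<le> B * rho u"
      using bound by (auto simp: abs_mult rho_nonneg mult_right_mono)
    show "integrable lborel (\<lambda>u. B * rho u)"
      using has_bochner_integral_rho by (auto simp: has_bochner_integral_iff)
  qed auto
  then have "((\<lambda>t. a * conv f rho t) \<longlongrightarrow> a * (L * (1 / a))) at_top"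
    using has_bochner_integral_rho unfolding conv_def
    by (intro tendsto_mult tendsto_const) (simp add: has_bochner_integral_iff)
  then show ?thesis
    using a conv_commute[of f rho] by simp
qed

lemma lin_tendsto_of_convergent:
  assumes "f \<in> borel_measurable borel" "\<And>s. \<bar>f s\<bar> \<le> B" "(f \<longlongrightarrow> L) at_top"
  shows "(lin f \<longlongrightarrow> 0) at_top"
  using tendsto_diff[OF assms(3) conv_rho_tendsto[OF assms]] by (simp add: lin_def[abs_def])

definition decay_const :: real where
  "decay_const = 4 * Gamma (b + 1) / a\<^sup>2"

lemma decay_const_nonneg: "0 \<le> decay_const"
  using b Gamma_real_pos[of "b + 1"] by (simp add: decay_const_def)

text \<open>The summands are the costs of the \<open>relax\<close> term, of the increments on
  \<open>{t/2..t}\<close>, and of the older memory.\<close>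

definition lin_const :: real where
  "lin_const = Gamma (b + 1) / a + a * decay_const / (1 - b) + 4 * a * decay_const"

lemma lin_const_nonneg: "0 \<le> lin_const"
  using b a Gamma_real_pos[of "b + 1"] decay_const_nonneg by (simp add: lin_const_def)

text \<open>
  Write \<open>lin f t = f t * relax t + a * (\<integral>s. rho (t - s) * (f t - f s))\<close>. On \<open>{t/2..t}\<close> the increment of \<open>f\<close>
  leaves \<open>u * rho u = O(u powr (- b))\<close> to integrate; on \<open>{0..t/2}\<close> the factor \<open>rho\<close> is at most \<open>rho (t/2)\<close>.
\<close>

lemma abs_lin_le:
  assumes [measurable]: "f \<in> borel_measurable borel" and f0: "\<And>s. s \<le> 0 \<Longrightarrow> f s = 0"
    and t: "0 < t" and int: "integrable lborel (\<lambda>s. kern 1 (t - s) * \<bar>f s\<bar>)"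
    and lip: "\<And>s. t / 2 \<le> s \<Longrightarrow> s < t \<Longrightarrow> \<bar>f t - f s\<bar> \<le> D * (t - s)" and D: "0 \<le> D"
  shows "integrable lborel (\<lambda>s. rho (t - s) * f s)" (is ?A)
    and "\<bar>lin f t\<bar> \<le> lin_const * (D * t powr (1 - b) + t powr (- b) * \<bar>f t\<bar>
          + t powr (- 1 - b) * conv (kern 1) (\<lambda>s. \<bar>f s\<bar>) t)" (is ?B)
proof -
  \<comment> \<open>\<open>kern 1\<close> acts as the Heaviside function: \<open>h s\<close> is the
    increment \<open>f t - f s\<close> for s > 0 and vanishes for s \<le> 0.\<close>
  define h where "h s = f t * kern 1 s - f s" for s
  have [measurable]: "h \<in> borel_measurable borel" by (simp add: h_def[abs_def])
  \<comment> \<open>An integrable majorant built from kernels, so that its integral follows from the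
    semigroup law. The first term is u * \<open>rho u\<close> \<le> \<open>decay_const\<close> *
    u^(-b), rewritten with \<open>kern (1 - b)\<close>; the other two bound the older half and are
    harmlessly extended to all of (0, t).\<close>
  define E where "E s = D * decay_const * Gamma (1 - b) * (kern (1 - b) (t - s) * kern 1 s)
     + rho (t / 2) * \<bar>f t\<bar> * (kern 1 (t - s) * kern 1 s) + rho (t / 2) * (kern 1 (t - s) * \<bar>f s\<bar>)" for s
  have G: "0 < Gamma (1 - b)" using b by (simp add: Gamma_real_pos)
  have dom: "\<bar>rho (t - s) * h s\<bar> \<le> E s" for s
  proof -
    have parts: "0 \<le> D * decay_const * Gamma (1 - b) * (kern (1 - b) (t - s) * kern 1 s)"
      "0 \<le> rho (t / 2) * \<bar>f t\<bar> * (kern 1 (t - s) * kern 1 s)"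
      "0 \<le> rho (t / 2) * (kern 1 (t - s) * \<bar>f s\<bar>)"
      using D G decay_const_nonneg b by (simp_all add: rho_nonneg kern_nonneg)
    consider "s \<le> 0" | "0 < s" "s < t / 2" | "t / 2 \<le> s" "s < t" | "t \<le> s" by linarith
    then show ?thesis
    proof cases
      case 1
      then show ?thesis using parts by (simp add: h_def f0 kern_def E_def)
    next
      case 2
      have "\<bar>rho (t - s) * h s\<bar> \<le> rho (t / 2) * (\<bar>f t\<bar> + \<bar>f s\<bar>)"
        using 2 t unfolding abs_mult
        by (intro mult_mono) (auto simp: rho_nonneg h_def kern_one intro!: rho_antimono)
      then show ?thesis using 2 t parts(1) by (simp add: E_def kern_one algebra_simps)
    next
      case 3
      have "\<bar>rho (t - s) * h s\<bar> \<le> (decay_const * (t - s) powr (- b - 1)) * (D * (t - s))"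
        using 3 t lip[of s] rho_decay[of "t - s"] unfolding abs_mult
        by (intro mult_mono) (auto simp: rho_nonneg h_def kern_one decay_const_def[symmetric] decay_const_nonneg)
      also have "\<dots> = D * decay_const * ((t - s) powr (- b - 1) * (t - s) powr 1)"
        using 3 by simp
      also have "\<dots> = D * decay_const * Gamma (1 - b) * (kern (1 - b) (t - s) * kern 1 s)"
        using 3 t G by (subst powr_add[symmetric]) (simp add: kern_def)
      finally show ?thesis using parts by (simp add: E_def)
    next
      case 4
      then show ?thesis using parts by (simp add: E_def rho_nonpos)
    qed
  qed
  have i1: "integrable lborel (\<lambda>s. kern (1 - b) (t - s) * kern 1 s)"
   and i2: "integrable lborel (\<lambda>s. kern 1 (t - s) * kern 1 s)"
    by (rule kern_integrable; use b in simp)+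
  have intE: "integrable lborel E"
    unfolding E_def by (intro Bochner_Integration.integrable_add integrable_mult_right int i1 i2)
  have inth: "integrable lborel (\<lambda>s. rho (t - s) * h s)"
    by (rule integrable_dominated[OF intE _ dom]) simp
  have ink: "integrable lborel (\<lambda>s. f t * (rho (t - s) * kern 1 s))"
    using kern_rho_integrable[of 1 t] conv_integrable_commute[of "kern 1" t rho] by simp
  from Bochner_Integration.integrable_diff[OF ink inth] show ?A
    by (simp add: h_def algebra_simps)
  have conv_f: "conv rho f t = f t * conv (kern 1) rho t - (LBINT s. rho (t - s) * h s)"
    using Bochner_Integration.integral_diff[OF ink inth] conv_commute[of "kern 1" rho t]
    by (simp add: h_def conv_def algebra_simps)
  have "lin f t = f t * relax t + a * (LBINT s. rho (t - s) * h s)"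
    unfolding lin_def relax_eq_integral[OF t] conv_f by (simp add: algebra_simps)
  then have "\<bar>lin f t\<bar> \<le> \<bar>f t * relax t\<bar> + \<bar>a * (LBINT s. rho (t - s) * h s)\<bar>"
    by (metis abs_triangle_ineq)
  then have "\<bar>lin f t\<bar> \<le> \<bar>f t\<bar> * relax t + a * \<bar>LBINT s. rho (t - s) * h s\<bar>"
    using a relax_nonneg[of t] by (simp add: abs_mult)
  also have "\<bar>LBINT s. rho (t - s) * h s\<bar> \<le> (LBINT s. E s)"
    by (rule order_trans[OF integral_abs_bound integral_mono[OF integrable_abs[OF inth] intE dom]])
  also have "(LBINT s. E s) = D * decay_const * Gamma (1 - b) * kern (2 - b) t + rho (t / 2) * \<bar>f t\<bar> * t
      + rho (t / 2) * conv (kern 1) (\<lambda>s. \<bar>f s\<bar>) t"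
    using conv_kern[of "1 - b" 1 t] conv_kern[of 1 1 t] b t i1 i2 int
    by (simp add: E_def[abs_def] conv_def kern_def[of 2] Gamma_numeral)
  also have "Gamma (1 - b) * kern (2 - b) t = t powr (1 - b) / (1 - b)"
  proof -
    have "Gamma (2 - b) = (1 - b) * Gamma (1 - b)"
      using Gamma_plus1[of "1 - b"] b nonpos_Ints_nonpos[of "1 - b"] by fastforce
    then show ?thesis using t G by (simp add: kern_def)
  qed
  then have "D * decay_const * Gamma (1 - b) * kern (2 - b) t = decay_const / (1 - b) * (D * t powr (1 - b))"
    by (simp add: mult.assoc)
  finally have "\<bar>lin f t\<bar> \<le> \<bar>f t\<bar> * relax t + a * (decay_const / (1 - b) * (D * t powr (1 - b))
      + rho (t / 2) * (\<bar>f t\<bar> * t + conv (kern 1) (\<lambda>s. \<bar>f s\<bar>) t))"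
    using a by (simp add: algebra_simps)
  also have "\<bar>f t\<bar> * relax t \<le> Gamma (b + 1) / a * (t powr (- b) * \<bar>f t\<bar>)"
  proof -
    have "relax t \<le> Gamma (b + 1) / a * t powr (- b)"
      using relax_upper[OF t] a t by (simp add: powr_minus field_simps)
    from mult_left_mono[OF this, of "\<bar>f t\<bar>"] show ?thesis by (simp add: mult_ac)
  qed
  also have "rho (t / 2) * (\<bar>f t\<bar> * t + conv (kern 1) (\<lambda>s. \<bar>f s\<bar>) t)
     \<le> (4 * decay_const * t powr (- 1 - b)) * (\<bar>f t\<bar> * t + conv (kern 1) (\<lambda>s. \<bar>f s\<bar>) t)"
  proof (rule mult_right_mono)
    have "(1/2::real) powr (- b - 1) = 2 powr (b + 1)"
      using powr_divide[of 1 2 "- b - 1"] powr_minus_divide[of "2::real" "- b - 1"] by (simp add: add.commute)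
    also have "\<dots> \<le> 2 powr 2" using b by (intro powr_mono) auto
    finally have "decay_const * ((1/2) powr (- b - 1) * t powr (- b - 1)) \<le> decay_const * (4 * t powr (- b - 1))"
      by (intro mult_left_mono mult_right_mono decay_const_nonneg) auto
    moreover have "(1/2) powr (- b - 1) * t powr (- b - 1) = (t / 2) powr (- b - 1)"
      using t powr_mult[of "1/2" t "- b - 1"] by simp
    moreover have "rho (t / 2) \<le> decay_const * (t / 2) powr (- b - 1)"
      using rho_decay[of "t / 2"] t by (simp add: decay_const_def)
    ultimately show "rho (t / 2) \<le> 4 * decay_const * t powr (- 1 - b)" by (simp add: minus_diff_commute)
    show "0 \<le> \<bar>f t\<bar> * t + conv (kern 1) (\<lambda>s. \<bar>f s\<bar>) t"
      using t by (intro add_nonneg_nonneg conv_nonneg kern_nonneg) auto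
  qed
  also have "t powr (- 1 - b) * (\<bar>f t\<bar> * t + conv (kern 1) (\<lambda>s. \<bar>f s\<bar>) t)
     = t powr (- b) * \<bar>f t\<bar> + t powr (- 1 - b) * conv (kern 1) (\<lambda>s. \<bar>f s\<bar>) t"
  proof -
    have "t powr (- 1 - b) * t = t powr (- b)"
      using t by (simp add: powr_diff powr_minus field_simps)
    then show ?thesis by (simp add: algebra_simps)
  qed
  then have "(4 * decay_const * t powr (- 1 - b)) * (\<bar>f t\<bar> * t + conv (kern 1) (\<lambda>s. \<bar>f s\<bar>) t)
     = 4 * decay_const * (t powr (- b) * \<bar>f t\<bar> + t powr (- 1 - b) * conv (kern 1) (\<lambda>s. \<bar>f s\<bar>) t)"
    by (simp add: mult.assoc)
  finally have *: "\<bar>lin f t\<bar> \<le> Gamma (b + 1) / a * (t powr (- b) * \<bar>f t\<bar>)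
     + a * (decay_const / (1 - b) * (D * t powr (1 - b))
       + 4 * decay_const * (t powr (- b) * \<bar>f t\<bar> + t powr (- 1 - b) * conv (kern 1) (\<lambda>s. \<bar>f s\<bar>) t))"
    using a by simp
  define u v w where "u = D * t powr (1 - b)" and "v = t powr (- b) * \<bar>f t\<bar>"
    and "w = t powr (- 1 - b) * conv (kern 1) (\<lambda>s. \<bar>f s\<bar>) t"
  define P Q R where "P = Gamma (b + 1) / a" and "Q = a * decay_const / (1 - b)" and "R = 4 * a * decay_const"
  have nn: "0 \<le> u" "0 \<le> v" "0 \<le> w" "0 \<le> P" "0 \<le> Q" "0 \<le> R"
    using D decay_const_nonneg a b Gamma_real_pos[of "b + 1"]
    by (auto simp: u_def v_def w_def P_def Q_def R_def kern_nonneg conv_nonneg)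
  have "\<bar>lin f t\<bar> \<le> P * v + Q * u + R * (v + w)"
    using * by (simp add: u_def v_def w_def P_def Q_def R_def algebra_simps)
  also have "\<dots> \<le> (P + Q + R) * (u + v + w)"
    using nn by (simp add: algebra_simps)
  finally show ?B
    by (simp add: u_def v_def w_def P_def Q_def R_def lin_const_def)
qed

end

section \<open>Functions with a power bound on the derivative\<close>

lemma powr_half_le:
  fixes t x :: real
  assumes "0 < t" "- n \<le> x" "0 \<le> n"
  shows "(t / 2) powr x \<le> 2 powr n * t powr x"
proof -
  have "(t / 2) powr x = 2 powr (- x) * t powr x"
    using assms by (simp add: powr_divide powr_minus field_simps)
  also have "\<dots> \<le> 2 powr n * t powr x"
    using assms by (intro mult_right_mono powr_mono) auto
  finally show ?thesis .
qed

text \<open>Mean value theorem: the intermediate point lies beyond t/2, where a nonpositive power is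
  at most its value at t/2. The applications take n = 1 and n = 2, whence their constants 2 and
  4.\<close>

lemma increment_le_of_deriv_powr:
  fixes f f' :: "real \<Rightarrow> real"
  assumes deriv: "\<And>s. 0 < s \<Longrightarrow> (f has_real_derivative f' s) (at s)"
    and bound: "\<And>s. 0 < s \<Longrightarrow> \<bar>f' s\<bar> \<le> N * s powr x"
    and x: "- n \<le> x" "x \<le> 0" "0 \<le> n" and N: "0 \<le> N" and t: "0 < t" "t / 2 \<le> s" "s < t"
  shows "\<bar>f t - f s\<bar> \<le> 2 powr n * N * t powr x * (t - s)"
proof -
  have "\<exists>z. s < z \<and> z < t \<and> f t - f s = (t - s) * f' z"
    by (rule MVT2) (use t in \<open>auto intro!: deriv\<close>)
  then obtain z where z: "s < z" "z < t" "f t - f s = (t - s) * f' z" by blast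
  have "\<bar>f' z\<bar> \<le> N * z powr x" by (rule bound) (use z t in auto)
  also have "\<dots> \<le> N * (t / 2) powr x"
    using N x z t by (intro mult_left_mono powr_mono2') auto
  also have "\<dots> \<le> N * (2 powr n * t powr x)"
    using N x t by (intro mult_left_mono powr_half_le) auto
  finally show ?thesis
    using z t by (simp add: abs_mult mult_ac mult_left_mono)
qed

lemma conv_kern_1_le:
  assumes [measurable]: "f \<in> borel_measurable borel" and "\<And>s. s \<le> 0 \<Longrightarrow> f s = 0"
    and bound: "\<And>s. 0 < s \<Longrightarrow> s < t \<Longrightarrow> \<bar>f s\<bar> \<le> B" and "0 < t"
  shows "integrable lborel (\<lambda>s. kern 1 (t - s) * \<bar>f s\<bar>)" (is ?A)
    and "conv (kern 1) (\<lambda>s. \<bar>f s\<bar>) t \<le> B * t" (is ?B)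
proof -
  have B: "has_bochner_integral lborel (\<lambda>s. B * (kern 1 (t - s) * kern 1 s)) (B * t)"
    using has_bochner_integral_mult_right[OF has_bochner_integral_kern[of 1 1 t], of B] assms
    by (simp add: kern_def[of 2] Gamma_numeral)
  have dom: "kern 1 (t - s) * \<bar>f s\<bar> \<le> B * (kern 1 (t - s) * kern 1 s)" for s
    using assms(2)[of s] bound[of s] by (auto simp: kern_def)
  show ?A
  proof (rule integrable_dominated)
    show "\<bar>kern 1 (t - s) * \<bar>f s\<bar>\<bar> \<le> B * (kern 1 (t - s) * kern 1 s)" for s
      using dom[of s] by (simp add: abs_mult kern_nonneg)
  qed (use B in \<open>auto simp: has_bochner_integral_iff\<close>)
  then have "conv (kern 1) (\<lambda>s. \<bar>f s\<bar>) t \<le> (LBINT s. B * (kern 1 (t - s) * kern 1 s))"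
    unfolding conv_def by (rule integral_mono[OF _ integrable.intros[OF B] dom])
  then show ?B
    using has_bochner_integral_integral_eq[OF B] by argo
qed

context relaxation begin

definition growth_const :: real where "growth_const = 1 + a * Gamma (1 - b)"

lemma growth_const_ge_1: "1 \<le> growth_const"
  using a b Gamma_real_pos[of "1 - b"] by (simp add: growth_const_def)

text \<open>By \<open>relax_lower\<close> the weight decays no faster than t^(-b), so a weighted
  bound permits growth of order t^b at most.\<close>

lemma le_of_weighted_le:
  assumes "0 < t" "\<bar>x * relax t\<bar> \<le> N"
  shows "\<bar>x\<bar> \<le> N * growth_const * max 1 (t powr b)"
proof -
  have G: "0 \<le> a * Gamma (1 - b)" using a b Gamma_real_pos[of "1 - b"] by simp
  have "0 \<le> N" using assms by linarith
  have "\<bar>x\<bar> * 1 \<le> \<bar>x\<bar> * ((1 + a * Gamma (1 - b) * t powr b) * relax t)"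
    by (intro mult_left_mono relax_lower assms) auto
  also have "\<dots> = (1 + a * Gamma (1 - b) * t powr b) * \<bar>x * relax t\<bar>"
    by (simp add: abs_mult relax_nonneg mult_ac)
  also have "\<dots> \<le> (1 * max 1 (t powr b) + a * Gamma (1 - b) * max 1 (t powr b)) * N"
    using G assms by (intro mult_mono add_mono mult_left_mono) auto
  finally show ?thesis by (simp add: growth_const_def algebra_simps)
qed

text \<open>The increment term has exponent (v - 1) + (1 - b) = v - b < 0, and the other terms see
  the size of f only relative to t^b.\<close>

lemma abs_lin_le_of_deriv:
  fixes f f' :: "real \<Rightarrow> real"
  assumes [measurable]: "f \<in> borel_measurable borel" and f0: "\<And>s. s \<le> 0 \<Longrightarrow> f s = 0"
    and deriv: "\<And>s. 0 < s \<Longrightarrow> (f has_real_derivative f' s) (at s)"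
    and bound: "\<And>s. 0 < s \<Longrightarrow> \<bar>f' s\<bar> \<le> N * s powr (v - 1)" and v: "0 < v" "v < b" and N: "0 \<le> N"
    and t: "0 < t" and B: "\<And>s. 0 < s \<Longrightarrow> s < t \<Longrightarrow> \<bar>f s\<bar> \<le> B"
  shows "\<bar>lin f t\<bar> \<le> lin_const * (2 * N * t powr (v - b) + t powr (- b) * \<bar>f t\<bar> + t powr (- b) * B)"
proof -
  have "\<bar>lin f t\<bar> \<le> lin_const * ((2 * N * t powr (v - 1)) * t powr (1 - b) + t powr (- b) * \<bar>f t\<bar>
          + t powr (- 1 - b) * conv (kern 1) (\<lambda>s. \<bar>f s\<bar>) t)"
  proof (rule abs_lin_le(2))
    show "integrable lborel (\<lambda>s. kern 1 (t - s) * \<bar>f s\<bar>)"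
      by (rule conv_kern_1_le(1)[OF _ f0 B]) (use t in auto)
    show "\<bar>f t - f s\<bar> \<le> 2 * N * t powr (v - 1) * (t - s)" if "t / 2 \<le> s" "s < t" for s
      using increment_le_of_deriv_powr[OF deriv bound, of 1 t s] that v b t N by simp
  qed (use f0 t N in auto)
  also have "(2 * N * t powr (v - 1)) * t powr (1 - b) = 2 * N * t powr (v - b)"
    using powr_add[of t "v - 1" "1 - b"] by (simp add: mult.assoc)
  also have "t powr (- 1 - b) * conv (kern 1) (\<lambda>s. \<bar>f s\<bar>) t \<le> t powr (- 1 - b) * (B * t)"
    by (intro mult_left_mono conv_kern_1_le(2)[OF _ f0 B]) (use t in auto)
  also have "t powr (- 1 - b) * (B * t) = t powr (- b) * B"
    using t by (simp add: powr_diff powr_minus field_simps)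
  finally show ?thesis
    using lin_const_nonneg by (simp add: mult_left_mono)
qed

lemma lin_bounded_of_deriv:
  fixes f f' :: "real \<Rightarrow> real"
  assumes [measurable]: "f \<in> borel_measurable borel" and f0: "\<And>s. s \<le> 0 \<Longrightarrow> f s = 0"
    and deriv: "\<And>s. 0 < s \<Longrightarrow> (f has_real_derivative f' s) (at s)"
    and bound: "\<And>s. 0 < s \<Longrightarrow> \<bar>f' s\<bar> \<le> N * s powr (v - 1)" and v: "0 < v" "v < b"
    and weighted: "\<And>s. 0 < s \<Longrightarrow> \<bar>f s * relax s\<bar> \<le> N"
    and t: "0 < t"
  shows "\<bar>lin f t\<bar> \<le> (2 + 4 * lin_const) * growth_const * N"
proof -
  have N: "0 \<le> N" using weighted[of 1] by simp
  have grow: "\<bar>f s\<bar> \<le> N * growth_const * max 1 (t powr b)" if "0 < s" "s \<le> t" for s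
  proof -
    have "s powr b \<le> t powr b" using that b by (intro powr_mono2) auto
    then have "N * growth_const * max 1 (s powr b) \<le> N * growth_const * max 1 (t powr b)"
      using N growth_const_ge_1 by (intro mult_left_mono) auto
    with le_of_weighted_le[OF that(1) weighted[OF that(1)]] show ?thesis by linarith
  qed
  have pos: "0 \<le> lin_const * (growth_const * N)" "0 \<le> growth_const * N"
    using lin_const_nonneg growth_const_ge_1 N by auto
  show ?thesis
  \<comment> \<open>The negative powers of t are useless near 0, where the trivial bound of twice
    the supremum suffices. It gives the 2 in the constant; the 4 collects 2 N and twice
    \<open>N * growth_const\<close>, using \<open>growth_const\<close> \<ge> 1.\<close>
  proof (cases "t \<le> 1")
    case True
    have "t powr b \<le> 1" using True t b by (intro powr_le1) auto
    have "\<bar>lin f t\<bar> \<le> 2 * (N * growth_const * max 1 (t powr b))"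
    proof (rule lin_bounded)
      show "\<bar>f s\<bar> \<le> N * growth_const * max 1 (t powr b)" if "s \<le> t" for s
        using grow[of s] that f0[of s] N growth_const_ge_1 by (cases "0 < s") auto
    qed simp
    then show ?thesis using \<open>t powr b \<le> 1\<close> pos by (simp add: algebra_simps)
  next
    case False
    then have "1 \<le> t powr b" using b by (intro ge_one_powr_ge_zero) auto
    then have m: "max 1 (t powr b) = t powr b" by simp
    have cancel: "t powr (- b) * t powr b = 1" using t by (simp add: powr_add[symmetric])
    have "\<bar>lin f t\<bar> \<le> lin_const * (2 * N * t powr (v - b) + t powr (- b) * \<bar>f t\<bar>
        + t powr (- b) * (N * growth_const * t powr b))"
      by (rule abs_lin_le_of_deriv[OF _ f0 deriv bound]) (use v N t grow m in auto)
    also have "\<dots> \<le> lin_const * (2 * N * 1 + t powr (- b) * (N * growth_const * t powr b)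
        + t powr (- b) * (N * growth_const * t powr b))"
    proof (intro mult_left_mono add_mono order.refl lin_const_nonneg)
      show "t powr (v - b) \<le> 1" using False v powr_mono[of "v - b" 0 t] by simp
      show "\<bar>f t\<bar> \<le> N * growth_const * t powr b" using grow[of t] t m by simp
    qed (use N growth_const_ge_1 in auto)
    also have "t powr (- b) * (N * growth_const * t powr b) = N * growth_const"
      using cancel by (simp add: mult_ac)
    also have "lin_const * (2 * N * 1 + N * growth_const + N * growth_const) \<le> lin_const * (4 * (growth_const * N))"
      using lin_const_nonneg mult_right_mono[OF growth_const_ge_1 N] by (intro mult_left_mono) (auto simp: mult_ac)
    finally show ?thesis using pos by (simp add: algebra_simps)
  qed
qed

lemma lin_tendsto_of_deriv:
  fixes f f' :: "real \<Rightarrow> real"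
  assumes [measurable]: "f \<in> borel_measurable borel" and f0: "\<And>s. s \<le> 0 \<Longrightarrow> f s = 0"
    and deriv: "\<And>s. 0 < s \<Longrightarrow> (f has_real_derivative f' s) (at s)"
    and bound: "\<And>s. 0 < s \<Longrightarrow> \<bar>f' s\<bar> \<le> N * s powr (v - 1)" and v: "0 < v" "v < b" and N: "0 \<le> N"
    and loc: "\<And>T. \<exists>B. \<forall>s. 0 < s \<and> s \<le> T \<longrightarrow> \<bar>f s\<bar> \<le> B"
    and slow: "((\<lambda>t. \<bar>f t\<bar> / t powr b) \<longlongrightarrow> 0) at_top"
  shows "(lin f \<longlongrightarrow> 0) at_top"
proof (rule Lim_null_comparison[rotated])
  \<comment> \<open>Of the 6 e, the derivative term takes 2 e. The current value and the past take 2
    e each: e for the bounded initial piece and e for the slow growth.\<close>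
  have *: "\<forall>\<^sub>F t in at_top. \<bar>lin f t\<bar> \<le> lin_const * (6 * e)" if "0 < e" for e
  proof -
    have "\<forall>\<^sub>F t in at_top. \<bar>f t\<bar> / t powr b < e"
      using slow order_tendstoD(2)[OF slow that] by simp
    then obtain T where T: "\<And>t. t \<ge> T \<Longrightarrow> \<bar>f t\<bar> / t powr b < e"
      by (auto simp: eventually_at_top_linorder)
    obtain B where B: "\<And>s. 0 < s \<Longrightarrow> s \<le> T \<Longrightarrow> \<bar>f s\<bar> \<le> B" using loc[of T] by auto
    define B' where "B' = max B 0"
    have all: "\<bar>f s\<bar> \<le> B' + e * t powr b" if "0 < s" "s \<le> t" for s t
    proof (cases "s \<le> T")
      case True
      then show ?thesis using B[of s] that add_increasing2[of "e * t powr b" "\<bar>f s\<bar>" B'] \<open>0 < e\<close> by (simp add: B'_def)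
    next
      case False
      then have "\<bar>f s\<bar> \<le> e * s powr b" using T[of s] that by (simp add: field_simps)
      also have "\<dots> \<le> e * t powr b" using that \<open>0 < e\<close> b by (intro mult_left_mono powr_mono2) auto
      finally show ?thesis by (simp add: B'_def)
    qed
    have lim1: "((\<lambda>t. N * t powr (v - b)) \<longlongrightarrow> 0) at_top"
      using v by (intro tendsto_mult_right_zero tendsto_neg_powr filterlim_ident) auto
    have lim2: "((\<lambda>t. B' * t powr (- b)) \<longlongrightarrow> 0) at_top"
      using b by (intro tendsto_mult_right_zero tendsto_neg_powr filterlim_ident) auto
    show ?thesis
      using order_tendstoD(2)[OF lim1 that] order_tendstoD(2)[OF lim2 that] eventually_gt_at_top[of 0]
    proof eventually_elim
      case (elim t)
      have cancel: "t powr (- b) * t powr b = 1" using elim by (simp add: powr_add[symmetric])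
      have "\<bar>lin f t\<bar> \<le> lin_const * (2 * N * t powr (v - b) + t powr (- b) * \<bar>f t\<bar>
        + t powr (- b) * (B' + e * t powr b))"
        by (rule abs_lin_le_of_deriv[OF _ f0 deriv bound]) (use v N elim all in auto)
      also have "\<dots> \<le> lin_const * (2 * N * t powr (v - b) + t powr (- b) * (B' + e * t powr b)
        + t powr (- b) * (B' + e * t powr b))"
        using elim all[of t t] by (intro mult_left_mono add_mono order.refl lin_const_nonneg) auto
      also have "t powr (- b) * (B' + e * t powr b) = B' * t powr (- b) + e"
        using cancel by (simp add: algebra_simps)
      also have "lin_const * (2 * N * t powr (v - b) + (B' * t powr (- b) + e) + (B' * t powr (- b) + e))
         \<le> lin_const * (6 * e)"
        using elim by (intro mult_left_mono lin_const_nonneg) auto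
      finally show ?case .
    qed
  qed
  show "((\<lambda>t. \<bar>lin f t\<bar>) \<longlongrightarrow> 0) at_top"
  proof (rule order_tendstoI)
    fix e :: real assume "0 < e"
    have pos: "0 < lin_const + 1" using lin_const_nonneg by simp
    have "\<forall>\<^sub>F t in at_top. \<bar>lin f t\<bar> \<le> lin_const * (6 * (e / (6 * (lin_const + 1))))"
      by (rule *) (use \<open>0 < e\<close> pos in simp)
    moreover have "lin_const * (6 * (e / (6 * (lin_const + 1)))) < e"
      using \<open>0 < e\<close> pos by (simp add: field_simps)
    ultimately show "\<forall>\<^sub>F t in at_top. \<bar>lin f t\<bar> < e"
      by (auto elim: eventually_mono)
  qed (auto intro: always_eventually less_le_trans)
qed simp

end

section \<open>Convolution of a singular kernel with a density in L1 and Lp\<close>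

text \<open>Used in place of Hoelder's inequality; \<open>l\<close> balances the two terms.\<close>

lemma Young_weighted:
  fixes x y p l :: real
  assumes "0 \<le> x" "0 \<le> y" "1 < p" "0 < l"
  shows "x * y \<le> l * x powr (p / (p - 1)) + l powr (1 - p) * y powr p"
\<comment> \<open>The split is at y = l * x^(1/(p-1)): below it the first term alone dominates the
  product, above it the second.\<close>
proof (cases "x = 0 \<or> y \<le> l * x powr (1 / (p - 1))")
  case True
  then have "x * y \<le> l * (x * x powr (1 / (p - 1)))"
    using mult_left_mono[of y "l * x powr (1 / (p - 1))" x] assms by (auto simp: mult_ac)
  also have "x * x powr (1 / (p - 1)) = x powr (p / (p - 1))"
  proof -
    have "1 + 1 / (p - 1) = p / (p - 1)" using assms by (simp add: field_simps)
    then show ?thesis using powr_mult_base[OF assms(1), of "1 / (p - 1)"] by simp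
  qed
  finally show ?thesis by (simp add: add_increasing2)
next
  case False
  then have "0 < x" "x powr (1 / (p - 1)) < y / l" using assms by (auto simp: field_simps)
  then have "0 < y" using assms by (smt (verit) powr_ge_zero zero_less_divide_iff)
  have "x = (x powr (1 / (p - 1))) powr (p - 1)"
    using \<open>0 < x\<close> assms by (simp add: powr_powr)
  also have "\<dots> \<le> (y / l) powr (p - 1)"
    using \<open>x powr (1 / (p - 1)) < y / l\<close> assms by (intro powr_mono2) auto
  also have "\<dots> = l powr (1 - p) * y powr (p - 1)"
    using \<open>0 < y\<close> assms by (simp add: powr_divide powr_diff field_simps)
  finally have "x * y \<le> l powr (1 - p) * (y powr (p - 1) * y)"
    using assms by (simp add: mult_right_mono mult.assoc[symmetric])
  also have "y powr (p - 1) * y = y powr p"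
    using \<open>0 < y\<close> by (simp add: powr_diff)
  finally show ?thesis using assms by (simp add: add_increasing)
qed

text \<open>The window (t - 1, t), where the kernel is singular, is handled by Young's inequality,
  the remaining past by boundedness. The second conclusion keeps the integrals localized in time, as
  needed for limits; the third is the uniform bound.\<close>

lemma singular_conv:
  fixes w g :: "real \<Rightarrow> real"
  assumes [measurable]: "w \<in> borel_measurable borel" "g \<in> borel_measurable borel"
    and w0: "\<And>u. u \<le> 0 \<Longrightarrow> w u = 0" and g0: "\<And>s. s \<le> 0 \<Longrightarrow> g s = 0"
    and p: "1 < p" "1 < \<eta> * p"
    and near: "\<And>u. 0 < u \<Longrightarrow> u < 1 \<Longrightarrow> \<bar>w u\<bar> \<le> C * u powr (\<eta> - 1)" and C: "0 \<le> C"
    and far: "\<And>u. 1 \<le> u \<Longrightarrow> u < t \<Longrightarrow> \<bar>w u\<bar> \<le> C2" and C2: "0 \<le> C2"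
    and g: "integrable lborel g" "integrable lborel (\<lambda>s. \<bar>g s\<bar> powr p)" and l: "0 < l"
  defines "x \<equiv> (\<eta> - 1) * (p / (p - 1)) + 1"
  shows "integrable lborel (\<lambda>s. w (t - s) * g s)" (is ?A)
    and "conv (\<lambda>u. \<bar>w u\<bar>) (\<lambda>s. \<bar>g s\<bar>) t \<le> (LBINT s. (if 1 \<le> t - s then \<bar>w (t - s)\<bar> else 0) * \<bar>g s\<bar>)
       + C * (l / x + l powr (1 - p) * (LBINT s. kern 1 (s - (t - 1)) * \<bar>g s\<bar> powr p))" (is ?B)
    and "conv (\<lambda>u. \<bar>w u\<bar>) (\<lambda>s. \<bar>g s\<bar>) t \<le> C2 * (LBINT s. \<bar>g s\<bar>)
       + C * (l / x + l powr (1 - p) * (LBINT s. \<bar>g s\<bar> powr p))" (is ?C)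
proof -
  \<comment> \<open>x - 1 is \<eta> - 1 times the conjugate exponent of p, so x > 0 is exactly the
    local integrability granted by \<eta> * p > 1.\<close>
  have "x * (p - 1) = \<eta> * p - 1" using p by (simp add: x_def field_simps)
  then have x: "0 < x" using p by (metis diff_gt_0_iff_gt zero_less_mult_pos2)
  then have Gx: "0 < Gamma x" by (rule Gamma_real_pos)
  define F where "F s = (if 1 \<le> t - s then \<bar>w (t - s)\<bar> else 0) * \<bar>g s\<bar>" for s
  \<comment> \<open>\<open>P\<close> is u^(x-1) on the window, with u = t - s, and integrates to
    1/x; \<open>F\<close> and \<open>Q\<close> are the far part and the windowed p-th power.\<close>
  define P where "P s = Gamma x * (kern x (t - s) * kern 1 (s - (t - 1)))" for s
  define Q where "Q s = kern 1 (s - (t - 1)) * \<bar>g s\<bar> powr p" for s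
  have F_le: "F s \<le> C2 * \<bar>g s\<bar>" for s
  proof (cases "0 < s \<and> 1 \<le> t - s")
    case True
    then show ?thesis using far[of "t - s"] by (simp add: F_def mult_right_mono)
  next
    case False
    then have "F s = 0" using g0[of s] by (auto simp: F_def)
    then show ?thesis using C2 by simp
  qed
  have F_nn: "0 \<le> F s" for s by (simp add: F_def)
  have intF: "integrable lborel F"
    by (rule integrable_dominated[of _ "\<lambda>s. C2 * \<bar>g s\<bar>"]) (use F_le F_nn g in \<open>auto simp: F_def[abs_def]\<close>)
  have P: "has_bochner_integral lborel P (1 / x)"
  proof -
    have "Gamma x * kern (x + 1) 1 = 1 / x"
    proof -
      have "x \<notin> \<int>\<^sub>\<le>\<^sub>0" using x nonpos_Ints_nonpos[of x] by auto
      then have "Gamma (x + 1) = x * Gamma x" by (rule Gamma_plus1)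
      then show ?thesis using Gx by (simp add: kern_def)
    qed
    then show ?thesis
      using has_bochner_integral_mult_right[OF has_bochner_integral_kern_shift[OF x zero_less_one, of t "t - 1"], of "Gamma x"]
      by (simp add: P_def[abs_def])
  qed
  have Q_le: "Q s \<le> \<bar>g s\<bar> powr p" and Q_nn: "0 \<le> Q s" for s by (auto simp: Q_def kern_def)
  have intQ: "integrable lborel Q"
    by (rule integrable_dominated[OF g(2)]) (use Q_le Q_nn in \<open>auto simp: Q_def[abs_def]\<close>)
  have dom: "\<bar>w (t - s)\<bar> * \<bar>g s\<bar> \<le> F s + C * (l * P s + l powr (1 - p) * Q s)" for s
  proof -
    have nn: "0 \<le> C * (l * P s + l powr (1 - p) * Q s)"
      using C l x Gx by (simp add: P_def Q_nn kern_nonneg)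
    consider "t - s \<le> 0" | "0 < t - s" "t - s < 1" | "1 \<le> t - s" by linarith
    then show ?thesis
    proof cases
      case 1
      then show ?thesis using w0 F_nn nn by simp
    next
      case 2
      let ?u = "t - s"
      have "\<bar>w ?u\<bar> * \<bar>g s\<bar> \<le> C * (?u powr (\<eta> - 1) * \<bar>g s\<bar>)"
        using near[OF 2] by (simp add: mult_right_mono mult.assoc[symmetric])
      also have "?u powr (\<eta> - 1) * \<bar>g s\<bar> \<le> l * (?u powr (\<eta> - 1)) powr (p / (p - 1)) + l powr (1 - p) * \<bar>g s\<bar> powr p"
        by (rule Young_weighted) (use p l in auto)
      also have "(?u powr (\<eta> - 1)) powr (p / (p - 1)) = P s"
        using 2 Gx by (simp add: powr_powr P_def kern_def x_def)
      also have "\<bar>g s\<bar> powr p = Q s"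
        using 2 by (simp add: Q_def kern_def)
      finally show ?thesis using F_nn[of s] C by (simp add: mult_left_mono)
    next
      case 3
      then show ?thesis using nn by (simp add: F_def)
    qed
  qed
  have intD: "integrable lborel (\<lambda>s. F s + C * (l * P s + l powr (1 - p) * Q s))"
    using P intF intQ by (auto simp: has_bochner_integral_iff)
  show ?A
    by (rule integrable_dominated[OF intD]) (use dom in \<open>auto simp: abs_mult\<close>)
  have "conv (\<lambda>u. \<bar>w u\<bar>) (\<lambda>s. \<bar>g s\<bar>) t \<le> (LBINT s. F s + C * (l * P s + l powr (1 - p) * Q s))"
    unfolding conv_def using integrable_abs[OF \<open>?A\<close>]
    by (intro integral_mono intD dom) (simp add: abs_mult)
  also have "\<dots> = (LBINT s. F s) + C * (l / x + l powr (1 - p) * (LBINT s. Q s))"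
    using P intF intQ by (simp add: has_bochner_integral_iff)
  finally show B: ?B by (simp add: F_def Q_def)
  have "(LBINT s. F s) \<le> C2 * (LBINT s. \<bar>g s\<bar>)"
    using integral_mono[OF intF _ F_le] g(1) by simp
  moreover have "C * (l / x + l powr (1 - p) * (LBINT s. Q s)) \<le> C * (l / x + l powr (1 - p) * (LBINT s. \<bar>g s\<bar> powr p))"
    by (intro mult_left_mono add_left_mono C integral_mono intQ g Q_le) auto
  ultimately show ?C using B by (simp add: F_def Q_def)
qed

text \<open>The order of choices matters: l is fixed first to make C * l / x small. Then the p-th
  power mass of g on (t - 1, t) tends to 0 and defeats the large but fixed factor
  \<open>l powr (1 - p)\<close>.\<close>

lemma singular_conv_tendsto:
  fixes w g :: "real \<Rightarrow> real"
  assumes [measurable]: "w \<in> borel_measurable borel" "g \<in> borel_measurable borel"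
    and w0: "\<And>u. u \<le> 0 \<Longrightarrow> w u = 0" and g0: "\<And>s. s \<le> 0 \<Longrightarrow> g s = 0"
    and p: "1 < p" "1 < \<eta> * p"
    and near: "\<And>u. 0 < u \<Longrightarrow> u < 1 \<Longrightarrow> \<bar>w u\<bar> \<le> C * u powr (\<eta> - 1)" and C: "0 \<le> C"
    and far: "\<And>u. 1 \<le> u \<Longrightarrow> \<bar>w u\<bar> \<le> C2" and lim: "(w \<longlongrightarrow> 0) at_top"
    and g: "integrable lborel g" "integrable lborel (\<lambda>s. \<bar>g s\<bar> powr p)"
  shows "(conv w g \<longlongrightarrow> 0) at_top"
proof (rule Lim_null_comparison[rotated])
  define x where "x = (\<eta> - 1) * (p / (p - 1)) + 1"
  define F where "F t s = (if 1 \<le> t - s then \<bar>w (t - s)\<bar> else 0) * \<bar>g s\<bar>" for t s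
  define Q where "Q t s = kern 1 (s - (t - 1)) * \<bar>g s\<bar> powr p" for t s
  have [measurable]: "F t \<in> borel_measurable borel" "Q t \<in> borel_measurable borel" for t
    by (simp_all add: F_def[abs_def] Q_def[abs_def])
  have "x * (p - 1) = \<eta> * p - 1" using p by (simp add: x_def field_simps)
  then have x: "0 < x" using p by (metis diff_gt_0_iff_gt zero_less_mult_pos2)
  have C2: "0 \<le> C2" using far[of 1] by simp
  have limF: "((\<lambda>t. LBINT s. F t s) \<longlongrightarrow> (LBINT s::real. 0)) at_top"
  proof (rule integral_dominated_convergence_at_top)
    show "AE s in lborel. ((\<lambda>t. F t s) \<longlongrightarrow> 0) at_top"
    proof (intro always_eventually allI)
      fix s
      have "((\<lambda>t. w (t - s)) \<longlongrightarrow> 0) at_top"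
        using filterlim_compose[OF lim filterlim_tendsto_add_at_top[OF tendsto_const[of "-s"] filterlim_ident]]
        by simp
      then have "((\<lambda>t. \<bar>w (t - s)\<bar> * \<bar>g s\<bar>) \<longlongrightarrow> 0) at_top"
        by (intro tendsto_mult_left_zero tendsto_rabs_zero)
      then show "((\<lambda>t. F t s) \<longlongrightarrow> 0) at_top"
        by (rule Lim_null_comparison[rotated]) (auto simp: F_def abs_mult)
    qed
    show "\<forall>\<^sub>F t in at_top. AE s in lborel. norm (F t s) \<le> C2 * \<bar>g s\<bar>"
      using far C2 by (intro always_eventually allI) (auto simp: F_def abs_mult intro!: mult_right_mono)
  qed (use g in auto)
  have limQ: "((\<lambda>t. LBINT s. Q t s) \<longlongrightarrow> (LBINT s::real. 0)) at_top"
  proof (rule integral_dominated_convergence_at_top)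
    show "AE s in lborel. ((\<lambda>t. Q t s) \<longlongrightarrow> 0) at_top"
    proof (rule AE_I2)
      fix s
      have "\<forall>\<^sub>F t in at_top. Q t s = 0"
        using eventually_ge_at_top[of "s + 1"] by eventually_elim (simp add: Q_def kern_def)
      then show "((\<lambda>t. Q t s) \<longlongrightarrow> 0) at_top" by (rule tendsto_eventually)
    qed
    show "\<forall>\<^sub>F t in at_top. AE s in lborel. norm (Q t s) \<le> \<bar>g s\<bar> powr p"
      by (auto simp: Q_def kern_def)
  qed (use g in auto)
  show "\<forall>\<^sub>F t in at_top. norm (conv w g t) \<le> conv (\<lambda>u. \<bar>w u\<bar>) (\<lambda>s. \<bar>g s\<bar>) t"
    by (simp add: abs_conv_le)
  show "(conv (\<lambda>u. \<bar>w u\<bar>) (\<lambda>s. \<bar>g s\<bar>) \<longlongrightarrow> 0) at_top"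
  proof (rule order_tendstoI)
    fix e :: real assume e: "0 < e"
    define l where "l = e * x / (2 * (C + 1))"
    have l: "0 < l" using e x C by (simp add: l_def)
    have "((\<lambda>t. (LBINT s. F t s) + C * (l / x + l powr (1 - p) * (LBINT s. Q t s)))
        \<longlongrightarrow> 0 + C * (l / x + l powr (1 - p) * 0)) at_top"
      using limF limQ by (intro tendsto_intros) auto
    moreover have "0 + C * (l / x + l powr (1 - p) * 0) < e"
    proof -
      have "C * (l / x) = e * (C / (2 * (C + 1)))" using x C by (simp add: l_def)
      also have "\<dots> < e * 1" using e C by (intro mult_strict_left_mono) auto
      finally show ?thesis by simp
    qed
    ultimately have "\<forall>\<^sub>F t in at_top. (LBINT s. F t s) + C * (l / x + l powr (1 - p) * (LBINT s. Q t s)) < e"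
      by (rule order_tendstoD)
    then show "\<forall>\<^sub>F t in at_top. conv (\<lambda>u. \<bar>w u\<bar>) (\<lambda>s. \<bar>g s\<bar>) t < e"
    proof eventually_elim
      case (elim t)
      have "conv (\<lambda>u. \<bar>w u\<bar>) (\<lambda>s. \<bar>g s\<bar>) t \<le> (LBINT s. F t s) + C * (l / x + l powr (1 - p) * (LBINT s. Q t s))"
        unfolding F_def Q_def x_def
        by (rule singular_conv(2)[OF _ _ w0 g0 p near C far C2 g l]) auto
      with elim show ?case by linarith
    qed
  next
    fix y :: real assume "y < 0"
    then have "y < conv (\<lambda>u. \<bar>w u\<bar>) (\<lambda>s. \<bar>g s\<bar>) t" for t
      using conv_nonneg[of "\<lambda>u. \<bar>w u\<bar>" "\<lambda>s. \<bar>g s\<bar>" t] by simp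
    then show "\<forall>\<^sub>F t in at_top. y < conv (\<lambda>u. \<bar>w u\<bar>) (\<lambda>s. \<bar>g s\<bar>) t"
      by (simp add: always_eventually)
  qed
qed

context relaxation begin

text \<open>\<open>ml b a \<eta>\<close> is \<open>lin\<close> of \<open>kern \<eta>\<close>, so
  \<open>abs_lin_le\<close> applies; by homogeneity all three of its terms scale like
  t^(\<eta>-1-b).\<close>

lemma abs_ml_le:
  assumes eta: "0 < \<eta>" "\<eta> < b + 1" and t: "0 < t"
  shows "\<bar>ml b a \<eta> t\<bar> \<le> lin_const * (4 * \<bar>\<eta> - 1\<bar> / Gamma \<eta> + 1 / Gamma \<eta> + 1 / Gamma (\<eta> + 1)) * t powr (\<eta> - 1 - b)"
proof -
  have G: "0 < Gamma \<eta>" using eta by (simp add: Gamma_real_pos)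
  have "ml b a \<eta> t = lin (kern \<eta>) t"
    using ml_eq_kern_minus[of b \<eta> a t] conv_kern_rho[of \<eta> t] conv_commute[of rho "kern \<eta>" t] eta b
    by (simp add: lin_def)
  also have "\<bar>\<dots>\<bar> \<le> lin_const * ((4 * (\<bar>\<eta> - 1\<bar> / Gamma \<eta>) * t powr (\<eta> - 2)) * t powr (1 - b) + t powr (- b) * \<bar>kern \<eta> t\<bar>
          + t powr (- 1 - b) * conv (kern 1) (\<lambda>s. \<bar>kern \<eta> s\<bar>) t)"
  proof (rule abs_lin_le(2))
    show "integrable lborel (\<lambda>s. kern 1 (t - s) * \<bar>kern \<eta> s\<bar>)"
      using kern_integrable[of 1 \<eta> t] eta by (simp add: kern_nonneg)
    fix s assume s: "t / 2 \<le> s" "s < t"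
    have der: "(kern \<eta> has_real_derivative (\<eta> - 1) * s powr (\<eta> - 2) / Gamma \<eta>) (at s)" if "0 < s" for s
    proof -
      have "((\<lambda>s. s powr (\<eta> - 1) / Gamma \<eta>) has_real_derivative (\<eta> - 1) * s powr (\<eta> - 2) / Gamma \<eta>) (at s)"
        using DERIV_cdivide[OF has_real_derivative_powr[OF that, of "\<eta> - 1"], of "Gamma \<eta>"] by simp
      then show ?thesis
        by (rule has_field_derivative_transform_within_open[where S="{0<..}"]) (use that in \<open>auto simp: kern_def\<close>)
    qed
    have "\<bar>kern \<eta> t - kern \<eta> s\<bar> \<le> 2 powr 2 * (\<bar>\<eta> - 1\<bar> / Gamma \<eta>) * t powr (\<eta> - 2) * (t - s)"
      by (rule increment_le_of_deriv_powr[OF der]) (use eta b G t s in \<open>auto simp: abs_mult\<close>)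
    then show "\<bar>kern \<eta> t - kern \<eta> s\<bar> \<le> 4 * (\<bar>\<eta> - 1\<bar> / Gamma \<eta>) * t powr (\<eta> - 2) * (t - s)"
      by simp
  qed (use t G in \<open>auto simp: kern_def\<close>)
  also have "conv (kern 1) (\<lambda>s. \<bar>kern \<eta> s\<bar>) t = kern (\<eta> + 1) t"
    using conv_kern[of 1 \<eta> t] eta by (simp add: kern_nonneg add.commute)
  also have "t powr (- 1 - b) * kern (\<eta> + 1) t = 1 / Gamma (\<eta> + 1) * t powr (\<eta> - 1 - b)"
    using t powr_add[of t "- 1 - b" \<eta>] by (simp add: kern_def algebra_simps)
  also have "t powr (- b) * \<bar>kern \<eta> t\<bar> = 1 / Gamma \<eta> * t powr (\<eta> - 1 - b)"
    using t G powr_add[of t "- b" "\<eta> - 1"] by (simp add: kern_def algebra_simps)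
  also have "4 * (\<bar>\<eta> - 1\<bar> / Gamma \<eta>) * t powr (\<eta> - 2) * t powr (1 - b) = 4 * \<bar>\<eta> - 1\<bar> / Gamma \<eta> * t powr (\<eta> - 1 - b)"
    using powr_add[of t "\<eta> - 2" "1 - b"] by (simp add: algebra_simps)
  finally show ?thesis by (simp add: algebra_simps)
qed

text \<open>The bound of \<open>abs_ml_le\<close> is too singular at 0 by a factor t^(-b); for u < 1
  the recursion \<open>ml_eq_kern_minus\<close> with positive second term replaces it. A single C is
  offered in the form that \<open>singular_conv\<close> expects.\<close>

lemma ml_bounds:
  assumes eta: "0 < \<eta>" "\<eta> < b + 1"
  obtains C where "0 \<le> C" "\<And>u. 0 < u \<Longrightarrow> u < 1 \<Longrightarrow> \<bar>ml b a \<eta> u\<bar> \<le> C * u powr (\<eta> - 1)"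
    "\<And>u. 1 \<le> u \<Longrightarrow> \<bar>ml b a \<eta> u\<bar> \<le> C" "(ml b a \<eta> \<longlongrightarrow> 0) at_top"
proof -
  have G: "0 < Gamma \<eta>" "0 < Gamma (\<eta> + 1)" "0 < Gamma (\<eta> + b)" using eta b by (auto simp: Gamma_real_pos)
  define L where "L = lin_const * (4 * \<bar>\<eta> - 1\<bar> / Gamma \<eta> + 1 / Gamma \<eta> + 1 / Gamma (\<eta> + 1))"
  define C where "C = max L (1 / Gamma \<eta> + a / Gamma (\<eta> + b))"
  have L: "\<bar>ml b a \<eta> u\<bar> \<le> L * u powr (\<eta> - 1 - b)" if "0 < u" for u
    using abs_ml_le[OF eta that] by (simp add: L_def)
  have L0: "0 \<le> L" using lin_const_nonneg G by (simp add: L_def)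
  show ?thesis
  proof
    show "0 \<le> C" using L0 by (simp add: C_def)
    show "\<bar>ml b a \<eta> u\<bar> \<le> C" if "1 \<le> u" for u
    proof -
      have "u powr (\<eta> - 1 - b) \<le> 1" using that eta powr_mono[of "\<eta> - 1 - b" 0 u] by simp
      then have "L * u powr (\<eta> - 1 - b) \<le> L * 1" using L0 by (intro mult_left_mono)
      then show ?thesis using L[of u] that by (simp add: C_def)
    qed
    show "\<bar>ml b a \<eta> u\<bar> \<le> C * u powr (\<eta> - 1)" if "0 < u" "u < 1" for u
    proof -
      have "\<bar>ml b a \<eta> u\<bar> \<le> kern \<eta> u + a * kern (\<eta> + b) u"
        using ml_eq_kern_minus[of b \<eta> a u] ml_nonneg[of "\<eta> + b" u] ml_le_kern[of "\<eta> + b" u] kern_nonneg[of \<eta> u]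
          mult_left_mono[of "ml b a (\<eta> + b) u" "kern (\<eta> + b) u" a] mult_nonneg_nonneg[of a "ml b a (\<eta> + b) u"] eta a b by linarith
      also have "u powr (\<eta> + b - 1) \<le> u powr (\<eta> - 1)"
        using that b by (intro powr_mono') auto
      then have "kern \<eta> u + a * kern (\<eta> + b) u \<le> (1 / Gamma \<eta> + a / Gamma (\<eta> + b)) * u powr (\<eta> - 1)"
        using that a G by (simp add: kern_def distrib_right divide_right_mono mult_left_mono)
      also have "\<dots> \<le> C * u powr (\<eta> - 1)"
        by (intro mult_right_mono) (auto simp: C_def)
      finally show ?thesis .
    qed
    have "((\<lambda>u. L * u powr (\<eta> - 1 - b)) \<longlongrightarrow> 0) at_top"
      using eta by (intro tendsto_mult_right_zero tendsto_neg_powr filterlim_ident) auto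
    then show "(ml b a \<eta> \<longlongrightarrow> 0) at_top"
      by (rule Lim_null_comparison[rotated]) (use L in \<open>auto intro: eventually_mono[OF eventually_gt_at_top[of 0]]\<close>)
  qed
qed

text \<open>\<open>lin\<close> is moved from the convolution to its kernel, which it turns into the
  decaying \<open>ml b a \<eta>\<close>. The associativity behind this needs the local bound from
  \<open>singular_conv\<close>.\<close>

lemma lin_conv_kern:
  fixes g :: "real \<Rightarrow> real"
  assumes [measurable]: "g \<in> borel_measurable borel" and g0: "\<And>s. s \<le> 0 \<Longrightarrow> g s = 0"
    and eta: "0 < \<eta>" "\<eta> < b + 1" and p: "1 < p" "1 < \<eta> * p"
    and g: "integrable lborel g" "integrable lborel (\<lambda>s. \<bar>g s\<bar> powr p)"
  shows "integrable lborel (\<lambda>s. rho (t - s) * conv (kern \<eta>) g s)" (is ?A)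
    and "lin (conv (kern \<eta>) g) t = conv (ml b a \<eta>) g t" (is ?B)
proof -
  have G: "0 < Gamma \<eta>" using eta by (simp add: Gamma_real_pos)
  have [measurable]: "ml b a \<eta> \<in> borel_measurable borel"
    by (rule ml_measurable) (use b eta in auto)
  \<comment> \<open>For \<eta> > 1 the kernel grows, so it is bounded only up to the time t under
    consideration.\<close>
  define M where "M = max 1 (t powr (\<eta> - 1)) / Gamma \<eta>"
  define x where "x = (\<eta> - 1) * (p / (p - 1)) + 1"
  define B where "B = M * (LBINT s. \<bar>g s\<bar>) + 1 / Gamma \<eta> * (1 / x + 1 powr (1 - p) * (LBINT s. \<bar>g s\<bar> powr p))"
  have near: "\<bar>kern \<eta> u\<bar> \<le> 1 / Gamma \<eta> * u powr (\<eta> - 1)" if "0 < u" "u < 1" for u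
    using that G by (simp add: kern_def)
  have far: "\<bar>kern \<eta> u\<bar> \<le> max 1 (s powr (\<eta> - 1)) / Gamma \<eta>" if "1 \<le> u" "u < s" for u s
  proof (cases "\<eta> \<le> 1")
    case True
    then have "u powr (\<eta> - 1) \<le> 1" using that powr_mono[of "\<eta> - 1" 0 u] by simp
    then show ?thesis using that G by (simp add: kern_def divide_right_mono)
  next
    case False
    then have "u powr (\<eta> - 1) \<le> s powr (\<eta> - 1)" using that by (intro powr_mono2) auto
    then show ?thesis using that G by (simp add: kern_def divide_right_mono)
  qed
  have farM: "\<bar>kern \<eta> u\<bar> \<le> M" if "1 \<le> u" "u < s" "s < t" for u s
    using far[of u t] that by (simp add: M_def)
  have int: "integrable lborel (\<lambda>u. kern \<eta> (s - u) * g u)" for s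
    by (rule singular_conv(1)[OF _ _ _ g0 p near _ far _ g zero_less_one]) (use G in \<open>auto simp: kern_def\<close>)
  have bound: "conv (\<lambda>u. \<bar>kern \<eta> u\<bar>) (\<lambda>s. \<bar>g s\<bar>) s \<le> B" if "s < t" for s
    unfolding B_def x_def
    by (rule singular_conv(3)[OF _ _ _ g0 p near _ farM _ g zero_less_one]) (use G that in \<open>auto simp: kern_def M_def\<close>)
  have bound': "\<bar>conv (kern \<eta>) g s\<bar> \<le> B" if "s < t" for s
    by (rule order_trans[OF abs_conv_le bound[OF that]])
  show ?A
    by (rule conv_rho_bounded(1)[OF _ bound']) auto
  have "conv rho (conv (kern \<eta>) g) t = conv (conv rho (kern \<eta>)) g t"
  proof (rule conv_assoc[OF _ _ _ int])
    have "integrable lborel (\<lambda>s. rho (t - s) * conv (\<lambda>u. \<bar>kern \<eta> u\<bar>) (\<lambda>u. \<bar>g u\<bar>) s)"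
    proof (rule conv_rho_bounded(1))
      show "\<bar>conv (\<lambda>u. \<bar>kern \<eta> u\<bar>) (\<lambda>u. \<bar>g u\<bar>) s\<bar> \<le> B" if "s < t" for s
        using bound[OF that] conv_nonneg[of "\<lambda>u. \<bar>kern \<eta> u\<bar>" "\<lambda>u. \<bar>g u\<bar>" s] by simp
    qed auto
    then show "integrable lborel (\<lambda>s. \<bar>rho (t - s)\<bar> * conv (\<lambda>u. \<bar>kern \<eta> u\<bar>) (\<lambda>u. \<bar>g u\<bar>) s)"
      by (simp add: rho_nonneg)
  qed auto
  moreover have "a * conv rho (kern \<eta>) s = kern \<eta> s - ml b a \<eta> s" for s
    using ml_eq_kern_minus[of b \<eta> a s] conv_kern_rho[of \<eta> s] conv_commute[of rho "kern \<eta>" s] eta b by simp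
  then have conv_eq: "conv rho (kern \<eta>) s = (kern \<eta> s - ml b a \<eta> s) / a" for s
    using a by (simp add: field_simps)
  obtain C where C: "0 \<le> C" "\<And>u. 0 < u \<Longrightarrow> u < 1 \<Longrightarrow> \<bar>ml b a \<eta> u\<bar> \<le> C * u powr (\<eta> - 1)"
    "\<And>u. 1 \<le> u \<Longrightarrow> \<bar>ml b a \<eta> u\<bar> \<le> C"
    using ml_bounds[OF eta] by metis
  have "integrable lborel (\<lambda>s. ml b a \<eta> (t - s) * g s)"
    by (rule singular_conv(1)[OF _ _ _ g0 p C(2) C(1) C(3) C(1) g zero_less_one]) (auto simp: ml_nonpos)
  then have "conv (conv rho (kern \<eta>)) g t = (conv (kern \<eta>) g t - conv (ml b a \<eta>) g t) / a"
    using int[of t] unfolding conv_def[of _ g] conv_eq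
    by (simp add: left_diff_distrib diff_divide_distrib)
  ultimately show ?B
    using a by (simp add: lin_def)
qed


section \<open>Nonlinear equations\<close>

text \<open>The third claim is the resolvent equation
  \<open>a * conv rho (kern b) = kern b - rho\<close>, convolved with z. The majorants are kernels,
  by \<open>rho_le_kern\<close>.\<close>

lemma conv_kern_bounded:
  fixes z :: "real \<Rightarrow> real"
  assumes [measurable]: "z \<in> borel_measurable borel" and z0: "\<And>s. s \<le> 0 \<Longrightarrow> z s = 0"
    and bound: "\<And>s. \<bar>z s\<bar> \<le> B"
  shows "integrable lborel (\<lambda>s. kern b (t - s) * z s)" (is ?A)
    and "integrable lborel (\<lambda>s. rho (t - s) * conv (kern b) z s)" (is ?B)
    and "a * conv rho (conv (kern b) z) t = conv (kern b) z t - conv rho z t" (is ?C)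
proof -
  have dom: "\<bar>kern b (t - s) * z s\<bar> \<le> B * (kern b (t - s) * kern 1 s)" for s t
    using mult_left_mono[OF bound[of s] kern_nonneg[OF b(1), of "t - s"]] z0[of s]
    by (cases "0 < s") (simp_all add: abs_mult kern_nonneg b kern_one mult_ac kern_def[of 1])
  have int: "integrable lborel (\<lambda>s. kern b (t - s) * z s)" for t
    by (rule integrable_dominated[OF _ _ dom]) (auto intro: integrable_mult_right kern_integrable b)
  then show ?A .
  have absz: "conv (\<lambda>u. \<bar>kern b u\<bar>) (\<lambda>u. \<bar>z u\<bar>) s \<le> B * kern (b + 1) s" for s
  proof -
    have "conv (\<lambda>u. \<bar>kern b u\<bar>) (\<lambda>u. \<bar>z u\<bar>) s \<le> (LBINT u. B * (kern b (s - u) * kern 1 u))"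
      unfolding conv_def
    proof (rule integral_mono)
      show "integrable lborel (\<lambda>u. \<bar>kern b (s - u)\<bar> * \<bar>z u\<bar>)"
        using integrable_abs[OF int[of s]] by (simp add: abs_mult)
      show "integrable lborel (\<lambda>u. B * (kern b (s - u) * kern 1 u))"
        using b by (auto intro: integrable_mult_right kern_integrable)
    qed (use dom in \<open>simp add: abs_mult\<close>)
    also have "\<dots> = B * kern (b + 1) s"
      using conv_kern[of b 1 s] b by (simp add: conv_def)
    finally show ?thesis .
  qed
  have dom2: "rho (t - s) * conv (\<lambda>u. \<bar>kern b u\<bar>) (\<lambda>u. \<bar>z u\<bar>) s \<le> B * (kern b (t - s) * kern (b + 1) s)" for s
  proof -
    have "rho (t - s) * conv (\<lambda>u. \<bar>kern b u\<bar>) (\<lambda>u. \<bar>z u\<bar>) s \<le> kern b (t - s) * (B * kern (b + 1) s)"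
      by (rule mult_mono[OF rho_le_kern absz]) (auto intro: kern_nonneg b conv_nonneg)
    then show ?thesis by (simp add: mult_ac)
  qed
  have intd: "integrable lborel (\<lambda>s. B * (kern b (t - s) * kern (b + 1) s))"
    using b by (auto intro: integrable_mult_right kern_integrable)
  have nn: "0 \<le> conv (\<lambda>u. \<bar>kern b u\<bar>) (\<lambda>u. \<bar>z u\<bar>) s" for s
    by (rule conv_nonneg) auto
  show ?B
  proof (rule integrable_dominated[OF intd])
    show "\<bar>rho (t - s) * conv (kern b) z s\<bar> \<le> B * (kern b (t - s) * kern (b + 1) s)" for s
      using mult_left_mono[OF abs_conv_le[of "kern b" z s] rho_nonneg[of "t - s"]] dom2[of s]
      by (simp add: abs_mult rho_nonneg)
  qed auto
  have "conv rho (conv (kern b) z) t = conv (conv rho (kern b)) z t"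
  proof (rule conv_assoc[OF _ _ _ int])
    show "integrable lborel (\<lambda>s. \<bar>rho (t - s)\<bar> * conv (\<lambda>u. \<bar>kern b u\<bar>) (\<lambda>u. \<bar>z u\<bar>) s)"
      by (rule integrable_dominated[OF intd]) (use dom2 nn in \<open>auto simp: rho_nonneg abs_mult\<close>)
  qed auto
  also have "\<dots> = (conv (kern b) z t - conv rho z t) / a"
  proof -
    have "conv rho (kern b) s = (kern b s - rho s) / a" for s
      using ml_volterra[OF b(1) b(1), of a s] a conv_commute[of rho "kern b" s]
      by (simp add: rho_def field_simps)
    moreover have "integrable lborel (\<lambda>s. rho (t - s) * z s)"
      by (rule conv_rho_bounded(1)[OF _ bound]) simp
    ultimately show ?thesis
      using int[of t] by (simp add: conv_def left_diff_distrib diff_divide_distrib)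
  qed
  finally show ?C using a by simp
qed

text \<open>The equation is convolved with \<open>a * rho\<close>. By the resolvent equation the
  terms \<open>a * conv rho z\<close> cancel, and what remains expresses the fractional integral of
  H - a * z through \<open>rho\<close>. Times after t do not enter, since \<open>rho\<close>
  vanishes at nonpositive arguments.\<close>

lemma variation_of_constants:
  fixes z x H :: "real \<Rightarrow> real"
  assumes [measurable]: "z \<in> borel_measurable borel" "x \<in> borel_measurable borel" "H \<in> borel_measurable borel"
    and z: "\<And>s. s \<le> 0 \<Longrightarrow> z s = 0" "\<And>s. \<bar>z s\<bar> \<le> Bz"
    and x: "\<And>s. s \<le> 0 \<Longrightarrow> x s = 0" "\<And>s. \<bar>x s\<bar> \<le> Bx"
    and H: "\<And>s. s \<le> 0 \<Longrightarrow> H s = 0" "\<And>s. \<bar>H s\<bar> \<le> BH"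
    and eq: "\<And>s. 0 < s \<Longrightarrow> s \<le> t \<Longrightarrow> z s = x s - a * conv (kern b) z s + conv (kern b) H s" and t: "0 < t"
  shows "z t = lin x t + conv rho H t"
proof -
  note cz = conv_kern_bounded[OF _ z, where t = t] and cH = conv_kern_bounded[OF _ H, where t = t]
  have ix: "integrable lborel (\<lambda>s. rho (t - s) * x s)"
    by (rule conv_rho_bounded(1)[OF _ x(2)]) simp
  have "rho (t - s) * z s = rho (t - s) * x s - a * (rho (t - s) * conv (kern b) z s) + rho (t - s) * conv (kern b) H s" for s
  proof -
    consider "s \<le> 0" | "t \<le> s" | "0 < s" "s < t" by linarith
    then show ?thesis
    proof cases
      case 1
      have "(\<lambda>u. kern b (s - u) * z u) = (\<lambda>u. 0)" "(\<lambda>u. kern b (s - u) * H u) = (\<lambda>u. 0)"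
        using 1 z(1) H(1) by (force simp: kern_def)+
      then have "conv (kern b) z s = 0" "conv (kern b) H s = 0"
        by (simp_all add: conv_def)
      then show ?thesis using 1 z(1) x(1) by simp
    next
      case 2
      then show ?thesis by (simp add: rho_nonpos)
    next
      case 3
      then show ?thesis by (subst eq) (auto simp: algebra_simps)
    qed
  qed
  then have "conv rho z t = conv rho x t - a * conv rho (conv (kern b) z) t + conv rho (conv (kern b) H) t"
    unfolding conv_def[of rho] using ix cz(2) cH(2) by simp
  from arg_cong[OF this, of "\<lambda>y. a * y"]
  have "a * conv rho z t = a * conv rho x t - a * (a * conv rho (conv (kern b) z) t) + a * conv rho (conv (kern b) H) t"
    by (simp add: distrib_left right_diff_distrib)
  then have "conv (kern b) H t - a * conv (kern b) z t = conv rho H t - a * conv rho x t"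
    using cz(3) cH(3) by (simp add: algebra_simps)
  then show ?thesis
    using eq[of t] t by (simp add: lin_def)
qed

end

section \<open>From the fractional integral equation to estimates of solutions\<close>

text \<open>The value at \<open>0\<close> is dropped; integrals do not see it, and pointwise bounds there are treated separately.\<close>

definition restrict_pos :: "(real \<Rightarrow> real) \<Rightarrow> real \<Rightarrow> real" where
  "restrict_pos f s = (if 0 < s then f s else 0)"

lemma restrict_pos_measurable:
  assumes "continuous_on {0..} f"
  shows "restrict_pos f \<in> borel_measurable borel"
proof -
  have "(\<lambda>s. indicator {0<..} s *\<^sub>R f s) \<in> borel_measurable borel"
    by (rule borel_measurable_continuous_on_indicator) (auto intro: continuous_on_subset[OF assms])
  moreover have "(\<lambda>s. indicator {0<..} s *\<^sub>R f s) = restrict_pos f"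
    by (auto simp: restrict_pos_def indicator_def)
  ultimately show ?thesis by simp
qed

lemma restrict_pos_locally_bounded:
  assumes "continuous_on {0..} f"
  obtains B where "0 \<le> B" "\<And>s. s \<le> T \<Longrightarrow> \<bar>restrict_pos f s\<bar> \<le> B"
proof -
  have "bounded (f ` {0..T})"
    by (intro compact_imp_bounded compact_continuous_image continuous_on_subset[OF assms]) auto
  then obtain B where "\<forall>s\<in>{0..T}. \<bar>f s\<bar> \<le> B"
    by (auto simp: bounded_iff)
  then have "\<bar>restrict_pos f s\<bar> \<le> max B 0" if "s \<le> T" for s
    using that by (simp add: restrict_pos_def le_max_iff_disj)
  then show thesis by (intro that[of "max B 0"]) auto
qed

lemma frac_integral_eq_conv:
  assumes "0 < c" and [measurable]: "restrict_pos f \<in> borel_measurable borel"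
  shows "frac_integral c f t = conv (kern c) (restrict_pos f) t"
proof -
  have G: "0 < Gamma c" using assms by (simp add: Gamma_real_pos)
  have eq: "indicator {0<..<t} s *\<^sub>R ((t - s) powr (c - 1) * f s) = Gamma c * (kern c (t - s) * restrict_pos f s)" for s
    using G by (auto simp: indicator_def kern_def restrict_pos_def)
  have "(LBINT s:{0..t}. (t - s) powr (c - 1) * f s) = (LBINT s:{0<..<t}. (t - s) powr (c - 1) * f s)"
  proof (rule set_integral_cong_set)
    show "set_borel_measurable lborel {0<..<t} (\<lambda>s. (t - s) powr (c - 1) * f s)"
      unfolding set_borel_measurable_def eq by simp
    \<comment> \<open>At s = t both sides vanish, since \<open>0 powr (c - 1) = 0\<close> for every
      c; only s = 0 adds a value.\<close>
    have "(\<lambda>s. indicator {0..t} s *\<^sub>R ((t - s) powr (c - 1) * f s)) =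
       (\<lambda>s. Gamma c * (kern c (t - s) * restrict_pos f s) + (if s = 0 \<and> 0 \<le> t then t powr (c - 1) * f 0 else 0))"
      using G by (auto simp: indicator_def kern_def restrict_pos_def fun_eq_iff)
    then show "set_borel_measurable lborel {0..t} (\<lambda>s. (t - s) powr (c - 1) * f s)"
      unfolding set_borel_measurable_def by simp
    show "AE s in lborel. (s \<in> {0<..<t}) = (s \<in> {0..t})"
      using AE_lborel_singleton[of 0] AE_lborel_singleton[of t] by eventually_elim auto
  qed
  also have "\<dots> = Gamma c * conv (kern c) (restrict_pos f) t"
    unfolding set_lebesgue_integral_def eq by (simp add: conv_def)
  finally show ?thesis using G by (simp add: frac_integral_def)
qed

context relaxation begin

text \<open>A solution up to time \<open>T\<close> sees \<open>h\<close> only at earlier times, so a bound on \<open>h (X s)\<close> for \<open>s < T\<close> is enough.\<close>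

lemma solution_le:
  assumes sol: "continuous_solution b (- a) h \<xi> X" and \<xi>: "continuous_on {0..} \<xi>"
    and [measurable]: "h \<in> borel_measurable borel" and T: "0 < T" and C: "0 \<le> C"
    and h: "\<And>s. 0 < s \<Longrightarrow> s < T \<Longrightarrow> \<bar>h (X s)\<bar> \<le> C * \<bar>X s\<bar>"
  shows "\<bar>X T\<bar> \<le> \<bar>lin (restrict_pos \<xi>) T\<bar> + C * conv rho (\<lambda>s. \<bar>restrict_pos X s\<bar>) T"
proof -
  have X: "continuous_on {0..} X" using sol by (simp add: continuous_solution_def)
  have [measurable]: "restrict_pos X \<in> borel_measurable borel" "restrict_pos \<xi> \<in> borel_measurable borel"
    using restrict_pos_measurable X \<xi> by auto
  obtain BX where BX: "0 \<le> BX" "\<And>s. s \<le> T \<Longrightarrow> \<bar>restrict_pos X s\<bar> \<le> BX"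
    using restrict_pos_locally_bounded[OF X] by metis
  obtain B where B: "0 \<le> B" "\<And>s. s \<le> T \<Longrightarrow> \<bar>restrict_pos \<xi> s\<bar> \<le> B"
    using restrict_pos_locally_bounded[OF \<xi>] by metis
  define z where "z s = (if s \<le> T then restrict_pos X s else 0)" for s
  define x where "x s = (if s \<le> T then restrict_pos \<xi> s else 0)" for s
  \<comment> \<open>The cut is strict at T because the bound on h is assumed only before T. The
    equation at T does not notice, since \<open>kern b 0 = 0\<close>.\<close>
  define H where "H s = (if 0 < s \<and> s < T then h (restrict_pos X s) else 0)" for s
  have [measurable]: "z \<in> borel_measurable borel" "x \<in> borel_measurable borel" "H \<in> borel_measurable borel"
    by (simp_all add: z_def[abs_def] x_def[abs_def] H_def[abs_def])
  have H_le: "\<bar>H s\<bar> \<le> C * \<bar>z s\<bar>" for s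
    using h[of s] C by (simp add: H_def z_def restrict_pos_def)
  have z_le: "\<bar>z s\<bar> \<le> BX" for s using BX by (simp add: z_def)
  have "z T = lin x T + conv rho H T"
  proof (rule variation_of_constants)
    show "\<bar>z s\<bar> \<le> BX" "\<bar>x s\<bar> \<le> B" for s using z_le B by (simp_all add: x_def)
    show "\<bar>H s\<bar> \<le> C * BX" for s
      using order_trans[OF H_le mult_left_mono[OF z_le C]] .
    fix s assume s: "0 < s" "s \<le> T"
    have Hs: "kern b (s - u) * restrict_pos (\<lambda>s. h (X s)) u = kern b (s - u) * H u" for u
      using s by (auto simp: kern_def H_def restrict_pos_def)
    have zs: "kern b (s - u) * restrict_pos (\<lambda>s. - a * X s) u = - a * (kern b (s - u) * z u)" for u
      using s by (auto simp: kern_def z_def restrict_pos_def)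
    have "restrict_pos (\<lambda>s. - (a * X s)) = (\<lambda>s. - a * restrict_pos X s)"
      "restrict_pos (\<lambda>s. h (X s)) = (\<lambda>s. if 0 < s then h (restrict_pos X s) else 0)"
      by (auto simp: restrict_pos_def)
    then have [measurable]: "restrict_pos (\<lambda>s. - (a * X s)) \<in> borel_measurable borel"
      "restrict_pos (\<lambda>s. h (X s)) \<in> borel_measurable borel" by simp_all
    have "X s = \<xi> s + frac_integral b (\<lambda>s. - a * X s) s + frac_integral b (\<lambda>s. h (X s)) s"
      using sol s by (simp add: continuous_solution_def)
    also have "frac_integral b (\<lambda>s. - a * X s) s = - a * conv (kern b) z s"
    proof -
      have "frac_integral b (\<lambda>s. - a * X s) s = (LBINT u. - a * (kern b (s - u) * z u))"
        unfolding zs[symmetric] using b by (subst frac_integral_eq_conv) (simp_all add: conv_def)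
      then show ?thesis by (simp add: conv_def)
    qed
    also have "frac_integral b (\<lambda>s. h (X s)) s = conv (kern b) H s"
      unfolding conv_def[of _ H] Hs[symmetric] using b by (subst frac_integral_eq_conv) (simp_all add: conv_def)
    finally have "X s = \<xi> s + - a * conv (kern b) z s + conv (kern b) H s" .
    moreover have "z s = X s" "x s = \<xi> s"
      using s by (simp_all add: z_def x_def restrict_pos_def)
    ultimately show "z s = x s - a * conv (kern b) z s + conv (kern b) H s" by simp
  qed (use T in \<open>auto simp: z_def x_def H_def restrict_pos_def\<close>)
  moreover have "z T = X T" using T by (simp add: z_def restrict_pos_def)
  moreover have "lin x T = lin (restrict_pos \<xi>) T"
  proof -
    have "conv rho x T = conv rho (restrict_pos \<xi>) T"
      by (rule conv_cong) (auto simp: x_def rho_nonpos)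
    then show ?thesis by (simp add: lin_def x_def)
  qed
  moreover have "\<bar>conv rho H T\<bar> \<le> C * conv rho (\<lambda>s. \<bar>restrict_pos X s\<bar>) T"
  proof -
    have "\<bar>conv rho H T\<bar> \<le> conv (\<lambda>s. \<bar>rho s\<bar>) (\<lambda>s. \<bar>H s\<bar>) T" by (rule abs_conv_le)
    also have "\<dots> \<le> (LBINT s. C * (rho (T - s) * \<bar>z s\<bar>))"
      unfolding conv_def
    proof (rule integral_mono)
      have iz: "integrable lborel (\<lambda>s. rho (T - s) * z s)"
        by (rule conv_rho_bounded(1)[OF _ z_le]) simp
      then show "integrable lborel (\<lambda>s. C * (rho (T - s) * \<bar>z s\<bar>))"
        using integrable_abs[OF iz] by (intro integrable_mult_right) (simp add: abs_mult rho_nonneg)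
      have "integrable lborel (\<lambda>s. rho (T - s) * H s)"
        by (rule conv_rho_bounded(1)[OF _ order_trans[OF H_le mult_left_mono[OF z_le C]]]) simp
      from integrable_abs[OF this] show "integrable lborel (\<lambda>s. \<bar>rho (T - s)\<bar> * \<bar>H s\<bar>)"
        by (simp add: abs_mult)
      show "\<bar>rho (T - s)\<bar> * \<bar>H s\<bar> \<le> C * (rho (T - s) * \<bar>z s\<bar>)" for s
        using mult_left_mono[OF H_le rho_nonneg[of "T - s"]] by (simp add: rho_nonneg mult_ac)
    qed
    also have "(\<lambda>s. rho (T - s) * \<bar>z s\<bar>) = (\<lambda>s. rho (T - s) * \<bar>restrict_pos X s\<bar>)"
      by (auto simp: z_def rho_nonpos)
    finally show ?thesis by (simp add: conv_def)
  qed
  ultimately show ?thesis by linarith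
qed

text \<open>
  The fading memory turns an eventual bound \<open>m\<close> on \<open>\<bar>X\<bar>\<close> into the eventual bound \<open>q * m\<close>, for any
  \<open>q > C / a\<close>.
\<close>

lemma tendsto_0_of_fading_memory:
  assumes X: "continuous_on {0..} X" and bound: "\<And>s. 0 \<le> s \<Longrightarrow> \<bar>X s\<bar> \<le> B"
    and le: "\<And>t. 0 < t \<Longrightarrow> \<bar>X t\<bar> \<le> \<bar>y t\<bar> + C * conv rho (\<lambda>s. \<bar>restrict_pos X s\<bar>) t"
    and y: "(y \<longlongrightarrow> 0) at_top" and C: "0 \<le> C" "C < a"
  shows "(X \<longlongrightarrow> 0) at_top"
proof -
  have [measurable]: "restrict_pos X \<in> borel_measurable borel" by (rule restrict_pos_measurable[OF X])
  have B: "0 \<le> B" using bound[of 0] by simp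
  \<comment> \<open>The midpoint of C/a and 1; the gap (q - C/a) * m absorbs the vanishing
    terms.\<close>
  define q where "q = (1 + C / a) / 2"
  have q: "0 < q" "q < 1" "C / a < q" using C a by (auto simp: q_def field_simps intro: add_pos_nonneg)
  have step: "\<forall>\<^sub>F t in at_top. \<bar>X t\<bar> \<le> q * m" if m: "0 < m" and ev: "\<forall>\<^sub>F t in at_top. \<bar>X t\<bar> \<le> m" for m
  proof -
    \<comment> \<open>The excess of \<bar>X\<bar> over m. It is bounded and eventually 0, so its
      convolution with \<open>rho\<close> fades, while the part below m contributes at most C/a *
      m.\<close>
    define r where "r s = max (\<bar>restrict_pos X s\<bar> - m) 0" for s
    have [measurable]: "r \<in> borel_measurable borel" by (simp add: r_def[abs_def])
    have r_le: "\<bar>r s\<bar> \<le> B" for s using bound[of s] m B by (auto simp: r_def restrict_pos_def max_def abs_if)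
    have "\<forall>\<^sub>F t in at_top. r t = 0"
      using ev eventually_gt_at_top[of 0] by eventually_elim (simp add: r_def restrict_pos_def)
    then have "(r \<longlongrightarrow> 0) at_top" by (rule tendsto_eventually)
    from conv_rho_tendsto[OF _ r_le this] have "((\<lambda>t. a * conv rho r t) \<longlongrightarrow> 0) at_top" by simp
    then have "((\<lambda>t. \<bar>y t\<bar> + C / a * (a * conv rho r t)) \<longlongrightarrow> 0 + C / a * 0) at_top"
      using y by (intro tendsto_intros tendsto_rabs_zero)
    moreover have "0 + C / a * 0 < (q - C / a) * m" using q m by simp
    ultimately have "\<forall>\<^sub>F t in at_top. \<bar>y t\<bar> + C / a * (a * conv rho r t) < (q - C / a) * m"
      by (rule order_tendstoD)
    then show ?thesis
      using eventually_gt_at_top[of 0]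
    proof eventually_elim
      case (elim t)
      have i: "integrable lborel (\<lambda>s. rho (t - s) * r s)" by (rule conv_rho_bounded(1)[OF _ r_le]) simp
      have i2: "integrable lborel (\<lambda>s. rho (t - s) * \<bar>restrict_pos X s\<bar>)"
        by (rule conv_rho_bounded(1)[of _ _ B]) (simp, use bound B in \<open>simp add: restrict_pos_def\<close>)
      have "conv rho (\<lambda>s. \<bar>restrict_pos X s\<bar>) t \<le> (LBINT s. m * rho (t - s) + rho (t - s) * r s)"
        unfolding conv_def
      proof (rule integral_mono[OF i2])
        show "integrable lborel (\<lambda>s. m * rho (t - s) + rho (t - s) * r s)"
          using rho_shift[of t] i by (auto simp: has_bochner_integral_iff)
        show "rho (t - s) * \<bar>restrict_pos X s\<bar> \<le> m * rho (t - s) + rho (t - s) * r s" for s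
          using mult_left_mono[of "\<bar>restrict_pos X s\<bar>" "m + r s" "rho (t - s)"] rho_nonneg[of "t - s"]
          by (simp add: r_def algebra_simps)
      qed
      also have "\<dots> = m / a + conv rho r t"
        using rho_shift[of t] i by (simp add: has_bochner_integral_iff conv_def)
      finally have "C * conv rho (\<lambda>s. \<bar>restrict_pos X s\<bar>) t \<le> C * (m / a + conv rho r t)"
        using C by (intro mult_left_mono)
      also have "\<dots> = C / a * m + C / a * (a * conv rho r t)"
        using a by (simp add: field_simps)
      finally show ?case using le[of t] elim by (simp add: algebra_simps)
    qed
  qed
  \<comment> \<open>The start is B + 1 because \<open>step\<close> requires a positive bound, and B
    may be 0.\<close>
  have iter: "\<forall>\<^sub>F t in at_top. \<bar>X t\<bar> \<le> q ^ n * (B + 1)" for n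
  proof (induction n)
    case 0
    show ?case using eventually_ge_at_top[of 0] by eventually_elim (use bound in \<open>auto intro: add_increasing2\<close>)
  next
    case (Suc n)
    then show ?case using step[of "q ^ n * (B + 1)"] q B by (simp add: mult.assoc)
  qed
  show ?thesis
  proof (rule tendstoI)
    fix e :: real assume e: "0 < e"
    have "(\<lambda>n. q ^ n * (B + 1)) \<longlonglongrightarrow> 0"
      using q by (intro tendsto_mult_left_zero LIMSEQ_realpow_zero) auto
    then have "eventually (\<lambda>n. q ^ n * (B + 1) < e) sequentially"
      using e by (rule order_tendstoD)
    then obtain n where "q ^ n * (B + 1) < e" by (auto simp: eventually_sequentially)
    then show "\<forall>\<^sub>F t in at_top. dist (X t) 0 < e"
      using iter[of n] by (auto elim: eventually_mono)
  qed
qed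

end

section \<open>Initial conditions and stability\<close>

lemma abs_le_sup_norm: "0 \<le> t \<Longrightarrow> ereal \<bar>f t\<bar> \<le> sup_norm f"
  unfolding sup_norm_def by (rule SUP_upper) simp

lemma sup_norm_nonneg: "0 \<le> sup_norm f"
  using abs_le_sup_norm[of 0 f] by (metis abs_ge_zero ereal_less_eq(5) order.refl order_trans)

lemma norm_X2_nonneg: "0 \<le> norm_X2 A \<beta> \<xi>"
  unfolding norm_X2_def
  by (intro INF_greatest add_nonneg_nonneg sup_norm_nonneg SUP_upper2[of 1]) auto

lemma norm_X3_nonneg: "0 \<le> norm_X3 \<eta> p \<xi>"
  unfolding norm_X3_def Lp_norm_def by (intro INF_greatest) (simp add: zero_ereal_def[symmetric])

lemma norm_X_less:
  assumes "norm_X A \<beta> \<eta> p \<xi> < ereal d"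
  obtains \<xi>1 \<xi>2 \<xi>3 where "(\<xi>1, \<xi>2, \<xi>3) \<in> IC_decompositions \<beta> \<eta> p \<xi>"
    "norm_X1 \<xi>1 < ereal d" "norm_X2 A \<beta> \<xi>2 < ereal d" "norm_X3 \<eta> p \<xi>3 < ereal d"
proof -
  obtain \<xi>1 \<xi>2 \<xi>3 where dec: "(\<xi>1, \<xi>2, \<xi>3) \<in> IC_decompositions \<beta> \<eta> p \<xi>"
    and less: "norm_X1 \<xi>1 + norm_X2 A \<beta> \<xi>2 + norm_X3 \<eta> p \<xi>3 < ereal d"
    using assms unfolding norm_X_def INF_less_iff by auto
  have nn: "0 \<le> norm_X1 \<xi>1" "0 \<le> norm_X2 A \<beta> \<xi>2" "0 \<le> norm_X3 \<eta> p \<xi>3"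
    by (simp_all add: norm_X1_def sup_norm_nonneg norm_X2_nonneg norm_X3_nonneg)
  then have "norm_X1 \<xi>1 + 0 + 0 \<le> norm_X1 \<xi>1 + norm_X2 A \<beta> \<xi>2 + norm_X3 \<eta> p \<xi>3"
    "0 + norm_X2 A \<beta> \<xi>2 + 0 \<le> norm_X1 \<xi>1 + norm_X2 A \<beta> \<xi>2 + norm_X3 \<eta> p \<xi>3"
    "0 + 0 + norm_X3 \<eta> p \<xi>3 \<le> norm_X1 \<xi>1 + norm_X2 A \<beta> \<xi>2 + norm_X3 \<eta> p \<xi>3"
    by (intro add_mono; simp)+
  with less dec show thesis by (intro that) auto
qed

lemma IC_decompositionsD:
  assumes dec: "(\<xi>1, \<xi>2, \<xi>3) \<in> IC_decompositions \<beta> \<eta> p \<xi>" and \<xi>: "continuous_on {0..} \<xi>"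
  shows "\<xi>1 \<in> IC1" "\<xi>2 \<in> IC2 \<beta>" "\<xi>3 \<in> IC3 \<eta> p"
    "continuous_on {0..} \<xi>1" "continuous_on {0..} \<xi>2" "continuous_on {0..} \<xi>3"
    "\<And>t. 0 \<le> t \<Longrightarrow> \<xi> t = \<xi>1 t + \<xi>2 t + \<xi>3 t"
proof -
  show 1: "\<xi>1 \<in> IC1" "\<xi>2 \<in> IC2 \<beta>" "\<xi>3 \<in> IC3 \<eta> p" "\<And>t. 0 \<le> t \<Longrightarrow> \<xi> t = \<xi>1 t + \<xi>2 t + \<xi>3 t"
    using dec by (auto simp: IC_decompositions_def)
  then show c: "continuous_on {0..} \<xi>1" "continuous_on {0..} \<xi>3"
    by (auto simp: IC1_def IC3_def)
  have "continuous_on {0..} (\<lambda>t. \<xi> t - \<xi>1 t - \<xi>3 t)"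
    by (intro continuous_intros \<xi> c)
  then show "continuous_on {0..} \<xi>2"
    by (rule continuous_on_eq) (simp add: 1)
qed

context relaxation begin

text \<open>Additivity of Bochner integrals needs integrability; here continuity on
  \<open>{0..}\<close> provides it through boundedness up to time t.\<close>

lemma lin_restrict_pos_add3:
  assumes c: "continuous_on {0..} f1" "continuous_on {0..} f2" "continuous_on {0..} f3"
    and eq: "\<And>t. 0 \<le> t \<Longrightarrow> f t = f1 t + f2 t + f3 t"
  shows "lin (restrict_pos f) t = lin (restrict_pos f1) t + lin (restrict_pos f2) t + lin (restrict_pos f3) t"
proof -
  have int: "integrable lborel (\<lambda>s. rho (t - s) * restrict_pos g s)" if g: "continuous_on {0..} g" for g
  proof -
    obtain B where "\<And>s. s \<le> t \<Longrightarrow> \<bar>restrict_pos g s\<bar> \<le> B"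
      using restrict_pos_locally_bounded[OF g] by metis
    then show ?thesis
      by (intro conv_rho_bounded(1)[where B=B] restrict_pos_measurable g) auto
  qed
  have "restrict_pos f = (\<lambda>s. restrict_pos f1 s + restrict_pos f2 s + restrict_pos f3 s)"
    using eq by (auto simp: restrict_pos_def)
  then show ?thesis
    using int[OF c(1)] int[OF c(2)] int[OF c(3)]
    by (simp add: lin_def conv_def algebra_simps)
qed

lemma lin_tendsto_IC1:
  assumes "f \<in> IC1"
  shows "(lin (restrict_pos f) \<longlongrightarrow> 0) at_top"
proof -
  have f: "continuous_on {0..} f" using assms by (simp add: IC1_def)
  obtain L where L: "\<And>e. 0 < e \<Longrightarrow> \<exists>t0>0. \<forall>s\<ge>t0. \<bar>f s - L\<bar> \<le> e"
    using assms by (auto simp: IC1_def)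
  have "(restrict_pos f \<longlongrightarrow> L) at_top"
  proof (rule tendstoI)
    fix e :: real assume "0 < e"
    then obtain t0 where "0 < t0" "\<forall>s\<ge>t0. \<bar>f s - L\<bar> \<le> e / 2" using L[of "e / 2"] by auto
    then show "\<forall>\<^sub>F s in at_top. dist (restrict_pos f s) L < e"
      using \<open>0 < e\<close> unfolding eventually_at_top_linorder
      by (intro exI[of _ t0]) (force simp: restrict_pos_def dist_real_def)
  qed
  moreover obtain B where B: "\<And>s. \<bar>restrict_pos f s\<bar> \<le> B"
  proof -
    obtain t0 where t0: "0 < t0" "\<forall>s\<ge>t0. \<bar>f s - L\<bar> \<le> 1" using L[of 1] by auto
    obtain B where B: "\<And>s. s \<le> t0 \<Longrightarrow> \<bar>restrict_pos f s\<bar> \<le> B"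
      using restrict_pos_locally_bounded[OF f] by metis
    have "\<bar>restrict_pos f s\<bar> \<le> max B (\<bar>L\<bar> + 1)" for s
    proof (cases "s \<le> t0")
      case False
      then have "\<bar>f s - L\<bar> \<le> 1" "0 < s" using t0 by auto
      then show ?thesis by (auto simp: restrict_pos_def)
    qed (use B[of s] in auto)
    then show thesis by (rule that)
  qed
  ultimately show ?thesis
    using lin_tendsto_of_convergent restrict_pos_measurable[OF f] by blast
qed

lemma lin_bounded_IC1:
  assumes "continuous_on {0..} f" "norm_X1 f < ereal d"
  shows "\<bar>lin (restrict_pos f) t\<bar> \<le> 2 * d" "\<bar>f 0\<bar> \<le> d"
proof -
  have *: "\<bar>f s\<bar> \<le> d" if "0 \<le> s" for s
    using abs_le_sup_norm[OF that, of f] assms(2) by (simp add: norm_X1_def) (metis ereal_less_eq(3) less_imp_le order_trans)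
  then show "\<bar>f 0\<bar> \<le> d" by simp
  show "\<bar>lin (restrict_pos f) t\<bar> \<le> 2 * d"
    by (rule lin_bounded[OF restrict_pos_measurable[OF assms(1)]])
      (use * *[of 0] in \<open>auto simp: restrict_pos_def intro: order_trans[OF abs_ge_zero]\<close>)
qed

lemma IC2_deriv:
  assumes "f \<in> IC2 b" "0 < s"
  shows "(restrict_pos f has_real_derivative deriv f s) (at s)"
proof -
  have "f differentiable (at s within {0<..})"
    using assms by (auto simp: IC2_def differentiable_on_def)
  then have "f differentiable (at s)"
    using assms(2) by (simp add: at_within_open[of s "{0<..}"])
  then have "(f has_real_derivative deriv f s) (at s)"
    by (simp add: DERIV_deriv_iff_real_differentiable)
  then show ?thesis
    by (rule has_field_derivative_transform_within_open[where S="{0<..}"])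
      (use assms in \<open>auto simp: restrict_pos_def\<close>)
qed

lemma lin_tendsto_IC2:
  assumes f: "f \<in> IC2 b" and c: "continuous_on {0..} f"
  shows "(lin (restrict_pos f) \<longlongrightarrow> 0) at_top"
proof -
  obtain v C where v: "0 < v" "v < b" and C: "\<And>t. 0 < t \<Longrightarrow> \<bar>deriv f t\<bar> \<le> C / t powr (1 - v)"
    using f unfolding IC2_def mem_Collect_eq by (metis greaterThanLessThan_iff)
  show ?thesis
  proof (rule lin_tendsto_of_deriv[OF restrict_pos_measurable[OF c] _ IC2_deriv[OF f] _ v])
    show "\<bar>deriv f s\<bar> \<le> C * s powr (v - 1)" if "0 < s" for s
      using C[OF that] powr_minus_divide[of s "1 - v"] by simp
    show "0 \<le> C" using C[of 1] by simp
    show "\<exists>B. \<forall>s. 0 < s \<and> s \<le> T \<longrightarrow> \<bar>restrict_pos f s\<bar> \<le> B" for T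
      using restrict_pos_locally_bounded[OF c, of T] by metis
    have "((\<lambda>t. \<bar>f t\<bar> / t powr b) \<longlongrightarrow> 0) at_top" using f by (simp add: IC2_def)
    moreover have "\<forall>\<^sub>F t in at_top. \<bar>f t\<bar> / t powr b = \<bar>restrict_pos f t\<bar> / t powr b"
      using eventually_gt_at_top[of 0] by eventually_elim (simp add: restrict_pos_def)
    ultimately show "((\<lambda>t. \<bar>restrict_pos f t\<bar> / t powr b) \<longlongrightarrow> 0) at_top"
      by (rule Lim_transform_eventually)
  qed (auto simp: restrict_pos_def)
qed

lemma lin_bounded_IC2:
  assumes f: "f \<in> IC2 b" and c: "continuous_on {0..} f" and d: "norm_X2 (- a) b f < ereal d"
  shows "0 < t \<Longrightarrow> \<bar>lin (restrict_pos f) t\<bar> \<le> (2 + 4 * lin_const) * growth_const * d" "\<bar>f 0\<bar> \<le> d"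
proof -
  let ?g = "\<lambda>t. f t * mittag_leffler b 1 (- a * t powr b)"
  obtain v where v: "0 < v" "v < b"
    and less: "sup_norm ?g + (SUP t\<in>{0<..}. ereal \<bar>t powr (1 - v) * deriv f t\<bar>) < ereal d"
    using d unfolding norm_X2_def INF_less_iff by auto
  have "0 \<le> (SUP t\<in>{0<..}. ereal \<bar>t powr (1 - v) * deriv f t\<bar>)"
    by (intro SUP_upper2[of 1]) auto
  then have "sup_norm ?g + 0 \<le> sup_norm ?g + (SUP t\<in>{0<..}. ereal \<bar>t powr (1 - v) * deriv f t\<bar>)"
    "0 + (SUP t\<in>{0<..}. ereal \<bar>t powr (1 - v) * deriv f t\<bar>) \<le> sup_norm ?g + (SUP t\<in>{0<..}. ereal \<bar>t powr (1 - v) * deriv f t\<bar>)"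
    by (intro add_mono; simp add: sup_norm_nonneg)+
  with less have 1: "sup_norm ?g < ereal d" and 2: "(SUP t\<in>{0<..}. ereal \<bar>t powr (1 - v) * deriv f t\<bar>) < ereal d"
    by auto
  have g: "\<bar>?g s\<bar> \<le> d" if "0 \<le> s" for s
    using order.strict_trans1[OF abs_le_sup_norm[OF that, of ?g] 1] by simp
  have der: "\<bar>s powr (1 - v) * deriv f s\<bar> \<le> d" if "0 < s" for s
  proof -
    have "ereal \<bar>s powr (1 - v) * deriv f s\<bar> \<le> (SUP t\<in>{0<..}. ereal \<bar>t powr (1 - v) * deriv f t\<bar>)"
      by (rule SUP_upper) (use that in simp)
    from order.strict_trans1[OF this 2] show ?thesis by simp
  qed
  \<comment> \<open>At 0 the Mittag-Leffler weight is 1 / \<open>Gamma 1\<close> = 1.\<close>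
  show "\<bar>f 0\<bar> \<le> d" using g[of 0] mittag_leffler_0[of 1 b] b by simp
  assume t: "0 < t"
  show "\<bar>lin (restrict_pos f) t\<bar> \<le> (2 + 4 * lin_const) * growth_const * d"
  proof (rule lin_bounded_of_deriv[OF restrict_pos_measurable[OF c] _ IC2_deriv[OF f] _ v _ t])
    show "\<bar>deriv f s\<bar> \<le> d * s powr (v - 1)" if "0 < s" for s
    proof -
      have "\<bar>deriv f s\<bar> = s powr (v - 1) * \<bar>s powr (1 - v) * deriv f s\<bar>"
        using that powr_add[of s "v - 1" "1 - v"] by (simp add: abs_mult)
      also have "\<dots> \<le> s powr (v - 1) * d" by (intro mult_left_mono der that) auto
      finally show ?thesis by (simp add: mult.commute)
    qed
    show "\<bar>restrict_pos f s * relax s\<bar> \<le> d" if "0 < s" for s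
      using g[of s] that by (simp add: restrict_pos_def relax_eq)
  qed (auto simp: restrict_pos_def)
qed

lemma IC3_densities_restrict_pos:
  assumes g: "g \<in> IC3_densities \<eta> p f" and eta: "0 < \<eta>" and p: "0 < p"
  shows "integrable lborel (restrict_pos g)" "integrable lborel (\<lambda>s. \<bar>restrict_pos g s\<bar> powr p)"
    "(LBINT s. \<bar>restrict_pos g s\<bar>) \<le> Lp_norm 1 g" "(LBINT s. \<bar>restrict_pos g s\<bar> powr p) \<le> Lp_norm p g powr p"
    "restrict_pos f = conv (kern \<eta>) (restrict_pos g)" "f 0 = 0"
proof -
  have i: "set_integrable lborel {0..} g" "set_integrable lborel {0..} (\<lambda>s. \<bar>g s\<bar> powr p)"
    and f: "\<And>t. 0 \<le> t \<Longrightarrow> f t = frac_integral \<eta> g t"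
    using g by (auto simp: IC3_densities_def L1_Lp_def)
  have e1: "(\<lambda>s. indicator {0<..} s *\<^sub>R g s) = restrict_pos g"
    and e2: "(\<lambda>s. indicator {0<..} s *\<^sub>R (\<bar>g s\<bar> powr p)) = (\<lambda>s. \<bar>restrict_pos g s\<bar> powr p)"
    by (auto simp: indicator_def restrict_pos_def)
  have i': "set_integrable lborel {0<..} g" "set_integrable lborel {0<..} (\<lambda>s. \<bar>g s\<bar> powr p)"
    by (rule set_integrable_subset[OF i(1)] set_integrable_subset[OF i(2)]; auto)+
  then show 1: "integrable lborel (restrict_pos g)" and 2: "integrable lborel (\<lambda>s. \<bar>restrict_pos g s\<bar> powr p)"
    unfolding set_integrable_def e1 e2 .
  have ia: "set_integrable lborel {0..} (\<lambda>s. \<bar>g s\<bar>)" by (rule set_integrable_abs[OF i(1)])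
  have "(LBINT s. \<bar>restrict_pos g s\<bar>) \<le> (LBINT s:{0..}. \<bar>g s\<bar>)"
    unfolding set_lebesgue_integral_def
    by (rule integral_mono[OF integrable_abs[OF 1] ia[unfolded set_integrable_def]]) (auto simp: restrict_pos_def)
  also have "\<dots> \<le> Lp_norm 1 g"
    by (simp add: Lp_norm_def)
  finally show "(LBINT s. \<bar>restrict_pos g s\<bar>) \<le> Lp_norm 1 g" .
  have "(LBINT s. \<bar>restrict_pos g s\<bar> powr p) \<le> (LBINT s:{0..}. \<bar>g s\<bar> powr p)"
    unfolding set_lebesgue_integral_def
    by (rule integral_mono[OF 2 i(2)[unfolded set_integrable_def]]) (auto simp: restrict_pos_def)
  also have "\<dots> = Lp_norm p g powr p"
  proof -
    have "0 \<le> (LBINT s:{0..}. \<bar>g s\<bar> powr p)"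
      unfolding set_lebesgue_integral_def by (intro Bochner_Integration.integral_nonneg) auto
    then show ?thesis using p by (simp add: Lp_norm_def powr_powr)
  qed
  finally show "(LBINT s. \<bar>restrict_pos g s\<bar> powr p) \<le> Lp_norm p g powr p" .
  have m: "restrict_pos g \<in> borel_measurable borel" using 1 by simp
  have z: "conv (kern \<eta>) (restrict_pos g) t = 0" if "t \<le> 0" for t
  proof -
    have "(\<lambda>s. kern \<eta> (t - s) * restrict_pos g s) = (\<lambda>s. 0)"
      using that by (auto simp: kern_def restrict_pos_def fun_eq_iff)
    then show ?thesis by (simp add: conv_def)
  qed
  show "restrict_pos f = conv (kern \<eta>) (restrict_pos g)"
  proof
    fix t
    show "restrict_pos f t = conv (kern \<eta>) (restrict_pos g) t"
      using f[of t] frac_integral_eq_conv[OF eta m, of t] z[of t] by (simp add: restrict_pos_def[of f])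
  qed
  show "f 0 = 0" using f[of 0] frac_integral_eq_conv[OF eta m, of 0] z[of 0] by simp
qed

lemma lin_tendsto_IC3:
  assumes f: "f \<in> IC3 \<eta> p" and eta: "0 < \<eta>" "\<eta> < b + 1" and p: "1 < p" "1 < \<eta> * p"
  shows "(lin (restrict_pos f) \<longlongrightarrow> 0) at_top"
proof -
  obtain g where "g \<in> IC3_densities \<eta> p f" using f by (auto simp: IC3_def)
  note g = IC3_densities_restrict_pos[OF this eta(1)]
  have g': "integrable lborel (restrict_pos g)" "integrable lborel (\<lambda>s. \<bar>restrict_pos g s\<bar> powr p)"
     and fg: "restrict_pos f = conv (kern \<eta>) (restrict_pos g)" using g p by auto
  have m: "restrict_pos g \<in> borel_measurable borel" using g' by simp
  have g0: "s \<le> 0 \<Longrightarrow> restrict_pos g s = 0" for s by (simp add: restrict_pos_def)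
  obtain C where C: "0 \<le> C" "\<And>u. 0 < u \<Longrightarrow> u < 1 \<Longrightarrow> \<bar>ml b a \<eta> u\<bar> \<le> C * u powr (\<eta> - 1)"
    "\<And>u. 1 \<le> u \<Longrightarrow> \<bar>ml b a \<eta> u\<bar> \<le> C" "(ml b a \<eta> \<longlongrightarrow> 0) at_top"
    using ml_bounds[OF eta] by metis
  have "(conv (ml b a \<eta>) (restrict_pos g) \<longlongrightarrow> 0) at_top"
    by (rule singular_conv_tendsto[OF ml_measurable m _ g0 p C(2,1,3,4) g']) (auto simp: b eta ml_nonpos)
  moreover have "lin (restrict_pos f) = conv (ml b a \<eta>) (restrict_pos g)"
    unfolding fg by (rule ext) (rule lin_conv_kern(2)[OF m g0 eta p g'])
  ultimately show ?thesis by simp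
qed

text \<open>Young's inequality gives no bound linear in the norm, as its term C * l / x is
  independent of g. Smallness is obtained by fixing l according to e and then choosing d according
  to l.\<close>

lemma lin_bounded_IC3:
  assumes eta: "0 < \<eta>" "\<eta> < b + 1" and p: "1 < p" "1 < \<eta> * p" and e: "0 < e"
  obtains d where "0 < d" "\<And>f t. norm_X3 \<eta> p f < ereal d \<Longrightarrow> \<bar>lin (restrict_pos f) t\<bar> \<le> e \<and> f 0 = 0"
proof -
  obtain C where C: "0 \<le> C" "\<And>u. 0 < u \<Longrightarrow> u < 1 \<Longrightarrow> \<bar>ml b a \<eta> u\<bar> \<le> C * u powr (\<eta> - 1)"
    "\<And>u. 1 \<le> u \<Longrightarrow> \<bar>ml b a \<eta> u\<bar> \<le> C"
    using ml_bounds[OF eta] by metis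
  define x where "x = (\<eta> - 1) * (p / (p - 1)) + 1"
  have "x * (p - 1) = \<eta> * p - 1" using p by (simp add: x_def field_simps)
  then have x: "0 < x" using p by (metis diff_gt_0_iff_gt zero_less_mult_pos2)
  \<comment> \<open>Makes C * l / x smaller than e, with C + 1 in the denominator to allow C =
    0.\<close>
  define l where "l = e * x / (3 * (C + 1))"
  have l: "0 < l" using e x C by (simp add: l_def)
  define E where "E d = C * d + C * (l / x + l powr (1 - p) * d powr p)" for d
  have "((\<lambda>d. E d) \<longlongrightarrow> C * 0 + C * (l / x + l powr (1 - p) * 0)) (at_right 0)"
  proof -
    have "((\<lambda>d. d powr p) \<longlongrightarrow> 0 powr p) (at_right (0::real))"
      by (rule tendsto_powr') (use p in \<open>auto intro: eventually_mono[OF eventually_at_right_less]\<close>)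
    then show ?thesis
      unfolding E_def by (intro tendsto_intros) auto
  qed
  moreover have "C * 0 + C * (l / x + l powr (1 - p) * 0) < e"
  proof -
    have "C * (l / x) = e * (C / (3 * (C + 1)))" using x C by (simp add: l_def)
    also have "\<dots> < e * 1" using e C by (intro mult_strict_left_mono) auto
    finally show ?thesis by simp
  qed
  ultimately have "\<forall>\<^sub>F d in at_right 0. E d < e" by (rule order_tendstoD)
  then have "\<forall>\<^sub>F d in at_right 0. 0 < d \<and> E d < e"
    using eventually_at_right_less by eventually_elim auto
  then obtain d where d: "0 < d" "E d < e"
    using eventually_happens' trivial_limit_at_right_real by blast
  show thesis
  proof (rule that[OF d(1)])
    fix f t assume "norm_X3 \<eta> p f < ereal d"
    then obtain g where gf: "g \<in> IC3_densities \<eta> p f" and gd: "Lp_norm 1 g + Lp_norm p g < d"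
      unfolding norm_X3_def INF_less_iff by auto
    have "0 \<le> Lp_norm 1 g" "0 \<le> Lp_norm p g" by (simp_all add: Lp_norm_def)
    with gd have gn: "Lp_norm 1 g \<le> d" "Lp_norm p g \<le> d" "0 \<le> Lp_norm p g" by auto
    note g = IC3_densities_restrict_pos[OF gf eta(1)]
    have g': "integrable lborel (restrict_pos g)" "integrable lborel (\<lambda>s. \<bar>restrict_pos g s\<bar> powr p)"
      and fg: "restrict_pos f = conv (kern \<eta>) (restrict_pos g)" "f 0 = 0" using g p by auto
    have I1: "(LBINT s. \<bar>restrict_pos g s\<bar>) \<le> d" using g(3) p gn by simp
    have "(LBINT s. \<bar>restrict_pos g s\<bar> powr p) \<le> Lp_norm p g powr p" using g(4) p by simp
    also have "\<dots> \<le> d powr p" using gn p by (intro powr_mono2) auto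
    finally have Ip: "(LBINT s. \<bar>restrict_pos g s\<bar> powr p) \<le> d powr p" .
    have m: "restrict_pos g \<in> borel_measurable borel" using g' by simp
    have g0: "s \<le> 0 \<Longrightarrow> restrict_pos g s = 0" for s by (simp add: restrict_pos_def)
    have "lin (restrict_pos f) t = conv (ml b a \<eta>) (restrict_pos g) t"
      unfolding fg by (rule lin_conv_kern(2)[OF m g0 eta p g'])
    also have "\<bar>\<dots>\<bar> \<le> conv (\<lambda>u. \<bar>ml b a \<eta> u\<bar>) (\<lambda>s. \<bar>restrict_pos g s\<bar>) t" by (rule abs_conv_le)
    also have "\<dots> \<le> C * (LBINT s. \<bar>restrict_pos g s\<bar>)
       + C * (l / x + l powr (1 - p) * (LBINT s. \<bar>restrict_pos g s\<bar> powr p))"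
      unfolding x_def
      by (rule singular_conv(3)[OF ml_measurable m _ g0 p C(2,1,3,1) g' l]) (auto simp: b eta ml_nonpos)
    also have "\<dots> \<le> E d"
      unfolding E_def using C l by (intro add_mono mult_left_mono I1 Ip order.refl) auto
    finally show "\<bar>lin (restrict_pos f) t\<bar> \<le> e \<and> f 0 = 0" using d fg by simp
  qed
qed

lemma lin_tendsto_IC:
  assumes f: "f \<in> IC b \<eta> p" and eta: "0 < \<eta>" "\<eta> < b + 1" and p: "1 < p" "1 < \<eta> * p"
  shows "(lin (restrict_pos f) \<longlongrightarrow> 0) at_top"
proof -
  obtain f1 f2 f3 where dec: "(f1, f2, f3) \<in> IC_decompositions b \<eta> p f" and c: "continuous_on {0..} f"
    using f by (auto simp: IC_def)
  note D = IC_decompositionsD[OF dec c]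
  have "((\<lambda>t. lin (restrict_pos f1) t + lin (restrict_pos f2) t + lin (restrict_pos f3) t) \<longlongrightarrow> 0 + 0 + 0) at_top"
    by (intro tendsto_add lin_tendsto_IC1 lin_tendsto_IC2 lin_tendsto_IC3[OF _ eta p] D)
  moreover have "lin (restrict_pos f) = (\<lambda>t. lin (restrict_pos f1) t + lin (restrict_pos f2) t + lin (restrict_pos f3) t)"
    by (rule ext) (rule lin_restrict_pos_add3[OF D(4-7)])
  ultimately show ?thesis by simp
qed

lemma lin_bounded_IC:
  assumes eta: "0 < \<eta>" "\<eta> < b + 1" and p: "1 < p" "1 < \<eta> * p" and e: "0 < e"
  obtains d where "0 < d"
    "\<And>f. f \<in> IC b \<eta> p \<Longrightarrow> norm_X (- a) b \<eta> p f < ereal d \<Longrightarrow> \<bar>f 0\<bar> \<le> e \<and> (\<forall>t>0. \<bar>lin (restrict_pos f) t\<bar> \<le> e)"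
proof -
  obtain d3 where d3: "0 < d3" "\<And>f t. norm_X3 \<eta> p f < ereal d3 \<Longrightarrow> \<bar>lin (restrict_pos f) t\<bar> \<le> e / 3 \<and> f 0 = 0"
    using lin_bounded_IC3[OF eta p, of "e / 3"] e by auto
  define K where "K = (2 + 4 * lin_const) * growth_const"
  have "2 * 1 \<le> K" unfolding K_def
    using lin_const_nonneg growth_const_ge_1 by (intro mult_mono) auto
  then have K: "0 < K" by simp
  \<comment> \<open>Each component may contribute e/3: the \<open>IC1\<close> estimate is 2 * d, the
    \<open>IC2\<close> estimate is K * d, and \<open>d3\<close> was chosen for e/3.\<close>
  define d where "d = min d3 (min (e / 6) (e / (3 * K)))"
  have d: "0 < d" "d \<le> d3" "d \<le> e / 6" "d \<le> e / (3 * K)" using d3 e K by (auto simp: d_def)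
  have Kd: "K * d \<le> e / 3" using d(4) K by (simp add: field_simps)
  show thesis
  proof (rule that[OF d(1)])
    fix f assume "f \<in> IC b \<eta> p" and less: "norm_X (- a) b \<eta> p f < ereal d"
    then have c: "continuous_on {0..} f" by (simp add: IC_def)
    obtain f1 f2 f3 where dec: "(f1, f2, f3) \<in> IC_decompositions b \<eta> p f"
      and n: "norm_X1 f1 < ereal d" "norm_X2 (- a) b f2 < ereal d" "norm_X3 \<eta> p f3 < ereal d"
      using norm_X_less[OF less] by metis
    note D = IC_decompositionsD[OF dec c]
    have n3: "norm_X3 \<eta> p f3 < ereal d3" using n(3) d(2) by (simp add: less_le_trans)
    note b1 = lin_bounded_IC1[OF D(4) n(1)] and b2 = lin_bounded_IC2[OF D(2) D(5) n(2)] and b3 = d3(2)[OF n3]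
    have "\<bar>f 0\<bar> \<le> e" using D(7)[of 0] b1(2) b2(2) b3 d by simp
    moreover have "\<bar>lin (restrict_pos f) t\<bar> \<le> e" if "0 < t" for t
    proof -
      have "\<bar>lin (restrict_pos f2) t\<bar> \<le> e / 3" using b2(1)[OF that] Kd by (simp add: K_def)
      then show ?thesis
        using lin_restrict_pos_add3[OF D(4-7), of t] b1(1)[of t] b3[of t] d(3) unfolding abs_le_iff by linarith
    qed
    ultimately show "\<bar>f 0\<bar> \<le> e \<and> (\<forall>t>0. \<bar>lin (restrict_pos f) t\<bar> \<le> e)" by blast
  qed
qed

text \<open>At a maximum r of \<bar>X\<bar> on \<open>{0..s}\<close> the memory term is at most C/a
  * \<bar>X r\<bar> and is absorbed on the left. This produces a bound independent of s.\<close>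

lemma solution_bounded:
  assumes sol: "continuous_solution b (- a) h \<xi> X" and \<xi>: "continuous_on {0..} \<xi>"
    and h: "h \<in> borel_measurable borel" "\<And>x. \<bar>h x\<bar> \<le> C * \<bar>x\<bar>" and C: "0 \<le> C" "C < a"
    and lim: "(lin (restrict_pos \<xi>) \<longlongrightarrow> 0) at_top"
  obtains B where "\<And>s. 0 \<le> s \<Longrightarrow> \<bar>X s\<bar> \<le> B"
proof -
  have X: "continuous_on {0..} X" using sol by (simp add: continuous_solution_def)
  obtain T where T: "\<And>t. T \<le> t \<Longrightarrow> \<bar>lin (restrict_pos \<xi>) t\<bar> < 1"
    using tendstoD[OF lim zero_less_one] by (auto simp: eventually_at_top_linorder)
  obtain B1 where B1: "0 \<le> B1" "\<And>s. s \<le> T \<Longrightarrow> \<bar>restrict_pos \<xi> s\<bar> \<le> B1"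
    using restrict_pos_locally_bounded[OF \<xi>] by metis
  define B where "B = max (2 * B1) 1"
  have lin_le: "\<bar>lin (restrict_pos \<xi>) t\<bar> \<le> B" for t
  proof (cases "t \<le> T")
    case True
    then have "\<bar>lin (restrict_pos \<xi>) t\<bar> \<le> 2 * B1"
      by (intro lin_bounded restrict_pos_measurable \<xi> B1) simp
    then show ?thesis by (simp add: B_def)
  next
    case False
    then show ?thesis using T[of t] by (simp add: B_def)
  qed
  have "\<bar>X s\<bar> \<le> max \<bar>X 0\<bar> (B / (1 - C / a))" if "0 \<le> s" for s
  proof -
    have "continuous_on {0..s} (\<lambda>s. \<bar>X s\<bar>)"
      by (intro continuous_intros continuous_on_subset[OF X]) auto
    from continuous_attains_sup[OF compact_Icc _ this] that
    obtain r where "r \<in> {0..s}" "\<forall>u\<in>{0..s}. \<bar>X u\<bar> \<le> \<bar>X r\<bar>" by auto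
    then have r: "0 \<le> r" "r \<le> s" "\<And>u. 0 \<le> u \<Longrightarrow> u \<le> s \<Longrightarrow> \<bar>X u\<bar> \<le> \<bar>X r\<bar>" by auto
    have "\<bar>X r\<bar> \<le> max \<bar>X 0\<bar> (B / (1 - C / a))"
    proof (cases "r = 0")
      case False
      with r have "0 < r" by simp
      have "\<bar>X r\<bar> \<le> \<bar>lin (restrict_pos \<xi>) r\<bar> + C * conv rho (\<lambda>s. \<bar>restrict_pos X s\<bar>) r"
        by (rule solution_le[OF sol \<xi> h(1) \<open>0 < r\<close> C(1)]) (rule h)
      moreover have "a * conv rho (\<lambda>s. \<bar>restrict_pos X s\<bar>) r \<le> \<bar>X r\<bar>"
        by (rule conv_rho_bounded(2)[OF restrict_pos_measurable[OF X]]) (use r in \<open>auto simp: restrict_pos_def\<close>)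
      then have "C / a * (a * conv rho (\<lambda>s. \<bar>restrict_pos X s\<bar>) r) \<le> C / a * \<bar>X r\<bar>"
        using C a by (intro mult_left_mono) auto
      ultimately have "(1 - C / a) * \<bar>X r\<bar> \<le> B"
        using lin_le[of r] a by (simp add: algebra_simps)
      moreover have "0 < 1 - C / a" using C a by simp
      ultimately have "\<bar>X r\<bar> \<le> B / (1 - C / a)"
        by (simp only: pos_le_divide_eq mult.commute)
      then show ?thesis by simp
    qed simp
    then show ?thesis using r(3)[of s] that by simp
  qed
  then show thesis by (rule that)
qed

text \<open>The growth bound on h is asked for along the path only, so that it serves both the
  global case and a solution confined to the region where h is controlled.\<close>

lemma solution_tendsto_0:
  assumes sol: "continuous_solution b (- a) h \<xi> X" and \<xi>: "continuous_on {0..} \<xi>"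
    and h: "h \<in> borel_measurable borel" "\<And>s. 0 \<le> s \<Longrightarrow> \<bar>h (X s)\<bar> \<le> C * \<bar>X s\<bar>" and C: "0 \<le> C" "C < a"
    and lim: "(lin (restrict_pos \<xi>) \<longlongrightarrow> 0) at_top" and B: "\<And>s. 0 \<le> s \<Longrightarrow> \<bar>X s\<bar> \<le> B"
  shows "(X \<longlongrightarrow> 0) at_top"
proof (rule tendsto_0_of_fading_memory[OF _ B _ lim C])
  show "continuous_on {0..} X" using sol by (simp add: continuous_solution_def)
  show "\<bar>X t\<bar> \<le> \<bar>lin (restrict_pos \<xi>) t\<bar> + C * conv rho (\<lambda>s. \<bar>restrict_pos X s\<bar>) t" if "0 < t" for t
    by (rule solution_le[OF sol \<xi> h(1) that C(1)]) (use h in auto)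
qed

text \<open>First exit: \<open>\<bar>X\<bar>\<close> cannot reach \<open>e\<close>, because up to that time the local bound on \<open>h\<close> applies.\<close>

lemma solution_small:
  assumes sol: "continuous_solution b (- a) h \<xi> X" and \<xi>: "continuous_on {0..} \<xi>"
    and h: "h \<in> borel_measurable borel" "\<And>x. \<bar>x\<bar> < e \<Longrightarrow> \<bar>h x\<bar> \<le> C * \<bar>x\<bar>" and C: "0 \<le> C" "C < a"
    and e: "0 < e" and small: "\<bar>\<xi> 0\<bar> \<le> (1 - C / a) * e / 2"
      "\<And>t. 0 < t \<Longrightarrow> \<bar>lin (restrict_pos \<xi>) t\<bar> \<le> (1 - C / a) * e / 2" and t: "0 \<le> t"
  shows "\<bar>X t\<bar> < e"
proof (rule ccontr)
  assume not: "\<not> \<bar>X t\<bar> < e"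
  have X: "continuous_on {0..} X" using sol by (simp add: continuous_solution_def)
  have q: "0 < 1 - C / a" "1 - C / a \<le> 1" using C a by auto
  define S where "S = {0..t} \<inter> (\<lambda>s. \<bar>X s\<bar>) -` {e..}"
  have "closed S"
    unfolding S_def by (intro continuous_closed_preimage continuous_intros continuous_on_subset[OF X]) auto
  moreover have "S \<subseteq> {0..t}" by (auto simp: S_def)
  ultimately have "compact S"
    using compact_Icc compact_Int_closed[of "{0..t}" S] by (simp add: Int_absorb1)
  moreover have "t \<in> S" using not t by (simp add: S_def)
  ultimately obtain T where T: "T \<in> S" and least: "\<And>s. s \<in> S \<Longrightarrow> T \<le> s"
    using compact_attains_inf[of S] by blast
  have XT: "e \<le> \<bar>X T\<bar>" "0 \<le> T" "T \<le> t" using T by (auto simp: S_def)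
  have before: "\<bar>X s\<bar> < e" if "0 \<le> s" "s < T" for s
    using least[of s] that XT by (force simp: S_def)
  have "(1 - C / a) * e / 2 < e" using mult_right_mono[OF q(2), of e] e by simp
  show False
  proof (cases "T = 0")
    \<comment> \<open>\<open>lin\<close> is controlled for positive times only; at time 0 the
      integrals vanish and the solution starts at \<open>\<xi> 0\<close>.\<close>
    case True
    have "(\<lambda>s. indicator {0..0} s *\<^sub>R ((0 - s) powr (b - 1) * f s)) = (\<lambda>s. 0)" for f
      by (auto simp: indicator_def fun_eq_iff)
    then have "frac_integral b f 0 = 0" for f
      unfolding frac_integral_def set_lebesgue_integral_def by (simp only:) simp
    then have "X 0 = \<xi> 0" using sol by (simp add: continuous_solution_def)
    then show False using True XT small(1) \<open>(1 - C / a) * e / 2 < e\<close> by simp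
  next
    case False
    with XT have "0 < T" by simp
    have "\<bar>X T\<bar> \<le> \<bar>lin (restrict_pos \<xi>) T\<bar> + C * conv rho (\<lambda>s. \<bar>restrict_pos X s\<bar>) T"
      by (rule solution_le[OF sol \<xi> h(1) \<open>0 < T\<close> C(1)]) (use h(2) before in auto)
    moreover have "a * conv rho (\<lambda>s. \<bar>restrict_pos X s\<bar>) T \<le> e"
      by (rule conv_rho_bounded(2)[OF restrict_pos_measurable[OF X]])
        (use before e in \<open>auto simp: restrict_pos_def intro: less_imp_le\<close>)
    then have "C / a * (a * conv rho (\<lambda>s. \<bar>restrict_pos X s\<bar>) T) \<le> C / a * e"
      using C a by (intro mult_left_mono) auto
    moreover have "C * conv rho (\<lambda>s. \<bar>restrict_pos X s\<bar>) T = C / a * (a * conv rho (\<lambda>s. \<bar>restrict_pos X s\<bar>) T)"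
      using a by simp
    \<comment> \<open>The memory takes C/a * e, and the data at most half of the remaining (1 - C/a)
      * e, so the sum stays below e.\<close>
    ultimately have "e \<le> (1 - C / a) * e / 2 + C / a * e"
      using small(2)[OF \<open>0 < T\<close>] XT(1) by linarith
    moreover have "0 < (1 - C / a) * e" using q e by simp
    moreover have "(1 - C / a) * e = e - C / a * e" by (simp only: left_diff_distrib mult_1)
    moreover have False if "e \<le> u / 2 + v" "0 < u" "u = e - v" for u v :: real
      using that by linarith
    ultimately show False by blast
  qed
qed

end

theorem theorem3p11:
  fixes \<beta> A \<eta> p :: real and h :: "real \<Rightarrow> real"
  assumes "0 < \<beta>" and "\<beta> < 1" and "A < 0"
    and "h \<in> borel_measurable borel"
    and "0 < \<eta>" and "\<eta> < \<beta> + 1" and "p > max (1 / \<eta>) 1"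
  shows "((\<exists>\<delta>0>0. \<exists>C>0. A + C < 0 \<and> (\<forall>x. \<bar>x\<bar> < \<delta>0 \<longrightarrow> \<bar>h x\<bar> \<le> C * \<bar>x\<bar>)) \<longrightarrow>
            asymptotically_IC_stable \<beta> A h \<eta> p) \<and>
         ((\<exists>C>0. A + C < 0 \<and> (\<forall>x. \<bar>h x\<bar> \<le> C * \<bar>x\<bar>)) \<longrightarrow>
            globally_IC_stable_in_the_large \<beta> A h \<eta> p)"
proof -
  interpret relaxation \<beta> "- A" by unfold_locales (use assms in auto)
  have p: "1 < p" "1 < \<eta> * p" using assms by (auto simp: field_simps)
  note eta = \<open>0 < \<eta>\<close> \<open>\<eta> < \<beta> + 1\<close>
  note h = \<open>h \<in> borel_measurable borel\<close>
  have IC_cont: "continuous_on {0..} \<xi>" if "\<xi> \<in> IC \<beta> \<eta> p" for \<xi>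
    using that by (simp add: IC_def)
  show ?thesis
  proof (intro conjI impI)
    assume "\<exists>C>0. A + C < 0 \<and> (\<forall>x. \<bar>h x\<bar> \<le> C * \<bar>x\<bar>)"
    then obtain C where "0 < C" "A + C < 0" and hC: "\<And>x. \<bar>h x\<bar> \<le> C * \<bar>x\<bar>" by blast
    then have C: "0 \<le> C" "C < - A" by auto
    show "globally_IC_stable_in_the_large \<beta> A h \<eta> p"
      unfolding globally_IC_stable_in_the_large_def
    proof (intro ballI allI impI)
      fix \<xi> X assume xi: "\<xi> \<in> IC \<beta> \<eta> p" and "continuous_solution \<beta> A h \<xi> X"
      then have sol: "continuous_solution \<beta> (- (- A)) h \<xi> X" by simp
      note lim = lin_tendsto_IC[OF xi eta p]
      obtain B where "\<And>s. 0 \<le> s \<Longrightarrow> \<bar>X s\<bar> \<le> B"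
        using solution_bounded[OF sol IC_cont[OF xi] h hC C lim] by blast
      then show "(X \<longlongrightarrow> 0) at_top"
        by (rule solution_tendsto_0[OF sol IC_cont[OF xi] h hC C lim])
    qed
  next
    assume "\<exists>\<delta>0>0. \<exists>C>0. A + C < 0 \<and> (\<forall>x. \<bar>x\<bar> < \<delta>0 \<longrightarrow> \<bar>h x\<bar> \<le> C * \<bar>x\<bar>)"
    then obtain \<delta>0 C where \<delta>0: "0 < \<delta>0" and "0 < C" "A + C < 0"
      and hC: "\<And>x. \<bar>x\<bar> < \<delta>0 \<Longrightarrow> \<bar>h x\<bar> \<le> C * \<bar>x\<bar>" by blast
    then have C: "0 \<le> C" "C < - A" by auto
    \<comment> \<open>Used twice: with a small e for stability, and with e =
      \<open>\<delta>0\<close> to confine solutions to the region where h is controlled.\<close>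
    have stable: "\<exists>\<delta>>0. \<forall>\<xi>\<in>IC \<beta> \<eta> p. norm_X A \<beta> \<eta> p \<xi> < ereal \<delta> \<longrightarrow>
        (\<forall>X. continuous_solution \<beta> A h \<xi> X \<longrightarrow> (\<forall>t\<ge>0. \<bar>X t\<bar> < e))" if e: "0 < e" "e \<le> \<delta>0" for e
    proof -
      have "C / - A < 1" by (subst divide_less_eq_1_pos) (use C a in auto)
      then have "0 < (1 - C / - A) * e / 2" using e by (intro divide_pos_pos mult_pos_pos) auto
      then obtain d where d: "0 < d"
        "\<And>f. f \<in> IC \<beta> \<eta> p \<Longrightarrow> norm_X (- (- A)) \<beta> \<eta> p f < ereal d \<Longrightarrow> \<bar>f 0\<bar> \<le> (1 - C / - A) * e / 2
           \<and> (\<forall>t>0. \<bar>lin (restrict_pos f) t\<bar> \<le> (1 - C / - A) * e / 2)"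
        using lin_bounded_IC[OF eta p] by metis
      show ?thesis
      proof (intro exI[of _ d] conjI ballI impI allI d(1))
        fix \<xi> X t assume xi: "\<xi> \<in> IC \<beta> \<eta> p" and n: "norm_X A \<beta> \<eta> p \<xi> < ereal d"
          and "continuous_solution \<beta> A h \<xi> X" and t: "(0::real) \<le> t"
        then have sol: "continuous_solution \<beta> (- (- A)) h \<xi> X" by simp
        show "\<bar>X t\<bar> < e"
          by (rule solution_small[OF sol IC_cont[OF xi] h _ C e(1) _ _ t]) (use d(2)[OF xi] n hC e in auto)
      qed
    qed
    show "asymptotically_IC_stable \<beta> A h \<eta> p"
      unfolding asymptotically_IC_stable_def IC_stable_def
    proof (intro conjI allI impI)
      fix e :: real assume e: "0 < e"
      \<comment> \<open>Pointwise strict bounds give only a weak bound on the supremum; the halving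
        restores strictness.\<close>
      define e' where "e' = min (e / 2) \<delta>0"
      have e': "0 < e'" "e' \<le> \<delta>0" "e' < e" using e \<delta>0 by (auto simp: e'_def)
      have "sup_norm X < ereal e" if "\<forall>t\<ge>0. \<bar>X t\<bar> < e'" for X
      proof -
        have "sup_norm X \<le> ereal e'"
          unfolding sup_norm_def by (rule SUP_least) (use that in \<open>auto intro: less_imp_le\<close>)
        also have "\<dots> < ereal e" using e' by simp
        finally show ?thesis .
      qed
      then show "\<exists>\<delta>>0. \<forall>\<xi>\<in>IC \<beta> \<eta> p. norm_X A \<beta> \<eta> p \<xi> < ereal \<delta> \<longrightarrow>
          (\<forall>X. continuous_solution \<beta> A h \<xi> X \<longrightarrow> sup_norm X < ereal e)"
        using stable[OF e'(1,2)] by meson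
    next
      \<comment> \<open>Data below this d keep the solution inside \<open>\<delta>0\<close> for all
        times, so the bound on h holds along the whole path.\<close>
      obtain d where d: "0 < d" "\<And>\<xi> X t. \<xi> \<in> IC \<beta> \<eta> p \<Longrightarrow> norm_X A \<beta> \<eta> p \<xi> < ereal d \<Longrightarrow>
          continuous_solution \<beta> A h \<xi> X \<Longrightarrow> 0 \<le> t \<Longrightarrow> \<bar>X t\<bar> < \<delta>0"
        using stable[OF \<delta>0 order.refl] by metis
      show "\<exists>\<delta>>0. \<forall>\<xi>\<in>IC \<beta> \<eta> p. norm_X A \<beta> \<eta> p \<xi> < ereal \<delta> \<longrightarrow>
          (\<forall>X. continuous_solution \<beta> A h \<xi> X \<longrightarrow> (X \<longlongrightarrow> 0) at_top)"
      proof (intro exI[of _ d] conjI ballI impI allI d(1))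
        fix \<xi> X assume xi: "\<xi> \<in> IC \<beta> \<eta> p" and n: "norm_X A \<beta> \<eta> p \<xi> < ereal d"
          and sol: "continuous_solution \<beta> A h \<xi> X"
        note small = d(2)[OF xi n sol]
        from sol have sol': "continuous_solution \<beta> (- (- A)) h \<xi> X" by simp
        show "(X \<longlongrightarrow> 0) at_top"
          by (rule solution_tendsto_0[OF sol' IC_cont[OF xi] h hC[OF small] C lin_tendsto_IC[OF xi eta p] less_imp_le[OF small]])
      qed
    qed
  qed
qed

end
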